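(* Let $d,N\ge 1$ be integers and $\delta\ge 2$ a real number. Consider each of the following four choices of an observable $F$ with values in $\mathbb{R}^p$ and of coefficients $\tilde b(x,\rho)\in\mathbb{R}^d$, $\tilde\sigma(x,\rho)\in\mathbb{R}^{d\times p}$, $a(z)\in\mathbb{R}^p$, $s(z)\in\mathbb{R}^{p\times p}$: (1) (Mean) $F=F_{\mathrm{mean}}$, $p=d$, $\tilde b(x,\rho)=0$, $\tilde\sigma(x,\rho)=I_d$, with $a=0_d$ and $s=I_d$. (2) (Second-order moment) $F=F_{\mathrm{s.m}}$, $p=d$, $$\tilde b(x,\rho)=\Big(\delta-\tfrac32\Big)\frac{x}{4\,m_2(\rho)^2},\qquad \tilde\sigma(x,\rho)=\mathrm{Diag}\Big[\frac{x}{2\,m_2(\rho)}\Big],$$ with $a=a_+^\delta$ and $s=I_d$. (3) (Variance) $F=F_{\mathrm{var}}$, $p=d$, $$\tilde b(x,\rho)=\Big(\delta-\tfrac32\Big)\frac{x-m(\rho)}{4\,\mathrm{Var}(\rho)^2},\qquad \tilde\sigma(x,\rho)=\mathrm{Diag}\Big[\frac{x-m(\rho)}{2\,\mathrm{Var}(\rho)}\Big],$$ with $a=a_+^\delta$ and $s=I_d$. (4) (Mean and variance) $F=[F_{\mathrm{mean}},F_{\mathrm{var}}]$, $p=2d$, $\tilde b$ as in the displayed formula of (3), and the $d\times 2d$ block matrix $$\tilde\sigma(x,\rho)=\Big(I_d\,,\ \mathrm{Diag}\Big[\frac{x-m(\rho)}{2\,\mathrm{Var}(\rho)}\Big]\Big),$$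 with $a(z_1,z_2)=(0_d,a_+^\delta(z_2))$ for $z_1\in\mathbb{R}^d$, $z_2\in(0,\infty)^d$, and $s=I_{2d}$. In each case, let $(B_t)_{t\ge0}$ be a $p$-dimensional Brownian motion (common to all particles), and let $Y_t=(Y^1_t,\dots,Y^N_t)$ be a solution, up to a stopping time $\tau$, of $$\mathrm{d}Y^i_t=\tilde b(Y^i_t,\hat\rho_{Y_t})\,\mathrm{d}t+\tilde\sigma(Y^i_t,\hat\rho_{Y_t})\,\mathrm{d}B_t,\qquad i=1,\dots,N,$$ such that on $[0,\tau)$ all components of the quantity appearing in the denominators ($m_2(\hat\rho_{Y_t})$ in case (2), $\mathrm{Var}(\hat\rho_{Y_t})$ in cases (3) and (4)) are strictly positive. Then on $[0,\tau)$ the macroscopic observable satisfies, whatever the number $N$ of particles, $$\mathrm{d}F(\hat\rho_{Y_t})=a\big(F(\hat\rho_{Y_t})\big)\,\mathrm{d}t+s\big(F(\hat\rho_{Y_t})\big)\,\mathrm{d}B_t .$$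
   Context: For $Y=(Y^1,\dots,Y^N)\in(\mathbb{R}^d)^N$, $\hat\rho_Y=\frac1N\sum_{i=1}^N\delta_{Y^i}$ is the empirical measure. For a probability measure $\rho$ on $\mathbb{R}^d$ with finite second moment and $j$-th one-dimensional marginal $\rho_j$ ($1\le j\le d$): $F_{\mathrm{mean}}(\rho)=m(\rho)=\int x\,\mathrm{d}\rho(x)\in\mathbb{R}^d$; $F_{\mathrm{s.m}}(\rho)=m_2(\rho)=\big(\int_{\mathbb{R}}x^2\,\mathrm{d}\rho_j(x)\big)_{j=1}^d$; $F_{\mathrm{var}}(\rho)=\mathrm{Var}(\rho)=(\mathrm{Var}(\rho_j))_{j=1}^d$, where $\mathrm{Var}(\rho_j)$ is the variance of $\rho_j$; $[F_{\mathrm{mean}},F_{\mathrm{var}}](\rho)\in\mathbb{R}^{2d}$ is the concatenation. Products, squares and quotients of vectors of $\mathbb{R}^d$ are taken componentwise, and $\mathrm{Diag}[v]$ is the diagonal matrix with diagonal $v$. For $z\in(0,\infty)^d$, $a_+^\delta(z)=\big(\frac{\delta-1}{2z_j}\big)_{j=1}^d$, so that $\mathrm{d}Z_t=a_+^\delta(Z_t)\,\mathrm{d}t+\mathrm{d}B_t$ describes $d$ independent Bessel processes of dimension $\delta$. Stochastic differential equations are in the Itô sense. *)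

theory Defs
  imports "HOL-Probability.Probability"
begin

section \<open>Filtered probability spaces, stopping times, Brownian motion\<close>

text \<open>
  Time is \<open>[0, \<infinity>)\<close>. The library's \<open>filtration\<close> is indexed by a whole type, here \<open>real\<close>; the
  \<open>\<sigma>\<close>-algebras at negative times are never used (take \<open>Fl t = Fl 0\<close> for \<open>t < 0\<close>). Completeness and
  right-continuity of the filtration are not required.
\<close>

locale filtered_prob_space =
  prob_space M + filtration "space M" Fl
  for M :: "'w measure" and Fl :: "real \<Rightarrow> 'w measure" +
  assumes subalgebra_Fl: "subalgebra M (Fl t)"

text \<open>
  The library's \<open>stopping_time\<close> takes its values in the index type of the filtration and
  therefore cannot be infinite.
\<close>

definition extended_stopping_time :: "(real \<Rightarrow> 'w measure) \<Rightarrow> ('w \<Rightarrow> ennreal) \<Rightarrow> bool" where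
  "extended_stopping_time Fl \<tau> \<longleftrightarrow> (\<forall>t\<ge>0. Measurable.pred (Fl t) (\<lambda>\<omega>. \<tau> \<omega> \<le> ennreal t))"

definition brownian_motion ::
    "'w measure \<Rightarrow> (real \<Rightarrow> 'w measure) \<Rightarrow> (real \<Rightarrow> 'w \<Rightarrow> real^'p) \<Rightarrow> bool" where
  "brownian_motion M Fl B \<longleftrightarrow>
     (\<forall>t\<ge>0. B t \<in> borel_measurable (Fl t)) \<and>
     (AE \<omega> in M. B 0 \<omega> = 0) \<and>
     (AE \<omega> in M. continuous_on {0..} (\<lambda>t. B t \<omega>)) \<and>
     (\<forall>s t. 0 \<le> s \<longrightarrow> s < t \<longrightarrow>
        prob_space.indep_set M (sets (Fl s))
          {(\<lambda>\<omega>. B t \<omega> - B s \<omega>) -` A \<inter> space M | A. A \<in> sets borel} \<and>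
        prob_space.indep_vars M (\<lambda>_. borel) (\<lambda>k \<omega>. (B t \<omega> - B s \<omega>) $ k) UNIV \<and>
        (\<forall>k. distributed M lborel (\<lambda>\<omega>. (B t \<omega> - B s \<omega>) $ k)
               (\<lambda>x. ennreal (normal_density 0 (sqrt (t - s)) x))))"


section \<open>The Ito integral on a stochastic interval\<close>

text \<open>
  \<open>Elementary m t \<xi>\<close> stands for the process \<open>\<Sum>k<m. \<xi>\<^sub>k 1_{(t\<^sub>k, t\<^sub>k\<^sub>+\<^sub>1]}\<close>.
\<close>

datatype 'w elementary =
  Elementary (stages: nat) (grid: "nat \<Rightarrow> real") (level: "nat \<Rightarrow> 'w \<Rightarrow> real")

definition elementary_process :: "'w measure \<Rightarrow> (real \<Rightarrow> 'w measure) \<Rightarrow> 'w elementary \<Rightarrow> bool" where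
  "elementary_process M Fl E \<longleftrightarrow>
     0 \<le> grid E 0 \<and>
     (\<forall>k<stages E. grid E k \<le> grid E (Suc k) \<and>
        level E k \<in> borel_measurable (Fl (grid E k)) \<and>
        (\<exists>C. \<forall>\<omega>\<in>space M. \<bar>level E k \<omega>\<bar> \<le> C))"

definition elementary_value :: "'w elementary \<Rightarrow> real \<Rightarrow> 'w \<Rightarrow> real" where
  "elementary_value E s \<omega> =
     (\<Sum>k<stages E. level E k \<omega> * indicator {grid E k<..grid E (Suc k)} s)"

definition elementary_integral ::
    "(real \<Rightarrow> 'w \<Rightarrow> real) \<Rightarrow> 'w elementary \<Rightarrow> real \<Rightarrow> 'w \<Rightarrow> real" where
  "elementary_integral W E t \<omega> =
     (\<Sum>k<stages E. level E k \<omega> * (W (min (grid E (Suc k)) t) \<omega> - W (min (grid E k) t) \<omega>))"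

text \<open>
  \<open>ito_integral M Fl W \<tau> H I\<close>: the process \<open>I\<close> is (a version of) \<open>\<integral>\<^sub>0\<^sup>t H\<^sub>s dW\<^sub>s\<close> for \<open>0 \<le> t < \<tau>\<close>,
  where \<open>W\<close> is a one-dimensional Brownian motion. As usual, \<open>I\<close> is the limit of the integrals
  of elementary processes \<open>E\<^sub>n\<close> with \<open>\<integral>\<^sub>0\<^sup>t (E\<^sub>n - H)\<^sup>2 ds \<longrightarrow> 0\<close>. Limits in probability (on the events
  \<open>{t < \<tau>}\<close>, locally uniformly in \<open>t\<close> for the integrals) become almost sure along a subsequence, and
  almost sure convergence is required here; so this is the usual integral for all adapted \<open>H\<close> with
  \<open>\<integral>\<^sub>0\<^sup>t H\<^sub>s\<^sup>2 ds < \<infinity>\<close> almost surely for \<open>t < \<tau>\<close>. Adaptedness of \<open>H\<close> on \<open>[0, \<tau>)\<close>, up to null sets, is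
  implied by the approximation by elementary processes. Nothing is required from \<open>\<tau>\<close> on.
\<close>

definition ito_integral ::
    "'w measure \<Rightarrow> (real \<Rightarrow> 'w measure) \<Rightarrow> (real \<Rightarrow> 'w \<Rightarrow> real) \<Rightarrow> ('w \<Rightarrow> ennreal) \<Rightarrow>
     (real \<Rightarrow> 'w \<Rightarrow> real) \<Rightarrow> (real \<Rightarrow> 'w \<Rightarrow> real) \<Rightarrow> bool" where
  "ito_integral M Fl W \<tau> H I \<longleftrightarrow>
     (\<exists>E :: nat \<Rightarrow> 'w elementary.
        (\<forall>n. elementary_process M Fl (E n)) \<and>
        (AE \<omega> in M. \<forall>t\<ge>0. ennreal t < \<tau> \<omega> \<longrightarrow>
           (\<forall>n. set_integrable lborel {0..t} (\<lambda>s. (elementary_value (E n) s \<omega> - H s \<omega>)\<^sup>2)) \<and>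
           ((\<lambda>n. LINT s:{0..t}|lborel. (elementary_value (E n) s \<omega> - H s \<omega>)\<^sup>2)
              \<longlonglongrightarrow> 0) \<and>
           uniform_limit {0..t} (\<lambda>n u. elementary_integral W (E n) u \<omega>) (\<lambda>u. I u \<omega>)
             sequentially))"

text \<open>
  \<open>ito_differential M Fl B \<tau> X \<beta> \<Sigma>\<close>: \<open>dX\<^sub>t = \<beta>\<^sub>t dt + \<Sigma>\<^sub>t dB\<^sub>t\<close> on \<open>[0, \<tau>)\<close>. The values of \<open>X\<close>, \<open>\<beta>\<close>, \<open>\<Sigma>\<close>
  from \<open>\<tau>\<close> on are irrelevant.
\<close>

definition ito_differential ::
    "'w measure \<Rightarrow> (real \<Rightarrow> 'w measure) \<Rightarrow> (real \<Rightarrow> 'w \<Rightarrow> real^'p) \<Rightarrow> ('w \<Rightarrow> ennreal) \<Rightarrow>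
     (real \<Rightarrow> 'w \<Rightarrow> real^'q) \<Rightarrow> (real \<Rightarrow> 'w \<Rightarrow> real^'q) \<Rightarrow> (real \<Rightarrow> 'w \<Rightarrow> real^'p^'q) \<Rightarrow> bool" where
  "ito_differential M Fl B \<tau> X \<beta> \<Sigma> \<longleftrightarrow>
     (\<forall>t\<ge>0. (\<lambda>\<omega>. if ennreal t < \<tau> \<omega> then X t \<omega> else 0) \<in> borel_measurable (Fl t)) \<and>
     (AE \<omega> in M. continuous_on {t. 0 \<le> t \<and> ennreal t < \<tau> \<omega>} (\<lambda>t. X t \<omega>)) \<and>
     (\<exists>J :: 'q \<Rightarrow> 'p \<Rightarrow> real \<Rightarrow> 'w \<Rightarrow> real.
        (\<forall>j k. ito_integral M Fl (\<lambda>t \<omega>. B t \<omega> $ k) \<tau> (\<lambda>t \<omega>. \<Sigma> t \<omega> $ j $ k) (J j k)) \<and>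
        (AE \<omega> in M. \<forall>t\<ge>0. ennreal t < \<tau> \<omega> \<longrightarrow>
           set_integrable lborel {0..t} (\<lambda>s. \<beta> s \<omega>) \<and>
           X t \<omega> = X 0 \<omega> + (LINT s:{0..t}|lborel. \<beta> s \<omega>) + (\<chi> j. \<Sum>k\<in>UNIV. J j k t \<omega>)))"

definition sde_solution ::
    "'w measure \<Rightarrow> (real \<Rightarrow> 'w measure) \<Rightarrow> (real \<Rightarrow> 'w \<Rightarrow> real^'p) \<Rightarrow> ('w \<Rightarrow> ennreal) \<Rightarrow>
     (real^'q \<Rightarrow> real^'q) \<Rightarrow> (real^'q \<Rightarrow> real^'p^'q) \<Rightarrow> (real \<Rightarrow> 'w \<Rightarrow> real^'q) \<Rightarrow> bool" where
  "sde_solution M Fl B \<tau> a s Z \<longleftrightarrow>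
     ito_differential M Fl B \<tau> Z (\<lambda>t \<omega>. a (Z t \<omega>)) (\<lambda>t \<omega>. s (Z t \<omega>))"


section \<open>Empirical measures, observables and particle systems\<close>

text \<open>The law of \<open>Y$i\<close> for a uniformly chosen index \<open>i\<close>, i.e. \<open>1/N \<Sum>\<^sub>i \<delta>\<^bsub>Y$i\<^esub>\<close>.\<close>

definition empirical :: "(real^'d)^'n \<Rightarrow> (real^'d) measure" where
  "empirical Y = distr (uniform_count_measure (UNIV :: 'n set)) borel (\<lambda>i. Y $ i)"

lemma emeasure_empirical:
  fixes Y :: "(real^'d)^'n"
  assumes "A \<in> sets borel"
  shows "emeasure (empirical Y) A =
    (\<Sum>i\<in>UNIV. emeasure (return borel (Y $ i)) A) / of_nat CARD('n)"
proof -
  have "emeasure (empirical Y) A = emeasure (uniform_count_measure (UNIV :: 'n set)) {i. Y $ i \<in> A}"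
    using assms unfolding empirical_def
    by (subst emeasure_distr)
       (auto simp: space_uniform_count_measure sets_uniform_count_measure measurable_def vimage_def)
  also have "\<dots> = of_nat (card {i. Y $ i \<in> A}) / of_nat CARD('n)"
    by (simp add: emeasure_uniform_count_measure ennreal_of_nat_eq_real_of_nat divide_ennreal)
  also have "of_nat (card {i. Y $ i \<in> A}) = (\<Sum>i\<in>UNIV. emeasure (return borel (Y $ i)) A)"
    using assms by (simp add: indicator_def sum.If_cases)
  finally show ?thesis .
qed

definition marginal :: "(real^'d) measure \<Rightarrow> 'd \<Rightarrow> real measure" where
  "marginal \<rho> j = distr \<rho> borel (\<lambda>x. x $ j)"

definition mean :: "(real^'d) measure \<Rightarrow> real^'d" where
  "mean \<rho> = (\<integral>x. x \<partial>\<rho>)"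

definition second_moment :: "(real^'d) measure \<Rightarrow> real^'d" where
  "second_moment \<rho> = (\<chi> j. \<integral>x. x\<^sup>2 \<partial>marginal \<rho> j)"

definition Var :: "(real^'d) measure \<Rightarrow> real^'d" where
  "Var \<rho> = (\<chi> j. prob_space.variance (marginal \<rho> j) (\<lambda>x. x))"

text \<open>\<open>\<real>\<^sup>2\<^sup>d\<close> is rendered as \<open>real^('d + 'd)\<close>, the first block being indexed by \<open>Inl\<close>.\<close>

definition concat_vec :: "real^'a \<Rightarrow> real^'b \<Rightarrow> real^('a::finite + 'b::finite)" where
  "concat_vec u v = (\<chi> k. case k of Inl i \<Rightarrow> u $ i | Inr j \<Rightarrow> v $ j)"

definition second_block :: "real^('a::finite + 'b::finite) \<Rightarrow> real^'b" where
  "second_block z = (\<chi> j. z $ Inr j)"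

definition mean_var :: "(real^'d) measure \<Rightarrow> real^('d::finite + 'd)" where
  "mean_var \<rho> = concat_vec (mean \<rho>) (Var \<rho>)"

definition Diag :: "real^'d \<Rightarrow> real^'d^'d" where
  "Diag v = (\<chi> i j. if i = j then v $ i else 0)"

definition hblock :: "real^'a^'d \<Rightarrow> real^'b^'d \<Rightarrow> real^('a::finite + 'b::finite)^'d" where
  "hblock S T = (\<chi> i. concat_vec (S $ i) (T $ i))"

definition bessel_drift :: "real \<Rightarrow> real^'d \<Rightarrow> real^'d" where
  "bessel_drift \<delta> z = (\<chi> j. (\<delta> - 1) / (2 * z $ j))"

definition drift_sm :: "real \<Rightarrow> real^'d \<Rightarrow> (real^'d) measure \<Rightarrow> real^'d" where
  "drift_sm \<delta> x \<rho> = (\<chi> j. (\<delta> - 3/2) * (x $ j / (4 * (second_moment \<rho> $ j)\<^sup>2)))"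

definition diffusion_sm :: "real^'d \<Rightarrow> (real^'d) measure \<Rightarrow> real^'d^'d" where
  "diffusion_sm x \<rho> = Diag (\<chi> j. x $ j / (2 * second_moment \<rho> $ j))"

definition drift_var :: "real \<Rightarrow> real^'d \<Rightarrow> (real^'d) measure \<Rightarrow> real^'d" where
  "drift_var \<delta> x \<rho> = (\<chi> j. (\<delta> - 3/2) * ((x $ j - mean \<rho> $ j) / (4 * (Var \<rho> $ j)\<^sup>2)))"

definition diffusion_var :: "real^'d \<Rightarrow> (real^'d) measure \<Rightarrow> real^'d^'d" where
  "diffusion_var x \<rho> = Diag (\<chi> j. (x $ j - mean \<rho> $ j) / (2 * Var \<rho> $ j))"

definition particle_solution ::
    "'w measure \<Rightarrow> (real \<Rightarrow> 'w measure) \<Rightarrow> (real \<Rightarrow> 'w \<Rightarrow> real^'p) \<Rightarrow> ('w \<Rightarrow> ennreal) \<Rightarrow>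
     (real^'d \<Rightarrow> (real^'d) measure \<Rightarrow> real^'d) \<Rightarrow>
     (real^'d \<Rightarrow> (real^'d) measure \<Rightarrow> real^'p^'d) \<Rightarrow>
     (real \<Rightarrow> 'w \<Rightarrow> (real^'d)^'n) \<Rightarrow> bool" where
  "particle_solution M Fl B \<tau> b \<sigma> Y \<longleftrightarrow>
     (\<forall>i. ito_differential M Fl B \<tau> (\<lambda>t \<omega>. Y t \<omega> $ i)
            (\<lambda>t \<omega>. b (Y t \<omega> $ i) (empirical (Y t \<omega>)))
            (\<lambda>t \<omega>. \<sigma> (Y t \<omega> $ i) (empirical (Y t \<omega>))))"

definition positive_before ::
    "'w measure \<Rightarrow> ('w \<Rightarrow> ennreal) \<Rightarrow> (real \<Rightarrow> 'w \<Rightarrow> real^'d) \<Rightarrow> bool" where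
  "positive_before M \<tau> Z \<longleftrightarrow>
     (AE \<omega> in M. \<forall>t\<ge>0. ennreal t < \<tau> \<omega> \<longrightarrow> (\<forall>j. 0 < Z t \<omega> $ j))"

end

theory Submission
  imports Defs
begin

text \<open>
  With \<open>D\<^sup>i = Y\<^sup>i - m\<close>, the Ito formula for the square gives
  \<open>d(D\<^sup>i)\<^sup>2 = (2 D\<^sup>i b\<^sup>i + (\<sigma>\<^sup>i)\<^sup>2) dt + 2 D\<^sup>i \<sigma>\<^sup>i dB\<close>; as \<open>b\<^sup>i\<close> and \<open>\<sigma>\<^sup>i\<close> are multiples of \<open>D\<^sup>i\<close>, averaging over
  \<open>i\<close> expresses these coefficients through the variance alone, while in the equation of the mean they
  average to zero. The second moment is the same computation without centring.

  The Ito formula for \<open>X = X\<^sub>0 + \<integral> \<beta> dt + I\<close> is obtained from the approximations \<open>E\<^sub>n\<cdot>W\<close> of \<open>I\<close> by summation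
  by parts along dyadic partitions, of mesh so small, depending on \<open>n\<close>, that the quadratic variation of
  \<open>E\<^sub>n\<cdot>W\<close> along them is almost surely asymptotic to \<open>\<integral> E\<^sub>n\<^sup>2 dt\<close> at rational times. Since only one Brownian
  component may drive the squared process, stochastic integrals of vanishing integrands have to be
  discarded: they are zero because a truncation and the isometry bound \<open>E\<^sub>n\<cdot>W\<close> by \<open>\<integral> E\<^sub>n\<^sup>2 dt\<close> in
  probability.
\<close>

section \<open>One-dimensional Brownian motion\<close>

text \<open>Each component of an observable is an average of coordinates or of their squares,
  centred or not, and the denominators enter only the coefficients; squaring is thus the one
  nonlinear operation to be differentiated. The obstacle is the form of the Ito integral: it is
  known only through some sequence of elementary processes that converges path by path, without a
  rate, on a random time interval. So limits are taken on single paths, probability enters through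
  null sets fixed beforehand, and every new integral has to come with elementary processes of its
  own; for products and linear combinations these arise by merging grids. In the discrete product
  rule the sum against the martingale part is never estimated: it converges because all other terms
  do. Centring removes the noise that acts equally on all particles, so that no cross variation of
  two Brownian components arises. The constant \<open>\<delta> - 3/2\<close> makes room for the Ito
  correction: \<open>2 * (\<delta> - 3/2) + 1 = 2 * (\<delta> - 1)\<close>.\<close>

locale real_brownian = filtered_prob_space M Fl
  for M :: "'w measure" and Fl :: "real \<Rightarrow> 'w measure" +
  fixes W :: "real \<Rightarrow> 'w \<Rightarrow> real"
  assumes W_adapted: "\<And>t. 0 \<le> t \<Longrightarrow> W t \<in> borel_measurable (Fl t)"
    and W_continuous: "AE \<omega> in M. continuous_on {0..} (\<lambda>t. W t \<omega>)"
    and W_indep: "\<And>s t. 0 \<le> s \<Longrightarrow> s < t \<Longrightarrow>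
      indep_set (sets (Fl s)) {(\<lambda>\<omega>. W t \<omega> - W s \<omega>) -` A \<inter> space M | A. A \<in> sets borel}"
    and W_normal: "\<And>s t. 0 \<le> s \<Longrightarrow> s < t \<Longrightarrow>
      distributed M lborel (\<lambda>\<omega>. W t \<omega> - W s \<omega>) (\<lambda>x. ennreal (normal_density 0 (sqrt (t - s)) x))"

lemma (in prob_space) indep_set_mono:
  assumes "indep_set A B" "A' \<subseteq> A" "B' \<subseteq> B"
  shows "indep_set A' B'"
  using assms unfolding indep_sets2_eq by (meson subset_iff)

lemma real_brownian_component:
  fixes B :: "real \<Rightarrow> 'w \<Rightarrow> real^'p"
  assumes "filtered_prob_space M Fl" and B: "brownian_motion M Fl B"
  shows "real_brownian M Fl (\<lambda>t \<omega>. B t \<omega> $ k)"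
proof -
  interpret filtered_prob_space M Fl by fact
  have *: "(\<lambda>x::real^'p. x $ k) \<in> borel_measurable borel"
    by (intro borel_measurable_continuous_onI continuous_intros)
  show ?thesis
  proof
    fix t :: real assume "0 \<le> t"
    then have "B t \<in> borel_measurable (Fl t)" using B by (auto simp: brownian_motion_def)
    from measurable_compose[OF this *] show "(\<lambda>\<omega>. B t \<omega> $ k) \<in> borel_measurable (Fl t)" .
  next
    have "AE \<omega> in M. continuous_on {0..} (\<lambda>t. B t \<omega>)" using B by (auto simp: brownian_motion_def)
    then show "AE \<omega> in M. continuous_on {0..} (\<lambda>t. B t \<omega> $ k)"
      by eventually_elim (intro continuous_intros)
  next
    fix s t :: real assume st: "0 \<le> s" "s < t"
    have ind: "indep_set (sets (Fl s)) {(\<lambda>\<omega>. B t \<omega> - B s \<omega>) -` A \<inter> space M | A. A \<in> sets borel}"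
      using B st unfolding brownian_motion_def by blast
    have sub: "{(\<lambda>\<omega>. B t \<omega> $ k - B s \<omega> $ k) -` A \<inter> space M |A. A \<in> sets borel}
      \<subseteq> {(\<lambda>\<omega>. B t \<omega> - B s \<omega>) -` A \<inter> space M | A. A \<in> sets borel}"
    proof safe
      fix A :: "real set" assume "A \<in> sets borel"
      then have "(\<lambda>x::real^'p. x $ k) -` A \<in> sets borel"
        using measurable_sets[OF *, of A] by simp
      moreover have "(\<lambda>\<omega>. B t \<omega> $ k - B s \<omega> $ k) -` A \<inter> space M
        = (\<lambda>\<omega>. B t \<omega> - B s \<omega>) -` ((\<lambda>x::real^'p. x $ k) -` A) \<inter> space M" by auto
      ultimately show "\<exists>A'. (\<lambda>\<omega>. B t \<omega> $ k - B s \<omega> $ k) -` A \<inter> space M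
         = (\<lambda>\<omega>. B t \<omega> - B s \<omega>) -` A' \<inter> space M \<and> A' \<in> sets borel" by blast
    qed
    show "indep_set (sets (Fl s))
        {(\<lambda>\<omega>. B t \<omega> $ k - B s \<omega> $ k) -` A \<inter> space M |A. A \<in> sets borel}"
      by (rule indep_set_mono[OF ind subset_refl sub])
    have "distributed M lborel (\<lambda>\<omega>. (B t \<omega> - B s \<omega>) $ k)
        (\<lambda>x. ennreal (normal_density 0 (sqrt (t - s)) x))"
      using B st unfolding brownian_motion_def by blast
    then show "distributed M lborel (\<lambda>\<omega>. B t \<omega> $ k - B s \<omega> $ k)
        (\<lambda>x. ennreal (normal_density 0 (sqrt (t - s)) x))"
      by simp
  qed
qed

context filtered_prob_space
begin

lemma measurable_Fl_mono:
  "f \<in> borel_measurable (Fl s) \<Longrightarrow> s \<le> t \<Longrightarrow> f \<in> borel_measurable (Fl t)"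
  using sets_F_mono[of s t] space_F by (auto simp: measurable_def)

lemma measurable_Fl_M: "f \<in> borel_measurable (Fl s) \<Longrightarrow> f \<in> borel_measurable M"
  using measurable_from_subalg[OF subalgebra_Fl] .

end

context real_brownian
begin

section \<open>Independence and moments of the increments\<close>

lemma W_measurable: "0 \<le> t \<Longrightarrow> W t \<in> borel_measurable M"
  by (rule measurable_Fl_M[OF W_adapted])

text \<open>\<open>W_indep\<close> speaks of families of sets, while independence of random
  variables concerns generated sigma-algebras. The one of \<open>X\<close> lies inside
  \<open>Fl s\<close>, and the preimages under the increment already form a sigma-algebra, so
  generating adds nothing.\<close>

lemma indep_increment:
  fixes X :: "'w \<Rightarrow> real" and g :: "real \<Rightarrow> real"
  assumes st: "0 \<le> s" "s < t" and X: "X \<in> borel_measurable (Fl s)"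
    and g: "g \<in> borel_measurable borel"
  shows "indep_var borel X borel (\<lambda>\<omega>. g (W t \<omega> - W s \<omega>))"
proof -
  let ?D = "\<lambda>\<omega>. W t \<omega> - W s \<omega>"
  have D: "?D \<in> borel_measurable M" using st W_measurable[of s] W_measurable[of t] by simp
  have "indep_var borel X borel ?D"
    unfolding indep_var_eq
  proof (intro conjI)
    show "random_variable borel X" using X by (rule measurable_Fl_M)
    show "random_variable borel ?D" using D .
    have "sigma_sets (space M) {X -` A \<inter> space M | A. A \<in> sets borel} \<subseteq> sets (Fl s)"
      using sets.sigma_sets_subset[of "{X -` A \<inter> space M | A. A \<in> sets borel}" "Fl s"]
        measurable_sets[OF X] by (auto simp: space_F)
    moreover have "sigma_sets (space M) {?D -` A \<inter> space M | A. A \<in> sets borel}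
       = {?D -` A \<inter> space M | A. A \<in> sets borel}"
      using sets_vimage_algebra[of "space M" ?D borel]
        sets.sigma_sets_eq[of "vimage_algebra (space M) ?D borel"]
        sets_vimage_algebra2[of ?D "space M" borel]
      by simp
    ultimately have "sigma_sets (space M) {X -` A \<inter> space M | A. A \<in> sets borel} \<subseteq> sets (Fl s)"
      "sigma_sets (space M) {?D -` A \<inter> space M | A. A \<in> sets borel}
        \<subseteq> {?D -` A \<inter> space M | A. A \<in> sets borel}" by auto
    then show "indep_set (sigma_sets (space M) {X -` A \<inter> space M | A. A \<in> sets borel})
      (sigma_sets (space M) {?D -` A \<inter> space M | A. A \<in> sets borel})"
      by (rule indep_set_mono[OF W_indep[OF st]])
  qed
  from indep_var_compose[OF this, of id borel g borel] g show ?thesis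
    by (simp add: comp_def)
qed

lemma increment_moment:
  assumes st: "0 \<le> s" "s < t"
  shows "integrable M (\<lambda>\<omega>. (W t \<omega> - W s \<omega>) ^ k)"
    and "expectation (\<lambda>\<omega>. (W t \<omega> - W s \<omega>) ^ k) = (LINT x|lborel. normal_density 0 (sqrt (t - s)) x * x ^ k)"
proof -
  have "0 < sqrt (t - s)" using st by simp
  from integrable_normal_moment[OF this, of 0 k]
  have i: "integrable lborel (\<lambda>x. normal_density 0 (sqrt (t - s)) x * x ^ k)" by simp
  show "integrable M (\<lambda>\<omega>. (W t \<omega> - W s \<omega>) ^ k)"
    using distributed_integrable[OF W_normal[OF st], of "\<lambda>x. x ^ k"] i by simp
  show "expectation (\<lambda>\<omega>. (W t \<omega> - W s \<omega>) ^ k) = (LINT x|lborel. normal_density 0 (sqrt (t - s)) x * x ^ k)"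
    using distributed_integral[OF W_normal[OF st], of "\<lambda>x. x ^ k"] by simp
qed

lemma increment_moments:
  assumes st: "0 \<le> s" "s < t"
  shows "expectation (\<lambda>\<omega>. W t \<omega> - W s \<omega>) = 0"
    and "expectation (\<lambda>\<omega>. (W t \<omega> - W s \<omega>)\<^sup>2) = t - s"
    and "expectation (\<lambda>\<omega>. (W t \<omega> - W s \<omega>) ^ 4) = 3 * (t - s)\<^sup>2"
proof -
  have p: "0 < sqrt (t - s)" using st by simp
  show "expectation (\<lambda>\<omega>. W t \<omega> - W s \<omega>) = 0"
    using increment_moment(2)[OF st, of 1] integral_normal_moment_odd[OF p, of 0 0] by simp
  show "expectation (\<lambda>\<omega>. (W t \<omega> - W s \<omega>)\<^sup>2) = t - s"
    using increment_moment(2)[OF st, of 2] integral_normal_moment_even[OF p, of 0 1] st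
    by (simp add: fact_numeral)
  show "expectation (\<lambda>\<omega>. (W t \<omega> - W s \<omega>) ^ 4) = 3 * (t - s)\<^sup>2"
    using increment_moment(2)[OF st, of 4] integral_normal_moment_even[OF p, of 0 2] st
    by (simp add: fact_numeral power2_eq_square)
qed

section \<open>Second moments of sums with orthogonal terms\<close>

lemma indep_increment_product:
  fixes X :: "'w \<Rightarrow> real" and g :: "real \<Rightarrow> real"
  assumes st: "0 \<le> s" "s < t" and X: "X \<in> borel_measurable (Fl s)" "integrable M X"
    and g: "g \<in> borel_measurable borel" "integrable M (\<lambda>\<omega>. g (W t \<omega> - W s \<omega>))"
  shows "integrable M (\<lambda>\<omega>. X \<omega> * g (W t \<omega> - W s \<omega>))"
    and "expectation (\<lambda>\<omega>. X \<omega> * g (W t \<omega> - W s \<omega>)) = expectation X * expectation (\<lambda>\<omega>. g (W t \<omega> - W s \<omega>))"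
  using indep_var_integrable[OF indep_increment[OF st X(1) g(1)] X(2) g(2)]
    indep_var_lebesgue_integral[OF indep_increment[OF st X(1) g(1)] X(2) g(2)] by auto

text \<open>Covers both the Ito isometry (\<open>D\<close> an increment of \<open>W\<close>) and the second moment of
  the quadratic variation error (\<open>D\<close> a centred squared increment).\<close>

lemma expectation_orthogonal_sum_square:
  fixes u :: "nat \<Rightarrow> real" and \<xi> D :: "nat \<Rightarrow> 'w \<Rightarrow> real" and v :: "nat \<Rightarrow> real"
  assumes u: "\<And>k. u k \<le> u (Suc k)"
    and \<xi>: "\<And>k. \<xi> k \<in> borel_measurable (Fl (u k))" "\<And>k \<omega>. \<omega> \<in> space M \<Longrightarrow> \<bar>\<xi> k \<omega>\<bar> \<le> C k"
    and D: "\<And>k. D k \<in> borel_measurable (Fl (u (Suc k)))"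
    and centred: "\<And>k X. X \<in> borel_measurable (Fl (u k)) \<Longrightarrow> integrable M X \<Longrightarrow>
       integrable M (\<lambda>\<omega>. X \<omega> * D k \<omega>) \<and> expectation (\<lambda>\<omega>. X \<omega> * D k \<omega>) = 0"
    and variance: "\<And>k X. X \<in> borel_measurable (Fl (u k)) \<Longrightarrow> integrable M X \<Longrightarrow>
       integrable M (\<lambda>\<omega>. X \<omega> * (D k \<omega>)\<^sup>2) \<and> expectation (\<lambda>\<omega>. X \<omega> * (D k \<omega>)\<^sup>2) = expectation X * v k"
  shows "(\<lambda>\<omega>. \<Sum>k<n. \<xi> k \<omega> * D k \<omega>) \<in> borel_measurable (Fl (u n)) \<and>
    integrable M (\<lambda>\<omega>. (\<Sum>k<n. \<xi> k \<omega> * D k \<omega>)\<^sup>2) \<and>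
    expectation (\<lambda>\<omega>. (\<Sum>k<n. \<xi> k \<omega> * D k \<omega>)\<^sup>2) = (\<Sum>k<n. expectation (\<lambda>\<omega>. (\<xi> k \<omega>)\<^sup>2) * v k)"
proof (induction n)
  case 0
  show ?case by simp
next
  case (Suc n)
  let ?S = "\<lambda>\<omega>. \<Sum>k<n. \<xi> k \<omega> * D k \<omega>"
  have S: "?S \<in> borel_measurable (Fl (u n))" and S2: "integrable M (\<lambda>\<omega>. (?S \<omega>)\<^sup>2)"
    and ES: "expectation (\<lambda>\<omega>. (?S \<omega>)\<^sup>2) = (\<Sum>k<n. expectation (\<lambda>\<omega>. (\<xi> k \<omega>)\<^sup>2) * v k)"
    using Suc.IH by auto
  have SM: "?S \<in> borel_measurable M" using S by (rule measurable_Fl_M)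
  have xiM: "\<xi> n \<in> borel_measurable M" using \<xi>(1) by (rule measurable_Fl_M)
  have S1: "integrable M ?S"
    by (rule square_integrable_imp_integrable[OF SM S2])
  have xi2: "integrable M (\<lambda>\<omega>. (\<xi> n \<omega>)\<^sup>2)"
    using xiM \<xi>(2)[of _ n] abs_le_square_iff[of _ "C n"]
    by (intro integrable_const_bound[where B="(C n)\<^sup>2"] AE_I2) (auto, force)
  have Sxi: "integrable M (\<lambda>\<omega>. 2 * ?S \<omega> * \<xi> n \<omega>)"
  proof (rule Bochner_Integration.integrable_bound)
    show "integrable M (\<lambda>\<omega>. 2 * C n * ?S \<omega>)" using S1 by simp
    show "(\<lambda>\<omega>. 2 * ?S \<omega> * \<xi> n \<omega>) \<in> borel_measurable M" using SM xiM by measurable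
    show "AE \<omega> in M. norm (2 * ?S \<omega> * \<xi> n \<omega>) \<le> norm (2 * C n * ?S \<omega>)"
    proof (rule AE_I2)
      fix \<omega> assume "\<omega> \<in> space M"
      then have "\<bar>\<xi> n \<omega>\<bar> \<le> \<bar>C n\<bar>" using \<xi>(2)[of \<omega> n] by linarith
      then show "norm (2 * ?S \<omega> * \<xi> n \<omega>) \<le> norm (2 * C n * ?S \<omega>)"
        by (simp add: abs_mult mult.commute mult_right_mono)
    qed
  qed
  \<comment> \<open>\<open>2 * ?S * \<xi> n\<close> is known at time \<open>u n\<close>, so
    \<open>centred\<close> kills the cross term of the square: this is the orthogonality.
    Boundedness of \<open>\<xi> n\<close> was needed to make this product integrable.\<close>
  have c: "integrable M (\<lambda>\<omega>. 2 * ?S \<omega> * \<xi> n \<omega> * D n \<omega>)" "expectation (\<lambda>\<omega>. 2 * ?S \<omega> * \<xi> n \<omega> * D n \<omega>) = 0"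
    using centred[of "\<lambda>\<omega>. 2 * ?S \<omega> * \<xi> n \<omega>" n] S \<xi>(1)[of n] Sxi by auto
  have q: "integrable M (\<lambda>\<omega>. (\<xi> n \<omega>)\<^sup>2 * (D n \<omega>)\<^sup>2)"
     "expectation (\<lambda>\<omega>. (\<xi> n \<omega>)\<^sup>2 * (D n \<omega>)\<^sup>2) = expectation (\<lambda>\<omega>. (\<xi> n \<omega>)\<^sup>2) * v n"
    using variance[of "\<lambda>\<omega>. (\<xi> n \<omega>)\<^sup>2" n] \<xi>(1)[of n] xi2 by auto
  have eq: "(\<Sum>k<Suc n. \<xi> k \<omega> * D k \<omega>)\<^sup>2 =
     (?S \<omega>)\<^sup>2 + 2 * ?S \<omega> * \<xi> n \<omega> * D n \<omega> + (\<xi> n \<omega>)\<^sup>2 * (D n \<omega>)\<^sup>2" for \<omega>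
    by (simp add: power2_eq_square algebra_simps)
  have "(\<lambda>\<omega>. \<Sum>k<Suc n. \<xi> k \<omega> * D k \<omega>) \<in> borel_measurable (Fl (u (Suc n)))"
    using measurable_Fl_mono[OF S u] measurable_Fl_mono[OF \<xi>(1)[of n] u] D[of n] by simp
  moreover have "integrable M (\<lambda>\<omega>. (\<Sum>k<Suc n. \<xi> k \<omega> * D k \<omega>)\<^sup>2)"
    unfolding eq using S2 c q by auto
  moreover have "expectation (\<lambda>\<omega>. (\<Sum>k<Suc n. \<xi> k \<omega> * D k \<omega>)\<^sup>2)
      = (\<Sum>k<Suc n. expectation (\<lambda>\<omega>. (\<xi> k \<omega>)\<^sup>2) * v k)"
    unfolding eq using S2 c q ES by simp
  ultimately show ?case by blast
qed

text \<open>The Ito isometry on a deterministic grid: given the past, an increment has mean 0 and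
  variance equal to its length.\<close>

lemma expectation_stochastic_sum_square:
  fixes u :: "nat \<Rightarrow> real" and \<xi> :: "nat \<Rightarrow> 'w \<Rightarrow> real"
  assumes u: "\<And>k. 0 \<le> u k" "\<And>k. u k \<le> u (Suc k)"
    and \<xi>: "\<And>k. \<xi> k \<in> borel_measurable (Fl (u k))" "\<And>k \<omega>. \<omega> \<in> space M \<Longrightarrow> \<bar>\<xi> k \<omega>\<bar> \<le> C k"
  shows "integrable M (\<lambda>\<omega>. (\<Sum>k<n. \<xi> k \<omega> * (W (u (Suc k)) \<omega> - W (u k) \<omega>))\<^sup>2)"
    and "expectation (\<lambda>\<omega>. (\<Sum>k<n. \<xi> k \<omega> * (W (u (Suc k)) \<omega> - W (u k) \<omega>))\<^sup>2)
      = (\<Sum>k<n. expectation (\<lambda>\<omega>. (\<xi> k \<omega>)\<^sup>2) * (u (Suc k) - u k))"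
proof -
  let ?D = "\<lambda>k \<omega>. W (u (Suc k)) \<omega> - W (u k) \<omega>"
  have D: "?D k \<in> borel_measurable (Fl (u (Suc k)))" for k
    using W_adapted[OF u(1)[of "Suc k"]] measurable_Fl_mono[OF W_adapted[OF u(1)[of k]] u(2)] by simp
  have mom: "integrable M (\<lambda>\<omega>. X \<omega> * ?D k \<omega>) \<and> expectation (\<lambda>\<omega>. X \<omega> * ?D k \<omega>) = 0 \<and>
      integrable M (\<lambda>\<omega>. X \<omega> * (?D k \<omega>)\<^sup>2) \<and> expectation (\<lambda>\<omega>. X \<omega> * (?D k \<omega>)\<^sup>2) = expectation X * (u (Suc k) - u k)"
    if X: "X \<in> borel_measurable (Fl (u k))" "integrable M X" for k X
  \<comment> \<open>Grids stopped at a fixed time repeat their last point; there the increment is 0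
    and no normal law is available.\<close>
  proof (cases "u k = u (Suc k)")
    case False
    then have lt: "u k < u (Suc k)" using u(2)[of k] by linarith
    show ?thesis
      using indep_increment_product[OF u(1) lt X, of "\<lambda>x. x"]
        indep_increment_product[OF u(1) lt X, of "\<lambda>x. x\<^sup>2"]
        increment_moment(1)[OF u(1) lt, of 1] increment_moment(1)[OF u(1) lt, of 2]
        increment_moments[OF u(1) lt] by simp
  qed simp
  have *: "(\<lambda>\<omega>. \<Sum>k<n. \<xi> k \<omega> * ?D k \<omega>) \<in> borel_measurable (Fl (u n)) \<and>
    integrable M (\<lambda>\<omega>. (\<Sum>k<n. \<xi> k \<omega> * ?D k \<omega>)\<^sup>2) \<and>
    expectation (\<lambda>\<omega>. (\<Sum>k<n. \<xi> k \<omega> * ?D k \<omega>)\<^sup>2)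
      = (\<Sum>k<n. expectation (\<lambda>\<omega>. (\<xi> k \<omega>)\<^sup>2) * (u (Suc k) - u k))"
    by (rule expectation_orthogonal_sum_square[where C=C]) (fact u \<xi> D | simp add: mom)+
  show "integrable M (\<lambda>\<omega>. (\<Sum>k<n. \<xi> k \<omega> * ?D k \<omega>)\<^sup>2)"
    using * by blast
  show "expectation (\<lambda>\<omega>. (\<Sum>k<n. \<xi> k \<omega> * ?D k \<omega>)\<^sup>2)
      = (\<Sum>k<n. expectation (\<lambda>\<omega>. (\<xi> k \<omega>)\<^sup>2) * (u (Suc k) - u k))"
    using * by blast
qed

text \<open>Centred squared increments over disjoint intervals are orthogonal. The total is of the
  order of the mesh, and it is this decay that yields almost sure convergence along dyadic
  grids.\<close>

lemma expectation_quadratic_variation_error: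
  fixes u :: "nat \<Rightarrow> real"
  assumes u: "\<And>k. 0 \<le> u k" "\<And>k. u k \<le> u (Suc k)"
  shows "integrable M (\<lambda>\<omega>. (\<Sum>k<n. (W (u (Suc k)) \<omega> - W (u k) \<omega>)\<^sup>2 - (u (Suc k) - u k))\<^sup>2)"
    and "expectation (\<lambda>\<omega>. (\<Sum>k<n. (W (u (Suc k)) \<omega> - W (u k) \<omega>)\<^sup>2 - (u (Suc k) - u k))\<^sup>2)
      = (\<Sum>k<n. 2 * (u (Suc k) - u k)\<^sup>2)"
proof -
  let ?D = "\<lambda>k \<omega>. (W (u (Suc k)) \<omega> - W (u k) \<omega>)\<^sup>2 - (u (Suc k) - u k)"
  have D: "?D k \<in> borel_measurable (Fl (u (Suc k)))" for k
    using W_adapted[OF u(1)[of "Suc k"]] measurable_Fl_mono[OF W_adapted[OF u(1)[of k]] u(2)] by simp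
  have mom: "integrable M (\<lambda>\<omega>. X \<omega> * ?D k \<omega>) \<and> expectation (\<lambda>\<omega>. X \<omega> * ?D k \<omega>) = 0 \<and>
      integrable M (\<lambda>\<omega>. X \<omega> * (?D k \<omega>)\<^sup>2) \<and> expectation (\<lambda>\<omega>. X \<omega> * (?D k \<omega>)\<^sup>2) = expectation X * (2 * (u (Suc k) - u k)\<^sup>2)"
    if X: "X \<in> borel_measurable (Fl (u k))" "integrable M X" for k X
  proof (cases "u k = u (Suc k)")
    case False
    then have lt: "u k < u (Suc k)" using u(2)[of k] by linarith
    let ?h = "u (Suc k) - u k" and ?I = "\<lambda>\<omega>. W (u (Suc k)) \<omega> - W (u k) \<omega>"
    have i2: "integrable M (\<lambda>\<omega>. (?I \<omega>)\<^sup>2)" and i4: "integrable M (\<lambda>\<omega>. (?I \<omega>) ^ 4)"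
      using increment_moment(1)[OF u(1) lt] by auto
    have sq: "((?I \<omega>)\<^sup>2 - ?h)\<^sup>2 = (?I \<omega>) ^ 4 - 2 * ?h * (?I \<omega>)\<^sup>2 + ?h\<^sup>2" for \<omega>
      by (simp add: power2_eq_square power4_eq_xxxx algebra_simps)
    have e1: "expectation (\<lambda>\<omega>. (?I \<omega>)\<^sup>2 - ?h) = 0"
      using i2 increment_moments[OF u(1) lt] by (simp add: prob_space)
    have j: "integrable M (\<lambda>\<omega>. ((?I \<omega>)\<^sup>2 - ?h)\<^sup>2)" unfolding sq using i2 i4 by simp
    \<comment> \<open>The fourth moment gives
      \<open>3 * ?h\<^sup>2 - 2 * ?h * ?h + ?h\<^sup>2\<close>, the variance of a squared centred
      normal variable.\<close>
    have e2: "expectation (\<lambda>\<omega>. ((?I \<omega>)\<^sup>2 - ?h)\<^sup>2) = 2 * ?h\<^sup>2"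
      unfolding sq using i2 i4 increment_moments[OF u(1) lt]
      by (simp add: prob_space) (simp add: power2_eq_square algebra_simps)
    show ?thesis
      using indep_increment_product[OF u(1) lt X, of "\<lambda>x. x\<^sup>2 - ?h"]
        indep_increment_product[OF u(1) lt X, of "\<lambda>x. (x\<^sup>2 - ?h)\<^sup>2"] e1 e2 i2 j by simp
  qed simp
  have *: "(\<lambda>\<omega>. \<Sum>k<n. 1 * ?D k \<omega>) \<in> borel_measurable (Fl (u n)) \<and>
    integrable M (\<lambda>\<omega>. (\<Sum>k<n. 1 * ?D k \<omega>)\<^sup>2) \<and>
    expectation (\<lambda>\<omega>. (\<Sum>k<n. 1 * ?D k \<omega>)\<^sup>2)
      = (\<Sum>k<n. expectation (\<lambda>\<omega>. 1\<^sup>2) * (2 * (u (Suc k) - u k)\<^sup>2))"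
    by (rule expectation_orthogonal_sum_square[where C="\<lambda>_. 1"]) (fact u D | simp add: mom)+
  show "integrable M (\<lambda>\<omega>. (\<Sum>k<n. ?D k \<omega>)\<^sup>2)"
    using * by simp
  show "expectation (\<lambda>\<omega>. (\<Sum>k<n. ?D k \<omega>)\<^sup>2) = (\<Sum>k<n. 2 * (u (Suc k) - u k)\<^sup>2)"
    using * by (simp add: prob_space)
qed

end

section \<open>Increments along dyadic partitions\<close>

definition dyadic :: "nat \<Rightarrow> nat \<Rightarrow> real" where
  "dyadic m k = real k / 2 ^ m"

text \<open>Both end points are stopped at \<open>v\<close>, so that a sum over the whole grid, with
  a range of \<open>k\<close> independent of \<open>v\<close>, describes the path up to time
  \<open>v\<close>.\<close>

definition increment :: "(real \<Rightarrow> real) \<Rightarrow> nat \<Rightarrow> real \<Rightarrow> nat \<Rightarrow> real" where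
  "increment f m v k = f (min (dyadic m (Suc k)) v) - f (min (dyadic m k) v)"

text \<open>The partition \<open>dyadic m 0, \<dots>, dyadic m (4^m)\<close> covers \<open>[0, 2^m]\<close>.\<close>

definition quad_var :: "(real \<Rightarrow> real) \<Rightarrow> nat \<Rightarrow> real \<Rightarrow> real" where
  "quad_var f m v = (\<Sum>k<4 ^ m. (increment f m v k)\<^sup>2)"

text \<open>The modulus of continuity at the mesh size, as a predicate: no supremum has to be formed
  or shown finite.\<close>

definition osc_le :: "(real \<Rightarrow> real) \<Rightarrow> nat \<Rightarrow> real \<Rightarrow> real \<Rightarrow> bool" where
  "osc_le f m T e \<longleftrightarrow> (\<forall>x\<in>{0..T}. \<forall>y\<in>{0..T}. \<bar>x - y\<bar> \<le> 1 / 2 ^ m \<longrightarrow> \<bar>f x - f y\<bar> \<le> e)"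

lemma dyadic_nonneg [simp]: "0 \<le> dyadic m k"
  by (simp add: dyadic_def)

lemma dyadic_0 [simp]: "dyadic m 0 = 0"
  by (simp add: dyadic_def)

lemma dyadic_Suc: "dyadic m (Suc k) = dyadic m k + 1 / 2 ^ m"
  by (simp add: dyadic_def add_divide_distrib)

lemma dyadic_le_Suc: "dyadic m k \<le> dyadic m (Suc k)"
  by (simp add: dyadic_Suc)

lemma dyadic_mono: "j \<le> k \<Longrightarrow> dyadic m j \<le> dyadic m k"
  by (simp add: dyadic_def divide_right_mono)

lemma dyadic_last: "dyadic m (4 ^ m) = 2 ^ m"
proof -
  have "(4::real) ^ m = 2 ^ m * 2 ^ m" by (simp flip: power_mult_distrib)
  then show ?thesis by (simp add: dyadic_def)
qed

lemma obtain_dyadic: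
  assumes "0 \<le> u"
  obtains k where "dyadic m k \<le> u" "u < dyadic m (Suc k)"
proof
  let ?k = "nat \<lfloor>u * 2 ^ m\<rfloor>"
  have "real ?k = of_int \<lfloor>u * 2 ^ m\<rfloor>" using assms by simp
  then have "real ?k \<le> u * 2 ^ m" "u * 2 ^ m < real ?k + 1" by linarith+
  then show "dyadic m ?k \<le> u" "u < dyadic m (Suc ?k)"
    by (auto simp: dyadic_def field_simps)
qed

lemma increment_eq_0: "v \<le> dyadic m k \<Longrightarrow> increment f m v k = 0"
  using dyadic_le_Suc[of m k] by (simp add: increment_def min_absorb2)

lemma increment_cong:
  "dyadic m (Suc k) \<le> v \<Longrightarrow> dyadic m (Suc k) \<le> w \<Longrightarrow> increment f m v k = increment f m w k"
  using dyadic_le_Suc[of m k] by (simp add: increment_def min_def)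

lemma min_dyadic_bounds:
  assumes "0 \<le> v" "v \<le> T"
  shows "min (dyadic m k) v \<in> {0..T}" "min (dyadic m k) v \<le> min (dyadic m (Suc k)) v"
    "\<bar>min (dyadic m (Suc k)) v - min (dyadic m k) v\<bar> \<le> 1 / 2 ^ m"
proof -
  obtain c where c: "1 / 2 ^ m = c" "dyadic m (Suc k) = dyadic m k + c" "0 < c"
    using dyadic_Suc[of m k] by simp
  then show "min (dyadic m k) v \<in> {0..T}" "min (dyadic m k) v \<le> min (dyadic m (Suc k)) v"
    "\<bar>min (dyadic m (Suc k)) v - min (dyadic m k) v\<bar> \<le> 1 / 2 ^ m"
    unfolding c(1) using assms dyadic_nonneg[of m k] by (auto simp: min_def not_le)
qed

lemma increment_bound:
  assumes "osc_le f m T e" "0 \<le> v" "v \<le> T"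
  shows "\<bar>increment f m v k\<bar> \<le> e"
  using assms(1) min_dyadic_bounds[OF assms(2,3), of m] unfolding osc_le_def increment_def by blast

lemma sum_increment:
  assumes "0 \<le> v" "v \<le> 2 ^ m"
  shows "(\<Sum>k<4 ^ m. increment f m v k) = f v - f 0"
  using sum_lessThan_telescope[of "\<lambda>k. f (min (dyadic m k) v)" "4 ^ m"] assms
  by (simp add: increment_def dyadic_last min_def)

lemma sum_increment_id_le:
  assumes "0 \<le> v"
  shows "(\<Sum>k<4 ^ m. increment (\<lambda>x. x) m v k) \<le> v"
  using sum_lessThan_telescope[of "\<lambda>k. min (dyadic m k) v" "4 ^ m"] assms
  by (simp add: increment_def dyadic_last min_def)

text \<open>Cells ending before \<open>u\<close> contribute equally to both sides, cells starting
  after \<open>u\<close> contribute nothing on the left. Only the cell containing \<open>u\<close>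
  can violate monotonicity, by at most one squared increment.\<close>

lemma quad_var_almost_mono:
  assumes osc: "osc_le f m T e" and "0 \<le> u" "u \<le> v" "v \<le> T"
  shows "quad_var f m u \<le> quad_var f m v + e\<^sup>2"
proof -
  obtain k0 where k0: "dyadic m k0 \<le> u" "u < dyadic m (Suc k0)" using obtain_dyadic[OF \<open>0 \<le> u\<close>] .
  have "(increment f m u k)\<^sup>2 \<le> (increment f m v k)\<^sup>2 + (if k = k0 then e\<^sup>2 else 0)" for k
  proof -
    consider "k < k0" | "k = k0" | "k > k0" by linarith
    then show ?thesis
    proof cases
      case 1
      then have "dyadic m (Suc k) \<le> u" using dyadic_mono[of "Suc k" k0 m] k0 by linarith
      then show ?thesis using increment_cong[of m k u v f] 1 assms by simp
    next
      case 2
      have "\<bar>increment f m u k\<bar> \<le> e" using increment_bound[OF osc, of u k] assms by simp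
      then have "(increment f m u k)\<^sup>2 \<le> e\<^sup>2"
        by (metis abs_le_square_iff abs_of_nonneg abs_ge_zero order_trans)
      then have "(increment f m u k)\<^sup>2 \<le> (increment f m v k)\<^sup>2 + e\<^sup>2"
        using zero_le_power2[of "increment f m v k"] by linarith
      then show ?thesis using 2 by simp
    next
      case 3
      then have "u \<le> dyadic m k" using dyadic_mono[of "Suc k0" k m] k0 by linarith
      then show ?thesis by (simp add: increment_eq_0)
    qed
  qed
  then have "quad_var f m u \<le> (\<Sum>k<4 ^ m. (increment f m v k)\<^sup>2 + (if k = k0 then e\<^sup>2 else 0))"
    unfolding quad_var_def by (intro sum_mono)
  also have "\<dots> \<le> quad_var f m v + e\<^sup>2"
    by (simp add: sum.distrib quad_var_def)
  finally show ?thesis .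
qed

text \<open>The paths stopped at \<open>s\<close> and at \<open>r\<close> have equal increments
  before the cell of \<open>s\<close>, and the former has none after it. The single cell left
  contributes at most \<open>e * (2 * e)\<close>.\<close>

lemma cross_variation_stopped:
  assumes osc: "osc_le f m T e" and "0 \<le> s" "s \<le> r" "r \<le> T"
  shows "\<bar>(\<Sum>k<4 ^ m. increment f m s k * increment f m r k) - quad_var f m s\<bar> \<le> 2 * e\<^sup>2"
proof -
  obtain k0 where k0: "dyadic m k0 \<le> s" "s < dyadic m (Suc k0)" using obtain_dyadic[OF \<open>0 \<le> s\<close>] .
  have e: "\<bar>increment f m s k\<bar> \<le> e" "\<bar>increment f m r k\<bar> \<le> e" for k
    using increment_bound[OF osc, of s k] increment_bound[OF osc, of r k] assms by simp_all
  have "\<bar>increment f m s k * increment f m r k - (increment f m s k)\<^sup>2\<bar> \<le> (if k = k0 then 2 * e\<^sup>2 else 0)" for k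
  proof -
    consider "k < k0" | "k = k0" | "k > k0" by linarith
    then show ?thesis
    proof cases
      case 1
      then have "dyadic m (Suc k) \<le> s" using dyadic_mono[of "Suc k" k0 m] k0 by linarith
      then show ?thesis using increment_cong[of m k s r f] 1 assms by (simp add: power2_eq_square)
    next
      case 2
      have "\<bar>increment f m s k * (increment f m r k - increment f m s k)\<bar> \<le> e * (2 * e)"
        unfolding abs_mult using e[of k] by (intro mult_mono) auto
      then show ?thesis using 2 by (simp add: power2_eq_square algebra_simps)
    next
      case 3
      then have "s \<le> dyadic m k" using dyadic_mono[of "Suc k0" k m] k0 by linarith
      then show ?thesis using 3 by (simp add: increment_eq_0)
    qed
  qed
  then have "(\<Sum>k<4 ^ m. \<bar>increment f m s k * increment f m r k - (increment f m s k)\<^sup>2\<bar>)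
      \<le> (\<Sum>k<4 ^ m. if k = k0 then 2 * e\<^sup>2 else 0)" by (intro sum_mono)
  also have "\<dots> \<le> 2 * e\<^sup>2" by simp
  finally show ?thesis
    unfolding quad_var_def sum_subtractf[symmetric] by (rule order_trans[OF sum_abs])
qed

text \<open>Uniform continuity of the limit passes to the approximations: one third of
  \<open>e\<close> for the limit at the two points, and one third at each point for the uniform
  distance.\<close>

lemma eventually_osc_le:
  assumes cont: "continuous_on {0..T} f" and f: "uniform_limit {0..T} g f sequentially"
    and m: "filterlim m at_top sequentially" and e: "0 < e"
  shows "eventually (\<lambda>n. osc_le (g n) (m n) T e) sequentially"
proof -
  have "uniformly_continuous_on {0..T} f" using cont compact_Icc by (rule compact_uniformly_continuous)
  then obtain d where d: "d > 0" "\<And>x y. x \<in> {0..T} \<Longrightarrow> y \<in> {0..T} \<Longrightarrow> dist x y < d \<Longrightarrow> dist (f x) (f y) < e / 3"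
    unfolding uniformly_continuous_on_def using e by (metis divide_pos_pos zero_less_numeral)
  have "((\<lambda>n. (1 / 2 :: real) ^ n) \<longlongrightarrow> 0) sequentially" by (rule LIMSEQ_realpow_zero) auto
  then have "((\<lambda>n. (1 / 2 :: real) ^ m n) \<longlongrightarrow> 0) sequentially"
    using m by (rule filterlim_compose)
  then have "eventually (\<lambda>n. (1 / 2 :: real) ^ m n < d) sequentially"
    using d(1) by (rule order_tendstoD)
  moreover have "eventually (\<lambda>n. \<forall>x\<in>{0..T}. dist (g n x) (f x) < e / 3) sequentially"
    using e by (intro uniform_limitD[OF f]) simp
  ultimately show ?thesis
  proof eventually_elim
    case (elim n)
    show ?case unfolding osc_le_def
    proof (intro ballI impI)
      fix x y assume xy: "x \<in> {0..T}" "y \<in> {0..T}" "\<bar>x - y\<bar> \<le> 1 / 2 ^ m n"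
      then have "dist x y < d" using elim(1) by (simp add: dist_real_def power_one_over)
      with d(2) xy have "dist (f x) (f y) < e / 3" by blast
      moreover have "dist (g n x) (f x) < e / 3" "dist (g n y) (f y) < e / 3" using elim(2) xy by auto
      ultimately show "\<bar>g n x - g n y\<bar> \<le> e" unfolding dist_real_def by linarith
    qed
  qed
qed

section \<open>Uniform convergence of quadratic variations\<close>

lemma obtain_subinterval:
  fixes v :: "nat \<Rightarrow> real"
  assumes "v 0 \<le> u" "u \<le> v (Suc L)"
  obtains i where "i \<le> L" "v i \<le> u" "u \<le> v (Suc i)"
  using assms
proof (induction L arbitrary: thesis)
  case (Suc L)
  show ?case
  proof (cases "u \<le> v (Suc L)")
    case True
    show ?thesis by (rule Suc.IH[OF _ Suc.prems(2) True]) (auto intro: Suc.prems(1) le_SucI)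
  next
    case False
    then show ?thesis using Suc.prems(1)[of "Suc L"] Suc.prems by simp
  qed
qed auto

text \<open>A Polya-type argument: \<open>quad_var\<close> is monotone up to the squared oscillation, so convergence
  at rational times to a continuous limit is uniform.\<close>

lemma quad_var_uniform_limit:
  assumes T: "0 \<le> T" "T \<in> \<rat>" and V: "continuous_on {0..T} V"
    and osc: "\<And>e. 0 < e \<Longrightarrow> eventually (\<lambda>n. osc_le (f n) (m n) T e) sequentially"
    and lim: "\<And>v. v \<in> \<rat> \<Longrightarrow> v \<in> {0..T} \<Longrightarrow> (\<lambda>n. quad_var (f n) (m n) v) \<longlonglongrightarrow> V v"
  shows "uniform_limit {0..T} (\<lambda>n. quad_var (f n) (m n)) V sequentially"
proof (rule uniform_limitI)
  fix e :: real assume e: "e > 0"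
  have "uniformly_continuous_on {0..T} V" using V compact_Icc by (rule compact_uniformly_continuous)
  then obtain d where d: "d > 0" "\<And>x y. x \<in> {0..T} \<Longrightarrow> y \<in> {0..T} \<Longrightarrow> dist x y < d \<Longrightarrow> dist (V x) (V y) < e / 4"
    unfolding uniformly_continuous_on_def using e by (metis divide_pos_pos zero_less_numeral)
  obtain L where L: "T / real (Suc L) < d"
  proof -
    obtain n where "real n > T / d" using reals_Archimedean2 by blast
    then have "T < real (Suc n) * d" using d(1) by (simp add: field_simps)
    then show ?thesis by (intro that[of n]) (simp add: field_simps)
  qed
  \<comment> \<open>As \<open>T\<close> is rational, all nodes of this equidistant partition are
    rational, which is where \<open>lim\<close> applies.\<close>
  define v where "v i = real i * (T / real (Suc L))" for i
  have v: "v i \<in> {0..T}" if "i \<le> Suc L" for i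
  proof -
    have "real i * T \<le> real (Suc L) * T" using that T by (intro mult_right_mono) auto
    then show ?thesis using T unfolding v_def by (auto simp: field_simps)
  qed
  have vQ: "v i \<in> \<rat>" for i unfolding v_def using T by (intro Rats_mult Rats_divide) auto
  have gap: "v (Suc i) - v i < d" for i
  proof -
    have "v (Suc i) - v i = T / real (Suc L)" by (simp only: v_def left_diff_distrib[symmetric]) simp
    then show ?thesis using L by simp
  qed
  have "eventually (\<lambda>n. \<forall>i\<in>{..Suc L}. dist (quad_var (f n) (m n) (v i)) (V (v i)) < e / 4) sequentially"
    using e v vQ by (intro eventually_ball_finite ballI tendstoD[OF lim]) auto
  moreover have "eventually (\<lambda>n. osc_le (f n) (m n) T (min 1 (e / 4))) sequentially" using e by (intro osc) auto
  ultimately show "eventually (\<lambda>n. \<forall>x\<in>{0..T}. dist (quad_var (f n) (m n) x) (V x) < e) sequentially"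
  proof eventually_elim
    case (elim n)
    show ?case
    proof
      fix u assume u: "u \<in> {0..T}"
      have "v (Suc L) = T" "v 0 = 0" by (auto simp: v_def)
      then obtain i where i: "i \<le> L" "v i \<le> u" "u \<le> v (Suc i)"
        using obtain_subinterval[of v u L] u by auto
      let ?q = "quad_var (f n) (m n)" and ?o = "(min 1 (e / 4))\<^sup>2"
      \<comment> \<open>The cap 1 in the oscillation bound is there to make its square at most
        \<open>e / 4\<close>.\<close>
      have o: "?o \<le> e / 4" using e by (auto simp: min_def power2_eq_square mult_left_le_one_le intro: order_trans)
      have vi: "v i \<in> {0..T}" "v (Suc i) \<in> {0..T}" using v i by auto
      have q: "?q (v i) \<le> ?q u + ?o" "?q u \<le> ?q (v (Suc i)) + ?o"
        using quad_var_almost_mono[OF elim(2)] i vi u by auto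
      have a: "dist (?q (v i)) (V (v i)) < e / 4" "dist (?q (v (Suc i))) (V (v (Suc i))) < e / 4"
        using elim(1) i by auto
      have "dist (v i) u < d" "dist (v (Suc i)) u < d" using gap[of i] i by (auto simp: dist_real_def)
      then have "dist (V (v i)) (V u) < e / 4" "dist (V (v (Suc i))) (V u) < e / 4"
        using d(2) vi u by blast+
      with a q o show "dist (?q u) (V u) < e" unfolding dist_real_def by linarith
    qed
  qed
qed

section \<open>Pathwise product rule along dyadic grids\<close>

text \<open>On one cell the difference is the integral of \<open>(g k - X s) * \<beta> s\<close>, at
  most \<open>e * K\<close> times the length. Cells beginning after \<open>u\<close> have increment
  0, hence closeness of \<open>g\<close> is required only up to \<open>u\<close>.\<close>

lemma riemann_stieltjes_error:
  fixes X \<beta> :: "real \<Rightarrow> real"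
  assumes T: "0 \<le> u" "u \<le> T" "u \<le> 2 ^ m" and X: "continuous_on {0..T} X" and \<beta>: "continuous_on {0..T} \<beta>"
    and K: "\<And>s. s \<in> {0..T} \<Longrightarrow> \<bar>\<beta> s\<bar> \<le> K" "0 \<le> K" "0 \<le> e"
    and g: "\<And>k s. dyadic m k \<le> s \<Longrightarrow> s \<le> dyadic m (Suc k) \<Longrightarrow> s \<le> u \<Longrightarrow> \<bar>g k - X s\<bar> \<le> e"
  shows "\<bar>(\<Sum>k<4 ^ m. g k * increment (\<lambda>t. integral {0..t} \<beta>) m u k) - integral {0..u} (\<lambda>s. X s * \<beta> s)\<bar> \<le> e * K * u"
proof -
  let ?A = "\<lambda>t. integral {0..t} \<beta>" and ?D = "\<lambda>t. integral {0..t} (\<lambda>s. X s * \<beta> s)"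
  have XB: "continuous_on {0..T} (\<lambda>s. X s * \<beta> s)" using X \<beta> by (rule continuous_on_mult)
  have diff: "integral {0..b} f - integral {0..a} f = integral {a..b} f"
    if "continuous_on {0..T} f" "0 \<le> a" "a \<le> b" "b \<le> T" for f :: "real \<Rightarrow> real" and a b
    using Henstock_Kurzweil_Integration.integral_combine[of 0 a b f] that
      integrable_continuous_real[of 0 b f] continuous_on_subset[of "{0..T}" f "{0..b}"] by auto
  have "\<bar>g k * increment ?A m u k - increment ?D m u k\<bar> \<le> e * K * increment (\<lambda>x. x) m u k" for k
  proof (cases "u \<le> dyadic m k")
    case True
    then show ?thesis by (simp add: increment_eq_0)
  next
    case False
    let ?a = "min (dyadic m k) u" and ?b = "min (dyadic m (Suc k)) u"
    have ab: "0 \<le> ?a" "?a \<le> ?b" "?b \<le> T" "?b \<le> u"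
      using min_dyadic_bounds[of u T m k] min_dyadic_bounds(1)[of u T m "Suc k"] T by auto
    have sub: "{?a..?b} \<subseteq> {0..T}" using ab by auto
    have c: "continuous_on {?a..?b} \<beta>" "continuous_on {?a..?b} (\<lambda>s. X s * \<beta> s)" "continuous_on {?a..?b} X"
      using continuous_on_subset[OF _ sub] \<beta> XB X by blast+
    have "g k * increment ?A m u k - increment ?D m u k
       = g k * integral {?a..?b} \<beta> - integral {?a..?b} (\<lambda>s. X s * \<beta> s)"
      unfolding increment_def using ab by (simp add: diff \<beta> XB)
    also have "\<dots> = integral {?a..?b} (\<lambda>s. g k * \<beta> s - X s * \<beta> s)"
      using c by (subst Henstock_Kurzweil_Integration.integral_diff)
         (auto intro!: integrable_continuous_real continuous_intros)
    also have "\<bar>\<dots>\<bar> \<le> e * K * (?b - ?a)"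
      unfolding real_norm_def[symmetric]
    proof (rule integral_bound[OF ab(2)])
      show "continuous_on {?a..?b} (\<lambda>s. g k * \<beta> s - X s * \<beta> s)" using c by (intro continuous_intros)
      fix s assume s: "s \<in> {?a..?b}"
      have "\<bar>g k - X s\<bar> \<le> e" using s False by (intro g) auto
      moreover have "\<bar>\<beta> s\<bar> \<le> K" using s sub by (intro K(1)) blast
      ultimately have "\<bar>(g k - X s) * \<beta> s\<bar> \<le> e * K" unfolding abs_mult using K(2,3) by (intro mult_mono) auto
      then show "norm (g k * \<beta> s - X s * \<beta> s) \<le> e * K" by (simp add: algebra_simps)
    qed
    finally show ?thesis by (simp add: increment_def)
  qed
  then have "(\<Sum>k<4 ^ m. \<bar>g k * increment ?A m u k - increment ?D m u k\<bar>) \<le> (\<Sum>k<4 ^ m. e * K * increment (\<lambda>x. x) m u k)"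
    by (intro sum_mono)
  also have "\<dots> = e * K * u" using sum_increment[of u m "\<lambda>x. x"] T by (simp flip: sum_distrib_left)
  finally have "\<bar>\<Sum>k<4 ^ m. (g k * increment ?A m u k - increment ?D m u k)\<bar> \<le> e * K * u"
    by (rule order_trans[OF sum_abs])
  moreover have "(\<Sum>k<4 ^ m. increment ?D m u k) = ?D u" using sum_increment[of u m ?D] T by simp
  ultimately show ?thesis by (simp add: sum_subtractf)
qed

lemma eventually_dyadic_covers:
  fixes T :: real
  assumes m: "filterlim m at_top sequentially"
  shows "eventually (\<lambda>n. T \<le> 2 ^ m n) sequentially"
proof -
  obtain N where N: "T \<le> real N" using real_arch_simple by blast
  have "eventually (\<lambda>n. N \<le> m n) sequentially" using m by (simp add: filterlim_at_top)
  then show ?thesis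
  proof eventually_elim
    case (elim n)
    then show ?case using N of_nat_less_two_power[of "m n", where 'a=real] by linarith
  qed
qed

text \<open>Replace the part \<open>I\<close> of \<open>X\<close> by \<open>J n\<close> and sum
  \<open>(a + d)\<^sup>2 - a\<^sup>2 = 2 * a * d + d\<^sup>2\<close> over the cells. The left side
  telescopes, the squares \<open>d\<^sup>2\<close> converge to the integral of
  \<open>\<sigma>\<^sup>2\<close>, and the drift part of \<open>2 * a * d\<close> is a
  Riemann-Stieltjes sum. What remains is exactly the sum against \<open>J n\<close>, which must
  therefore converge to the remainder.\<close>

lemma pathwise_ito_square:
  fixes X \<beta> \<sigma> I :: "real \<Rightarrow> real" and J :: "nat \<Rightarrow> real \<Rightarrow> real" and m :: "nat \<Rightarrow> nat"
  assumes T: "0 \<le> T" "T \<in> \<rat>"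
    and X: "continuous_on {0..T} X" and \<beta>: "continuous_on {0..T} \<beta>" and \<sigma>: "continuous_on {0..T} \<sigma>"
    and X_eq: "\<And>t. t \<in> {0..T} \<Longrightarrow> X t = X 0 + integral {0..t} \<beta> + I t"
    and J: "uniform_limit {0..T} J I sequentially"
    and m: "filterlim m at_top sequentially"
    and qv: "\<And>v. v \<in> \<rat> \<Longrightarrow> v \<in> {0..T} \<Longrightarrow>
      (\<lambda>n. quad_var (J n) (m n) v) \<longlonglongrightarrow> integral {0..v} (\<lambda>s. (\<sigma> s)\<^sup>2)"
  shows "uniform_limit {0..T}
    (\<lambda>n u. \<Sum>k<4 ^ m n. 2 * (X (dyadic (m n) k) - I (dyadic (m n) k) + J n (dyadic (m n) k)) * increment (J n) (m n) u k)
    (\<lambda>u. (X u)\<^sup>2 - (X 0)\<^sup>2 - integral {0..u} (\<lambda>s. 2 * X s * \<beta> s + (\<sigma> s)\<^sup>2)) sequentially"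
    (is "uniform_limit _ ?R ?L _")
proof -
  define A where "A t = integral {0..t} \<beta>" for t
  define V where "V t = integral {0..t} (\<lambda>s. (\<sigma> s)\<^sup>2)" for t
  define D where "D t = integral {0..t} (\<lambda>s. X s * \<beta> s)" for t
  define x where "x n t = X t - I t + J n t" for n t
  have \<sigma>2: "continuous_on {0..T} (\<lambda>s. (\<sigma> s)\<^sup>2)" using \<sigma> by (intro continuous_intros)
  have X\<beta>: "continuous_on {0..T} (\<lambda>s. X s * \<beta> s)" using X \<beta> by (intro continuous_intros)
  have int: "f integrable_on {0..T}" if "continuous_on {0..T} f" for f :: "real \<Rightarrow> real"
    using that by (rule integrable_continuous_real)
  have A: "continuous_on {0..T} A" and V: "continuous_on {0..T} V"
    unfolding A_def[abs_def] V_def[abs_def] by (intro indefinite_integral_continuous_1 int \<beta> \<sigma>2)+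
  have x_eq: "x n t = X 0 + A t + J n t" if "t \<in> {0..T}" for n t
    using X_eq[OF that] by (simp add: x_def A_def)
  \<comment> \<open>Continuity of \<open>I\<close> is read off the equation, whose other terms are
    continuous; it yields the oscillation bounds for \<open>J n\<close>.\<close>
  have I: "continuous_on {0..T} I"
  proof -
    have "continuous_on {0..T} (\<lambda>t. X t - X 0 - A t)" using X A by (intro continuous_intros)
    moreover have "X t - X 0 - A t = I t" if "t \<in> {0..T}" for t
      using X_eq[OF that] by (simp add: A_def)
    ultimately show ?thesis by (rule continuous_on_eq)
  qed
  have x: "uniform_limit {0..T} x X sequentially"
  proof -
    have "uniform_limit {0..T} (\<lambda>n t. X t - I t + J n t) (\<lambda>t. X t - I t + I t) sequentially"
      by (intro uniform_limit_intros J)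
    then show ?thesis by (simp add: x_def[abs_def])
  qed
  obtain K where K: "\<And>s. s \<in> {0..T} \<Longrightarrow> \<bar>\<beta> s\<bar> \<le> K" "0 < K"
  proof -
    have "bounded (\<beta> ` {0..T})" using \<beta> by (intro compact_imp_bounded compact_continuous_image) auto
    then obtain K where "\<forall>y\<in>\<beta> ` {0..T}. norm y \<le> K" "0 < K" unfolding bounded_pos by blast
    then show ?thesis by (intro that[of K]) auto
  qed
  \<comment> \<open>\<open>T + 1\<close> instead of \<open>T\<close> makes \<open>P\<close> positive
    also for \<open>T = 0\<close>, so that it may be divided by.\<close>
  define P where "P = K * (T + 1)"
  have P: "0 < P" using K T by (simp add: P_def)
  have grid_fine: "eventually (\<lambda>n. T \<le> 2 ^ m n) sequentially" by (rule eventually_dyadic_covers[OF m])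
  have inc_A: "\<bar>increment A j v k\<bar> \<le> K * increment (\<lambda>x. x) j v k" if v: "v \<in> {0..T}" for j v k
  proof -
    let ?a = "min (dyadic j k) v" and ?b = "min (dyadic j (Suc k)) v"
    have ab: "0 \<le> ?a" "?a \<le> ?b" "?b \<le> T"
      using min_dyadic_bounds[of v T j k] min_dyadic_bounds(1)[of v T j "Suc k"] v by auto
    have sub: "{0..?b} \<subseteq> {0..T}" "{?a..?b} \<subseteq> {0..T}"
      unfolding atLeastatMost_subset_iff using ab by linarith+
    have c: "continuous_on {0..?b} \<beta>" "continuous_on {?a..?b} \<beta>"
      using sub continuous_on_subset[OF \<beta>] by blast+
    have "A ?b - A ?a = integral {?a..?b} \<beta>"
      using Henstock_Kurzweil_Integration.integral_combine[OF ab(1,2) integrable_continuous_real[OF c(1)]]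
      by (simp add: A_def)
    also have "\<bar>\<dots>\<bar> \<le> K * (?b - ?a)"
      unfolding real_norm_def[symmetric]
    proof (rule integral_bound[OF ab(2) c(2)])
      fix t assume "t \<in> {?a..?b}"
      then have "t \<in> {0..T}" using sub by blast
      then show "norm (\<beta> t) \<le> K" using K(1) by simp
    qed
    finally show ?thesis by (simp add: increment_def)
  qed
  \<comment> \<open>The drift does not change the quadratic variation. With \<open>a\<close> and
    \<open>b\<close> the increments of \<open>A\<close> and \<open>J n\<close>, the squares differ
    by \<open>a * (a + 2 * b)\<close>: the first factors sum to at most \<open>P\<close> in absolute
    value, the second is at most \<open>3 * e'\<close>.\<close>
  have qv_x: "(\<lambda>n. quad_var (x n) (m n) v) \<longlonglongrightarrow> V v" if v: "v \<in> \<rat>" "v \<in> {0..T}" for v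
  proof -
    have "(\<lambda>n. quad_var (x n) (m n) v - quad_var (J n) (m n) v) \<longlonglongrightarrow> 0"
    proof (rule tendstoI)
      fix e :: real assume e: "e > 0"
      define e' where "e' = e / (4 * P)"
      have e': "0 < e'" using e P by (simp add: e'_def)
      have oA: "eventually (\<lambda>n. osc_le A (m n) T e') sequentially"
        using A m e' by (intro eventually_osc_le) (auto intro: uniform_limit_const)
      have oJ: "eventually (\<lambda>n. osc_le (J n) (m n) T e') sequentially"
        by (rule eventually_osc_le[OF I J m e'])
      show "eventually (\<lambda>n. dist (quad_var (x n) (m n) v - quad_var (J n) (m n) v) 0 < e) sequentially"
        using oA oJ
      proof eventually_elim
        case (elim n)
        have v': "0 \<le> v" "v \<le> T" using v by auto
        have "\<bar>(increment (x n) (m n) v k)\<^sup>2 - (increment (J n) (m n) v k)\<^sup>2\<bar>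
           \<le> (K * increment (\<lambda>x. x) (m n) v k) * (3 * e')" for k
        proof -
          have "increment (x n) (m n) v k = increment A (m n) v k + increment (J n) (m n) v k"
            unfolding increment_def using min_dyadic_bounds(1)[OF v'] by (simp add: x_eq)
          then have "(increment (x n) (m n) v k)\<^sup>2 - (increment (J n) (m n) v k)\<^sup>2
            = increment A (m n) v k * (increment A (m n) v k + 2 * increment (J n) (m n) v k)"
            by (simp add: power2_eq_square algebra_simps)
          moreover have "\<bar>increment A (m n) v k + 2 * increment (J n) (m n) v k\<bar> \<le> 3 * e'"
            using increment_bound[OF elim(1) v', of k] increment_bound[OF elim(2) v', of k] by linarith
          ultimately show ?thesis using inc_A[OF v(2), of "m n" k]
            by (simp only: abs_mult) (intro mult_mono, auto)
        qed
        then have "(\<Sum>k<4 ^ m n. \<bar>(increment (x n) (m n) v k)\<^sup>2 - (increment (J n) (m n) v k)\<^sup>2\<bar>)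
           \<le> (\<Sum>k<4 ^ m n. (K * increment (\<lambda>x. x) (m n) v k) * (3 * e'))" by (intro sum_mono)
        also have "\<dots> = K * (\<Sum>k<4 ^ m n. increment (\<lambda>x. x) (m n) v k) * (3 * e')"
          by (simp add: sum_distrib_left sum_distrib_right)
        also have "\<dots> \<le> P * (3 * e')"
          unfolding P_def using sum_increment_id_le[OF v'(1), of "m n"] v' K e'
          by (intro mult_right_mono mult_left_mono) auto
        also have "\<dots> = 3 * e / 4" using P by (simp add: e'_def)
        also have "\<dots> < e" using e by simp
        finally show ?case
          unfolding quad_var_def sum_subtractf[symmetric] dist_real_def
          by (simp add: order_le_less_trans[OF sum_abs])
      qed
    qed
    from tendsto_add[OF this qv[OF v]] show ?thesis by (simp add: V_def)
  qed
  have U1: "uniform_limit {0..T} (\<lambda>n. quad_var (x n) (m n)) V sequentially"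
    by (rule quad_var_uniform_limit[OF T V eventually_osc_le[OF X x m] qv_x])
  define S where "S n u = (\<Sum>k<4 ^ m n. x n (min (dyadic (m n) k) u) * increment A (m n) u k)" for n u
  have U2: "uniform_limit {0..T} S D sequentially"
  proof (rule uniform_limitI)
    fix e :: real assume e: "e > 0"
    define e' where "e' = e / (4 * P)"
    have e': "0 < e'" using e P by (simp add: e'_def)
    have "eventually (\<lambda>n. osc_le X (m n) T e') sequentially"
      using X m e' by (intro eventually_osc_le) (auto intro: uniform_limit_const)
    moreover have "eventually (\<lambda>n. \<forall>t\<in>{0..T}. dist (x n t) (X t) < e') sequentially"
      by (rule uniform_limitD[OF x e'])
    ultimately show "eventually (\<lambda>n. \<forall>u\<in>{0..T}. dist (S n u) (D u) < e) sequentially"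
      using grid_fine
    proof eventually_elim
      case (elim n)
      show ?case
      proof
        fix u assume u: "u \<in> {0..T}"
        have "\<bar>(\<Sum>k<4 ^ m n. x n (min (dyadic (m n) k) u) * increment (\<lambda>t. integral {0..t} \<beta>) (m n) u k)
             - integral {0..u} (\<lambda>s. X s * \<beta> s)\<bar> \<le> (2 * e') * K * u"
        proof (rule riemann_stieltjes_error[OF _ _ _ X \<beta> K(1)])
          fix k s assume ks: "dyadic (m n) k \<le> s" "s \<le> dyadic (m n) (Suc k)" "s \<le> u"
          then have mk: "min (dyadic (m n) k) u = dyadic (m n) k" by simp
          have in0: "dyadic (m n) k \<in> {0..T}" "s \<in> {0..T}"
            using ks u order_trans[OF dyadic_nonneg ks(1)] by auto
          have "\<bar>dyadic (m n) k - s\<bar> \<le> 1 / 2 ^ m n" using ks dyadic_Suc[of "m n" k] by linarith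
          then have "\<bar>X (dyadic (m n) k) - X s\<bar> \<le> e'" using elim(1) in0 unfolding osc_le_def by blast
          moreover have "\<bar>x n (dyadic (m n) k) - X (dyadic (m n) k)\<bar> < e'"
            using elim(2) in0 by (auto simp: dist_real_def)
          ultimately show "\<bar>x n (min (dyadic (m n) k) u) - X s\<bar> \<le> 2 * e'" unfolding mk by linarith
        qed (use u elim K e' in auto)
        also have "(2 * e') * K * u \<le> (2 * e') * K * (T + 1)" using u e' K by (intro mult_left_mono) auto
        also have "\<dots> = (2 * e') * P" by (simp add: P_def)
        also have "\<dots> = e / 2" using P by (simp add: e'_def)
        also have "\<dots> < e" using e by simp
        finally show "dist (S n u) (D u) < e" by (simp add: S_def D_def A_def[abs_def] dist_real_def)
      qed
    qed
  qed
  have bdd: "bounded (X ` {0..T})" using X by (intro compact_imp_bounded compact_continuous_image) auto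
  have U3: "uniform_limit {0..T} (\<lambda>n u. x n u * x n u) (\<lambda>u. X u * X u) sequentially"
    by (rule uniform_lim_mult[OF x x bdd bdd])
  have U4: "uniform_limit {0..T} (\<lambda>n u. x n 0 * x n 0) (\<lambda>u. X 0 * X 0) sequentially"
  proof -
    have "(\<lambda>n. x n 0 * x n 0) \<longlonglongrightarrow> X 0 * X 0"
      using T by (intro tendsto_uniform_limitI[OF U3]) auto
    then show ?thesis by (auto simp: uniform_limit_iff tendsto_iff)
  qed
  \<comment> \<open>The limit of all terms of the discrete product rule other than the sum against
    \<open>J n\<close>.\<close>
  have U: "uniform_limit {0..T} (\<lambda>n u. x n u * x n u - x n 0 * x n 0 - quad_var (x n) (m n) u - 2 * S n u)
     (\<lambda>u. X u * X u - X 0 * X 0 - V u - 2 * D u) sequentially"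
    by (intro uniform_limit_minus U1 U3 U4 bounded_linear.uniform_limit[OF bounded_linear_mult_right U2])
  have lim_eq: "X u * X u - X 0 * X 0 - V u - 2 * D u = ?L u" if u: "u \<in> {0..T}" for u
  proof -
    have sub: "{0..u} \<subseteq> {0..T}" using u by auto
    have i: "(\<lambda>s. X s * \<beta> s) integrable_on {0..u}" "(\<lambda>s. (\<sigma> s)\<^sup>2) integrable_on {0..u}"
      using continuous_on_subset[OF X\<beta> sub] continuous_on_subset[OF \<sigma>2 sub]
      by (auto intro: integrable_continuous_real)
    have "integral {0..u} (\<lambda>s. 2 * X s * \<beta> s + (\<sigma> s)\<^sup>2) = 2 * D u + V u"
      using Henstock_Kurzweil_Integration.integral_add[OF integrable_on_cmult_left[OF i(1), of 2] i(2)]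
        Henstock_Kurzweil_Integration.integral_mult_right[of "{0..u}" 2 "\<lambda>s. X s * \<beta> s"]
      by (simp add: D_def V_def mult.assoc)
    then show ?thesis by (simp add: power2_eq_square)
  qed
  \<comment> \<open>The discrete product rule itself, cell by cell. The sum telescopes to time
    \<open>u\<close> only if the grid reaches \<open>u\<close>, that is for
    \<open>u \<le> 2 ^ m n\<close>.\<close>
  have sum_eq: "x n u * x n u - x n 0 * x n 0 - quad_var (x n) (m n) u - 2 * S n u = ?R n u"
    if u: "u \<in> {0..T}" and "u \<le> 2 ^ m n" for n u
  proof -
    let ?t = "\<lambda>k. dyadic (m n) k"
    have u': "0 \<le> u" "u \<le> T" using u by auto
    have "increment (\<lambda>s. x n s * x n s) (m n) u k - (increment (x n) (m n) u k)\<^sup>2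
        - 2 * (x n (min (?t k) u) * increment A (m n) u k)
      = 2 * (X (?t k) - I (?t k) + J n (?t k)) * increment (J n) (m n) u k" for k
    proof (cases "u \<le> ?t k")
      case True
      then show ?thesis by (simp add: increment_eq_0)
    next
      case False
      then have mk: "min (?t k) u = ?t k" by simp
      have "increment (x n) (m n) u k = increment A (m n) u k + increment (J n) (m n) u k"
        unfolding increment_def using min_dyadic_bounds(1)[OF u'] by (simp add: x_eq)
      moreover have "increment (\<lambda>s. x n s * x n s) (m n) u k
         = 2 * x n (?t k) * increment (x n) (m n) u k + (increment (x n) (m n) u k)\<^sup>2"
        unfolding increment_def mk by (simp add: power2_eq_square algebra_simps)
      ultimately show ?thesis by (simp add: mk x_def algebra_simps)
    qed
    then have "(\<Sum>k<4 ^ m n. increment (\<lambda>s. x n s * x n s) (m n) u k - (increment (x n) (m n) u k)\<^sup>2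
        - 2 * (x n (min (?t k) u) * increment A (m n) u k)) = ?R n u" by simp
    then show ?thesis
      using sum_increment[OF u'(1) that(2), of "\<lambda>s. x n s * x n s"]
      by (simp add: sum_subtractf quad_var_def S_def flip: sum_distrib_left)
  qed
  show ?thesis
  proof (rule uniform_limit_cong[THEN iffD1, OF _ _ U])
    show "eventually (\<lambda>n. \<forall>u\<in>{0..T}. x n u * x n u - x n 0 * x n 0 - quad_var (x n) (m n) u - 2 * S n u = ?R n u) sequentially"
      using grid_fine by eventually_elim (use sum_eq in auto)
  qed (rule lim_eq)
qed

section \<open>Step functions on the dyadic grid and convergence in mean square\<close>

text \<open>Cells are open on the left as in \<open>elementary_value\<close>, so that the product of
  the two is again a sum over intervals of this kind. The point 0 lies in no cell.\<close>

definition dyadic_step :: "(nat \<Rightarrow> real) \<Rightarrow> nat \<Rightarrow> real \<Rightarrow> real" where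
  "dyadic_step g m s = (\<Sum>k<4 ^ m. g k * indicator {dyadic m k<..dyadic m (Suc k)} s)"

lemma obtain_dyadic_step:
  assumes s: "0 < s" "s \<le> 2 ^ m"
  obtains k where "dyadic m k < s" "s \<le> dyadic m (Suc k)" "dyadic_step g m s = g k"
proof -
  have "\<exists>k. dyadic m k < s \<and> s \<le> dyadic m (Suc k)"
  proof -
    obtain k where k: "dyadic m k \<le> s" "s < dyadic m (Suc k)" using obtain_dyadic[of s m] s by auto
    show ?thesis
    proof (cases "dyadic m k = s")
      \<comment> \<open>A grid point belongs to the cell on its left, whereas
        \<open>obtain_dyadic\<close> returns the one on its right.\<close>
      case True
      with s have "k \<noteq> 0" by (metis dyadic_0 less_irrefl)
      then obtain j where "k = Suc j" using not0_implies_Suc by blast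
      then have "dyadic m j < s" "s \<le> dyadic m (Suc j)" using True dyadic_Suc[of m j] by auto
      then show ?thesis by blast
    next
      case False
      then have "dyadic m k < s \<and> s \<le> dyadic m (Suc k)" using k by simp
      then show ?thesis by blast
    qed
  qed
  then obtain k where k: "dyadic m k < s" "s \<le> dyadic m (Suc k)" by blast
  have "k < 4 ^ m"
  proof (rule ccontr)
    assume "\<not> ?thesis"
    then have "2 ^ m \<le> dyadic m k" using dyadic_mono[of "4 ^ m" k m] by (simp add: dyadic_last)
    with k s show False by linarith
  qed
  have "g j * indicator {dyadic m j<..dyadic m (Suc j)} s = (if j = k then g k else 0)" for j
  proof -
    consider "j < k" | "j = k" | "j > k" by linarith
    then show ?thesis
    proof cases
      case 1
      then show ?thesis using dyadic_mono[of "Suc j" k m] k by (auto simp: indicator_def)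
    next
      case 2
      then show ?thesis using k by (auto simp: indicator_def)
    next
      case 3
      then show ?thesis using dyadic_mono[of "Suc k" j m] k by (auto simp: indicator_def)
    qed
  qed
  then have "dyadic_step g m s = (\<Sum>j<4 ^ m. if j = k then g k else 0)"
    unfolding dyadic_step_def by simp
  also have "\<dots> = g k" using \<open>k < 4 ^ m\<close> by simp
  finally show ?thesis using that[OF k] by simp
qed

lemma dyadic_step_measurable [measurable]: "dyadic_step g m \<in> borel_measurable borel"
  unfolding dyadic_step_def[abs_def] by measurable

lemma dyadic_step_bound: "\<bar>dyadic_step g m s\<bar> \<le> (\<Sum>k<4 ^ m. \<bar>g k\<bar>)"
  unfolding dyadic_step_def
  by (rule order_trans[OF sum_abs sum_mono]) (auto simp: indicator_def)

text \<open>Integrability of the squared error is part of what an Ito integral has to provide;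
  bounded Borel approximations and continuous integrands supply it.\<close>

lemma set_integrable_bounded_minus_continuous_square:
  fixes p h :: "real \<Rightarrow> real"
  assumes p: "p \<in> borel_measurable borel" "\<And>s. \<bar>p s\<bar> \<le> C" and h: "continuous_on {a..b} h"
  shows "set_integrable lborel {a..b} (\<lambda>s. (p s - h s)\<^sup>2)"
proof -
  have "bounded (h ` {a..b})" using h by (intro compact_imp_bounded compact_continuous_image) auto
  then obtain D where "\<forall>x\<in>h ` {a..b}. norm x \<le> D" unfolding bounded_iff by blast
  then have D: "\<And>s. s \<in> {a..b} \<Longrightarrow> \<bar>h s\<bar> \<le> D" by simp
  have hm: "(\<lambda>s. indicator {a..b} s *\<^sub>R h s) \<in> borel_measurable borel"
    using borel_measurable_continuous_on_indicator[OF _ h] by simp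
  show ?thesis unfolding set_integrable_def
  proof (rule Bochner_Integration.integrable_bound)
    show "integrable lborel (\<lambda>s. indicator {a..b} s *\<^sub>R (C + D)\<^sup>2)"
      using borel_integrable_atLeastAtMost'[OF continuous_on_const] by (simp only: set_integrable_def)
    \<comment> \<open>\<open>h\<close> is under control only on the interval. Cutting it off inside
      the square leaves the function unchanged and makes it Borel.\<close>
    have "(\<lambda>s. indicator {a..b} s *\<^sub>R (p s - indicator {a..b} s *\<^sub>R h s)\<^sup>2) \<in> borel_measurable lborel"
      using p(1) hm by measurable
    also have "(\<lambda>s. indicator {a..b} s *\<^sub>R (p s - indicator {a..b} s *\<^sub>R h s)\<^sup>2)
       = (\<lambda>s. indicator {a..b} s *\<^sub>R (p s - h s)\<^sup>2)" by (auto simp: indicator_def)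
    finally show "(\<lambda>s. indicator {a..b} s *\<^sub>R (p s - h s)\<^sup>2) \<in> borel_measurable lborel" .
    show "AE s in lborel. norm (indicator {a..b} s *\<^sub>R (p s - h s)\<^sup>2) \<le> norm (indicator {a..b} s *\<^sub>R (C + D)\<^sup>2)"
    proof (rule AE_I2)
      fix s
      have "(p s - h s)\<^sup>2 \<le> (C + D)\<^sup>2" if "s \<in> {a..b}"
      proof -
        have "\<bar>p s - h s\<bar> \<le> \<bar>C + D\<bar>" using p(2)[of s] D[OF that] by linarith
        then show ?thesis by (simp add: abs_le_square_iff)
      qed
      then show "norm (indicator {a..b} s *\<^sub>R (p s - h s)\<^sup>2) \<le> norm (indicator {a..b} s *\<^sub>R (C + D)\<^sup>2)"
        by (auto simp: indicator_def)
    qed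
  qed
qed

text \<open>Write \<open>p\<close> for the step function. In \<open>p * E - X * \<sigma> = p * (E -
  \<sigma>) + (p - X) * \<sigma>\<close> the first term is a bounded factor times a sequence tending
  to 0 in mean square, and in the second \<open>p - X\<close> is uniformly small while
  \<open>\<sigma>\<close> is bounded.\<close>

lemma dyadic_step_product_L2:
  fixes X \<sigma> :: "real \<Rightarrow> real" and E :: "nat \<Rightarrow> real \<Rightarrow> real"
  assumes T: "0 \<le> T" and X: "continuous_on {0..T} X" and \<sigma>: "continuous_on {0..T} \<sigma>"
    and m: "filterlim m at_top sequentially"
    and E: "\<And>n. E n \<in> borel_measurable borel" "\<And>n s. \<bar>E n s\<bar> \<le> C n"
    and lim: "(\<lambda>n. LINT s:{0..T}|lborel. (E n s - \<sigma> s)\<^sup>2) \<longlonglongrightarrow> 0"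
    and g: "\<And>e. 0 < e \<Longrightarrow> eventually (\<lambda>n. \<forall>k s. dyadic (m n) k < s \<longrightarrow> s \<le> dyadic (m n) (Suc k) \<longrightarrow> s \<le> T
       \<longrightarrow> \<bar>g n k - X s\<bar> \<le> e) sequentially"
  shows "set_integrable lborel {0..T} (\<lambda>s. (dyadic_step (g n) (m n) s * E n s - X s * \<sigma> s)\<^sup>2)"
    and "(\<lambda>n. LINT s:{0..T}|lborel. (dyadic_step (g n) (m n) s * E n s - X s * \<sigma> s)\<^sup>2) \<longlonglongrightarrow> 0"
proof -
  let ?p = "\<lambda>n. dyadic_step (g n) (m n)"
  have X\<sigma>: "continuous_on {0..T} (\<lambda>s. X s * \<sigma> s)" using X \<sigma> by (intro continuous_intros)
  show int: "set_integrable lborel {0..T} (\<lambda>s. (?p n s * E n s - X s * \<sigma> s)\<^sup>2)" for n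
  proof (rule set_integrable_bounded_minus_continuous_square[OF _ _ X\<sigma>])
    show "(\<lambda>s. ?p n s * E n s) \<in> borel_measurable borel" using E(1)[of n] by measurable
    show "\<bar>?p n s * E n s\<bar> \<le> (\<Sum>k<4 ^ m n. \<bar>g n k\<bar>) * C n" for s
      unfolding abs_mult using dyadic_step_bound[of "g n" "m n" s] E(2)[of n s]
      by (intro mult_mono) (auto intro: sum_nonneg)
  qed
  have intE: "set_integrable lborel {0..T} (\<lambda>s. (E n s - \<sigma> s)\<^sup>2)" for n
    using E(1)[of n] E(2)[of n] \<sigma> by (rule set_integrable_bounded_minus_continuous_square)
  have bdd: "\<exists>D. \<forall>s\<in>{0..T}. \<bar>f s\<bar> \<le> D" if "continuous_on {0..T} f" for f :: "real \<Rightarrow> real"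
  proof -
    have "bounded (f ` {0..T})" using that by (intro compact_imp_bounded compact_continuous_image) auto
    then show ?thesis unfolding bounded_iff by auto
  qed
  obtain D where D: "\<And>s. s \<in> {0..T} \<Longrightarrow> \<bar>X s\<bar> \<le> D" using bdd[OF X] by blast
  obtain S where S: "\<And>s. s \<in> {0..T} \<Longrightarrow> \<bar>\<sigma> s\<bar> \<le> S" using bdd[OF \<sigma>] by blast
  have ineq: "(LINT s:{0..T}|lborel. (?p n s * E n s - X s * \<sigma> s)\<^sup>2)
      \<le> 2 * (D + 1)\<^sup>2 * (LINT s:{0..T}|lborel. (E n s - \<sigma> s)\<^sup>2) + 2 * e\<^sup>2 * S\<^sup>2 * T"
    if gn: "\<forall>k s. dyadic (m n) k < s \<longrightarrow> s \<le> dyadic (m n) (Suc k) \<longrightarrow> s \<le> T \<longrightarrow> \<bar>g n k - X s\<bar> \<le> e"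
      and Tn: "T \<le> 2 ^ m n" and e: "0 < e" "e \<le> 1" for n e
  proof -
    have pt: "(?p n s * E n s - X s * \<sigma> s)\<^sup>2 \<le> 2 * (D + 1)\<^sup>2 * (E n s - \<sigma> s)\<^sup>2 + 2 * e\<^sup>2 * S\<^sup>2"
      if s: "s \<in> {0..T}" "s \<noteq> 0" for s
    proof -
      obtain k where k: "dyadic (m n) k < s" "s \<le> dyadic (m n) (Suc k)" "?p n s = g n k"
        using obtain_dyadic_step[of s "m n" "g n"] s Tn by auto
      have px: "\<bar>?p n s - X s\<bar> \<le> e" using gn k s by auto
      have "\<bar>?p n s\<bar> \<le> D + 1" using px D[OF s(1)] e by linarith
      then have p: "(?p n s)\<^sup>2 \<le> (D + 1)\<^sup>2" using abs_le_square_iff[of "?p n s" "D + 1"] by linarith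
      have "(?p n s - X s)\<^sup>2 \<le> e\<^sup>2" using px e abs_le_square_iff[of "?p n s - X s" e] by simp
      moreover have "(\<sigma> s)\<^sup>2 \<le> S\<^sup>2" using S[OF s(1)] abs_le_square_iff[of "\<sigma> s" S] by simp
      ultimately have q: "(?p n s - X s)\<^sup>2 * (\<sigma> s)\<^sup>2 \<le> e\<^sup>2 * S\<^sup>2" by (intro mult_mono) auto
      have "(?p n s * E n s - X s * \<sigma> s)\<^sup>2 = (?p n s * (E n s - \<sigma> s) + (?p n s - X s) * \<sigma> s)\<^sup>2"
        by (simp add: algebra_simps)
      also have "\<dots> \<le> 2 * ((?p n s)\<^sup>2 * (E n s - \<sigma> s)\<^sup>2) + 2 * ((?p n s - X s)\<^sup>2 * (\<sigma> s)\<^sup>2)"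
        using zero_le_power2[of "?p n s * (E n s - \<sigma> s) - (?p n s - X s) * \<sigma> s"]
        by (simp add: power2_eq_square algebra_simps)
      also have "\<dots> \<le> 2 * ((D + 1)\<^sup>2 * (E n s - \<sigma> s)\<^sup>2) + 2 * (e\<^sup>2 * S\<^sup>2)"
        using mult_right_mono[OF p, of "(E n s - \<sigma> s)\<^sup>2"] q by simp
      finally show ?thesis by (simp add: mult.assoc)
    qed
    have i: "set_integrable lborel {0..T} (\<lambda>s. 2 * (D + 1)\<^sup>2 * (E n s - \<sigma> s)\<^sup>2)"
      "set_integrable lborel {0..T} (\<lambda>s. 2 * e\<^sup>2 * S\<^sup>2)"
      using intE[of n] by (intro set_integrable_mult_right, simp)
        (rule borel_integrable_atLeastAtMost', rule continuous_on_const)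
    have "(LINT s:{0..T}|lborel. (?p n s * E n s - X s * \<sigma> s)\<^sup>2)
      \<le> (LINT s:{0..T}|lborel. 2 * (D + 1)\<^sup>2 * (E n s - \<sigma> s)\<^sup>2 + 2 * e\<^sup>2 * S\<^sup>2)"
      unfolding set_lebesgue_integral_def
    proof (rule integral_mono_AE)
      show "integrable lborel (\<lambda>s. indicator {0..T} s *\<^sub>R (?p n s * E n s - X s * \<sigma> s)\<^sup>2)"
        using int[of n] by (simp add: set_integrable_def)
      show "integrable lborel (\<lambda>s. indicator {0..T} s *\<^sub>R (2 * (D + 1)\<^sup>2 * (E n s - \<sigma> s)\<^sup>2 + 2 * e\<^sup>2 * S\<^sup>2))"
        using set_integral_add(1)[OF i] by (simp add: set_integrable_def)
      \<comment> \<open>At 0 the step function vanishes whatever \<open>X\<close> is, so the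
        pointwise bound may fail at this one point.\<close>
      have "AE s::real in lborel. s \<noteq> 0" by (rule AE_lborel_singleton)
      then show "AE s in lborel. indicator {0..T} s *\<^sub>R (?p n s * E n s - X s * \<sigma> s)\<^sup>2
          \<le> indicator {0..T} s *\<^sub>R (2 * (D + 1)\<^sup>2 * (E n s - \<sigma> s)\<^sup>2 + 2 * e\<^sup>2 * S\<^sup>2)"
        by eventually_elim (use pt in \<open>auto simp: indicator_def\<close>)
    qed
    also have "\<dots> = 2 * (D + 1)\<^sup>2 * (LINT s:{0..T}|lborel. (E n s - \<sigma> s)\<^sup>2) + 2 * e\<^sup>2 * S\<^sup>2 * T"
      using set_integral_add(2)[OF i] T by (simp add: set_lebesgue_integral_def)
    finally show ?thesis .
  qed
  show "(\<lambda>n. LINT s:{0..T}|lborel. (?p n s * E n s - X s * \<sigma> s)\<^sup>2) \<longlonglongrightarrow> 0"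
  proof (rule tendstoI)
    fix r :: real assume r: "r > 0"
    define A where "A = 2 * S\<^sup>2 * T + 1"
    have A: "A \<ge> 1" using T by (simp add: A_def)
    \<comment> \<open>\<open>e \<le> 1\<close> serves twice: it keeps the step function below
      \<open>D + 1\<close> and gives \<open>e\<^sup>2 \<le> e\<close>.\<close>
    define e where "e = min 1 (r / (2 * A))"
    have e: "0 < e" "e \<le> 1" using r A by (auto simp: e_def)
    have "e\<^sup>2 \<le> e" using e by (simp add: power2_eq_square mult_left_le)
    also have "e \<le> r / (2 * A)" by (simp add: e_def)
    finally have "e\<^sup>2 * A \<le> r / 2" using A by (simp add: field_simps)
    moreover have "2 * e\<^sup>2 * S\<^sup>2 * T \<le> e\<^sup>2 * A" by (simp add: A_def algebra_simps)
    ultimately have small: "2 * e\<^sup>2 * S\<^sup>2 * T \<le> r / 2" by linarith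
    have "(\<lambda>n. 2 * (D + 1)\<^sup>2 * (LINT s:{0..T}|lborel. (E n s - \<sigma> s)\<^sup>2)) \<longlonglongrightarrow> 2 * (D + 1)\<^sup>2 * 0"
      by (intro tendsto_intros lim)
    then have "eventually (\<lambda>n. 2 * (D + 1)\<^sup>2 * (LINT s:{0..T}|lborel. (E n s - \<sigma> s)\<^sup>2) < r / 2) sequentially"
      using r by (intro order_tendstoD(2)) auto
    then show "eventually (\<lambda>n. dist (LINT s:{0..T}|lborel. (?p n s * E n s - X s * \<sigma> s)\<^sup>2) 0 < r) sequentially"
      using g[OF e(1)] eventually_dyadic_covers[OF m, of T]
    proof eventually_elim
      case (elim n)
      have "0 \<le> (LINT s:{0..T}|lborel. (?p n s * E n s - X s * \<sigma> s)\<^sup>2)"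
        unfolding set_lebesgue_integral_def by (intro integral_nonneg_AE AE_I2) simp
      then show ?case using ineq[OF elim(2,3) e] elim(1) small by (simp add: dist_real_def)
    qed
  qed
qed

section \<open>Elementary processes\<close>

abbreviation lifetime :: "('w \<Rightarrow> ennreal) \<Rightarrow> 'w \<Rightarrow> real set" where
  "lifetime \<tau> \<omega> \<equiv> {t. 0 \<le> t \<and> ennreal t < \<tau> \<omega>}"

abbreviation ito_approximation ::
    "(real \<Rightarrow> 'w \<Rightarrow> real) \<Rightarrow> (nat \<Rightarrow> 'w elementary) \<Rightarrow> (real \<Rightarrow> 'w \<Rightarrow> real) \<Rightarrow>
     (real \<Rightarrow> 'w \<Rightarrow> real) \<Rightarrow> real \<Rightarrow> 'w \<Rightarrow> bool" where
  "ito_approximation W E H I t \<omega> \<equiv>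
     (\<forall>n. set_integrable lborel {0..t} (\<lambda>s. (elementary_value (E n) s \<omega> - H s \<omega>)\<^sup>2)) \<and>
     ((\<lambda>n. LINT s:{0..t}|lborel. (elementary_value (E n) s \<omega> - H s \<omega>)\<^sup>2) \<longlonglongrightarrow> 0) \<and>
     uniform_limit {0..t} (\<lambda>n u. elementary_integral W (E n) u \<omega>) (\<lambda>u. I u \<omega>) sequentially"

text \<open>An elementary process has one increasing grid, but products and sums produce overlapping
  intervals. All end points are sorted into a single grid, and each cell receives the sum of the
  levels of the intervals covering it. Such intervals have begun when the cell begins, so the sum is
  adapted.\<close>

lemma elementary_of_intervals:
  fixes a b :: "'i \<Rightarrow> real" and \<xi> :: "'i \<Rightarrow> 'w \<Rightarrow> real"
  assumes filt: "filtered_prob_space M Fl" and S: "finite S"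
    and ab: "\<And>i. i \<in> S \<Longrightarrow> 0 \<le> a i" "\<And>i. i \<in> S \<Longrightarrow> a i \<le> b i"
    and \<xi>: "\<And>i. i \<in> S \<Longrightarrow> \<xi> i \<in> borel_measurable (Fl (a i))" "\<And>i. i \<in> S \<Longrightarrow> \<exists>C. \<forall>\<omega>\<in>space M. \<bar>\<xi> i \<omega>\<bar> \<le> C"
  shows "\<exists>E. elementary_process M Fl E \<and>
    (\<forall>s \<omega>. elementary_value E s \<omega> = (\<Sum>i\<in>S. \<xi> i \<omega> * indicator {a i<..b i} s)) \<and>
    (\<forall>W t \<omega>. elementary_integral W E t \<omega> = (\<Sum>i\<in>S. \<xi> i \<omega> * (W (min (b i) t) \<omega> - W (min (a i) t) \<omega>)))"
proof (cases "S = {}")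
  case True
  then show ?thesis
    by (intro exI[of _ "Elementary 0 (\<lambda>_. 0) (\<lambda>_ _. 0)"])
       (auto simp: elementary_process_def elementary_value_def elementary_integral_def)
next
  case False
  interpret filtered_prob_space M Fl by fact
  define P where "P = sorted_list_of_set (a ` S \<union> b ` S)"
  define n where "n = length P - 1"
  have setP: "set P = a ` S \<union> b ` S" and srt: "sorted_wrt (<) P"
    unfolding P_def using S by (auto intro: strict_sorted_list_of_set)
  have len: "length P = Suc n" using False setP unfolding n_def by (cases P) auto
  have less: "P ! p < P ! q \<longleftrightarrow> p < q" if "p \<le> n" "q \<le> n" for p q
    using sorted_wrt_nth_less[OF srt, of p q] sorted_wrt_nth_less[OF srt, of q p] that len
    by (metis le_imp_less_Suc less_asym linorder_neqE_nat order_less_irrefl)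
  have le: "P ! p \<le> P ! q \<longleftrightarrow> p \<le> q" if "p \<le> n" "q \<le> n" for p q
    using less[OF that(2,1)] by (simp add: not_less[symmetric])
  define c where "c i l = (if a i \<le> P ! l \<and> P ! Suc l \<le> b i then 1 else 0 :: real)" for i l
  \<comment> \<open>Stated for arbitrary \<open>f\<close>, so that one identity gives both the
    values and the integrals.\<close>
  have telescope: "(\<Sum>l<n. c i l * (f (P ! Suc l) - f (P ! l))) = f (b i) - f (a i)"
    if i: "i \<in> S" for f :: "real \<Rightarrow> real" and i
  proof -
    obtain p where p: "p \<le> n" "P ! p = a i"
      using setP i len by (metis UnI1 imageI in_set_conv_nth less_Suc_eq_le)
    obtain q where q: "q \<le> n" "P ! q = b i"
      using setP i len by (metis UnI2 imageI in_set_conv_nth less_Suc_eq_le)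
    have pq: "p \<le> q" using ab(2)[OF i] le[OF p(1) q(1)] p q by simp
    have "(\<Sum>l<n. c i l * (f (P ! Suc l) - f (P ! l))) = (\<Sum>l\<in>{p..<q}. f (P ! Suc l) - f (P ! l))"
    proof (rule sum.mono_neutral_cong_right)
      show "{p..<q} \<subseteq> {..<n}" using q by auto
      show "\<forall>l\<in>{..<n} - {p..<q}. c i l * (f (P ! Suc l) - f (P ! l)) = 0"
        using le p q unfolding c_def p(2)[symmetric] q(2)[symmetric] by auto
      show "c i l * (f (P ! Suc l) - f (P ! l)) = f (P ! Suc l) - f (P ! l)" if "l \<in> {p..<q}" for l
        using that le p q unfolding c_def p(2)[symmetric] q(2)[symmetric] by auto
    qed auto
    also have "\<dots> = f (P ! q) - f (P ! p)" using pq by (rule sum_Suc_diff')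
    finally show ?thesis by (simp add: p q)
  qed
  define E where "E = Elementary n (\<lambda>l. P ! l) (\<lambda>l \<omega>. \<Sum>i\<in>S. \<xi> i \<omega> * c i l)"
  have "elementary_process M Fl E"
    unfolding elementary_process_def E_def elementary.sel
  proof (intro conjI allI impI)
    have "P ! 0 \<in> set P" using len by simp
    moreover have "0 \<le> x" if "x \<in> set P" for x
    proof -
      have "0 \<le> b i" if "i \<in> S" for i using ab[OF that] by (rule order_trans)
      then show ?thesis using that ab(1) unfolding setP by blast
    qed
    ultimately show "0 \<le> P ! 0" by blast
  next
    fix l assume l: "l < n"
    show "P ! l \<le> P ! Suc l" using le[of l "Suc l"] l by simp
    show "(\<lambda>\<omega>. \<Sum>i\<in>S. \<xi> i \<omega> * c i l) \<in> borel_measurable (Fl (P ! l))"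
    proof (rule borel_measurable_sum)
      fix i assume i: "i \<in> S"
      show "(\<lambda>\<omega>. \<xi> i \<omega> * c i l) \<in> borel_measurable (Fl (P ! l))"
      proof (cases "a i \<le> P ! l")
        case True
        have "\<xi> i \<in> borel_measurable (Fl (P ! l))" by (rule measurable_Fl_mono[OF \<xi>(1)[OF i] True])
        then show ?thesis by simp
      qed (simp add: c_def)
    qed
    have "\<forall>i\<in>S. \<exists>C. \<forall>\<omega>\<in>space M. \<bar>\<xi> i \<omega>\<bar> \<le> C" using \<xi>(2) by blast
    then obtain C where C: "\<And>i \<omega>. i \<in> S \<Longrightarrow> \<omega> \<in> space M \<Longrightarrow> \<bar>\<xi> i \<omega>\<bar> \<le> C i" by metis
    have "\<bar>\<Sum>i\<in>S. \<xi> i \<omega> * c i l\<bar> \<le> (\<Sum>i\<in>S. C i)" if "\<omega> \<in> space M" for \<omega>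
    proof (rule order_trans[OF sum_abs sum_mono])
      fix i assume "i \<in> S"
      with C[of i \<omega>] that show "\<bar>\<xi> i \<omega> * c i l\<bar> \<le> C i" by (auto simp: c_def)
    qed
    then show "\<exists>C. \<forall>\<omega>\<in>space M. \<bar>\<Sum>i\<in>S. \<xi> i \<omega> * c i l\<bar> \<le> C" by blast
  qed
  moreover have "elementary_value E s \<omega> = (\<Sum>i\<in>S. \<xi> i \<omega> * indicator {a i<..b i} s)" for s \<omega>
  proof -
    \<comment> \<open>The indicator of an interval open on the left is the difference of
      \<open>?f\<close> at its right and left end points, which brings the value into telescoping
      form.\<close>
    let ?f = "\<lambda>x. if s \<le> x then 1 else 0 :: real"
    have "elementary_value E s \<omega> = (\<Sum>l<n. \<Sum>i\<in>S. \<xi> i \<omega> * (c i l * (?f (P ! Suc l) - ?f (P ! l))))"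
      unfolding elementary_value_def E_def elementary.sel sum_distrib_right
    proof (intro sum.cong refl)
      fix l i assume "l \<in> {..<n}"
      then have "P ! l \<le> P ! Suc l" using le[of l "Suc l"] by simp
      then show "\<xi> i \<omega> * c i l * indicator {P ! l<..P ! Suc l} s = \<xi> i \<omega> * (c i l * (?f (P ! Suc l) - ?f (P ! l)))"
        by (auto simp: indicator_def)
    qed
    also have "\<dots> = (\<Sum>i\<in>S. \<xi> i \<omega> * (\<Sum>l<n. c i l * (?f (P ! Suc l) - ?f (P ! l))))"
      by (subst sum.swap) (simp add: sum_distrib_left)
    also have "\<dots> = (\<Sum>i\<in>S. \<xi> i \<omega> * indicator {a i<..b i} s)"
    proof (intro sum.cong refl)
      fix i assume i: "i \<in> S"
      show "\<xi> i \<omega> * (\<Sum>l<n. c i l * (?f (P ! Suc l) - ?f (P ! l))) = \<xi> i \<omega> * indicator {a i<..b i} s"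
        using ab(2)[OF i] by (subst telescope[OF i]) (auto simp: indicator_def)
    qed
    finally show ?thesis .
  qed
  moreover have "elementary_integral W E t \<omega> = (\<Sum>i\<in>S. \<xi> i \<omega> * (W (min (b i) t) \<omega> - W (min (a i) t) \<omega>))" for W t \<omega>
  proof -
    have "elementary_integral W E t \<omega>
       = (\<Sum>l<n. \<Sum>i\<in>S. \<xi> i \<omega> * (c i l * (W (min (P ! Suc l) t) \<omega> - W (min (P ! l) t) \<omega>)))"
      unfolding elementary_integral_def E_def elementary.sel sum_distrib_right by (simp add: mult.assoc)
    also have "\<dots> = (\<Sum>i\<in>S. \<xi> i \<omega> * (\<Sum>l<n. c i l * (W (min (P ! Suc l) t) \<omega> - W (min (P ! l) t) \<omega>)))"
      by (subst sum.swap) (simp add: sum_distrib_left)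
    also have "\<dots> = (\<Sum>i\<in>S. \<xi> i \<omega> * (W (min (b i) t) \<omega> - W (min (a i) t) \<omega>))"
      by (intro sum.cong refl) (simp only: telescope[of _ "\<lambda>x. W (min x t) \<omega>"])
    finally show ?thesis .
  qed
  ultimately show ?thesis by blast
qed

lemma elementary_grid_mono:
  assumes E: "elementary_process M Fl E" and "j \<le> k" "k \<le> stages E"
  shows "grid E j \<le> grid E k"
  using assms(2,3)
proof (induction k rule: dec_induct)
  case (step k)
  then have "grid E k \<le> grid E (Suc k)" using E by (simp add: elementary_process_def)
  with step show ?case by simp
qed simp

lemma elementary_grid_nonneg:
  assumes E: "elementary_process M Fl E" and "k \<le> stages E"
  shows "0 \<le> grid E k"
  using elementary_grid_mono[OF E, of 0 k] E assms(2) by (auto simp: elementary_process_def)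

text \<open>The intervals of all the processes are collected into one family, indexed by pairs;
  overlaps are harmless for \<open>elementary_of_intervals\<close>.\<close>

lemma elementary_lincomb:
  fixes E :: "'i \<Rightarrow> 'w elementary"
  assumes filt: "filtered_prob_space M Fl" and S: "finite S" and E: "\<And>i. i \<in> S \<Longrightarrow> elementary_process M Fl (E i)"
  shows "\<exists>F. elementary_process M Fl F \<and>
    (\<forall>s \<omega>. elementary_value F s \<omega> = (\<Sum>i\<in>S. c i * elementary_value (E i) s \<omega>)) \<and>
    (\<forall>W t \<omega>. elementary_integral W F t \<omega> = (\<Sum>i\<in>S. c i * elementary_integral W (E i) t \<omega>))"
proof -
  define K where "K = Sigma S (\<lambda>i. {..<stages (E i)})"
  have K: "finite K" "\<And>i k. (i, k) \<in> K \<Longrightarrow> i \<in> S \<and> k < stages (E i)" using S by (auto simp: K_def)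
  have EK: "elementary_process M Fl (E i)" "k < stages (E i)" if "(i, k) \<in> K" for i k
    using K(2)[OF that] E by auto
  have "\<exists>F. elementary_process M Fl F \<and>
    (\<forall>s \<omega>. elementary_value F s \<omega> = (\<Sum>x\<in>K. (case x of (i, k) \<Rightarrow> \<lambda>\<omega>. c i * level (E i) k \<omega>) \<omega> *
        indicator {(case x of (i, k) \<Rightarrow> grid (E i) k)<..(case x of (i, k) \<Rightarrow> grid (E i) (Suc k))} s)) \<and>
    (\<forall>W t \<omega>. elementary_integral W F t \<omega> = (\<Sum>x\<in>K. (case x of (i, k) \<Rightarrow> \<lambda>\<omega>. c i * level (E i) k \<omega>) \<omega> *
        (W (min (case x of (i, k) \<Rightarrow> grid (E i) (Suc k)) t) \<omega> - W (min (case x of (i, k) \<Rightarrow> grid (E i) k) t) \<omega>)))"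
  proof (rule elementary_of_intervals[OF filt K(1)])
    fix x assume "x \<in> K"
    then obtain i k where x: "x = (i, k)" "(i, k) \<in> K" by (cases x) auto
    note e = EK[OF x(2)]
    show "0 \<le> (case x of (i, k) \<Rightarrow> grid (E i) k)" using elementary_grid_nonneg[OF e(1)] e(2) x by simp
    show "(case x of (i, k) \<Rightarrow> grid (E i) k) \<le> (case x of (i, k) \<Rightarrow> grid (E i) (Suc k))"
      using e x by (simp add: elementary_process_def)
    have "level (E i) k \<in> borel_measurable (Fl (grid (E i) k))"
      using e by (simp add: elementary_process_def)
    then show "(case x of (i, k) \<Rightarrow> \<lambda>\<omega>. c i * level (E i) k \<omega>) \<in> borel_measurable (Fl (case x of (i, k) \<Rightarrow> grid (E i) k))"
      using x by simp
    obtain C where "\<forall>\<omega>\<in>space M. \<bar>level (E i) k \<omega>\<bar> \<le> C" using e by (auto simp: elementary_process_def)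
    then have "\<forall>\<omega>\<in>space M. \<bar>c i * level (E i) k \<omega>\<bar> \<le> \<bar>c i\<bar> * C" by (auto simp: abs_mult mult_left_mono)
    then show "\<exists>C. \<forall>\<omega>\<in>space M. \<bar>(case x of (i, k) \<Rightarrow> \<lambda>\<omega>. c i * level (E i) k \<omega>) \<omega>\<bar> \<le> C" using x by auto
  qed
  then obtain F where F: "elementary_process M Fl F"
    "\<And>s \<omega>. elementary_value F s \<omega> = (\<Sum>(i, k)\<in>K. c i * level (E i) k \<omega> * indicator {grid (E i) k<..grid (E i) (Suc k)} s)"
    "\<And>W t \<omega>. elementary_integral W F t \<omega> = (\<Sum>(i, k)\<in>K. c i * level (E i) k \<omega> * (W (min (grid (E i) (Suc k)) t) \<omega> - W (min (grid (E i) k) t) \<omega>))"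
    by (auto simp: split_beta)
  have Sigma: "(\<Sum>(i, k)\<in>K. f i k) = (\<Sum>i\<in>S. \<Sum>k<stages (E i). f i k)" for f :: "'i \<Rightarrow> nat \<Rightarrow> real"
    unfolding K_def using S by (subst sum.Sigma) auto
  have "elementary_value F s \<omega> = (\<Sum>i\<in>S. c i * elementary_value (E i) s \<omega>)" for s \<omega>
    unfolding F(2) Sigma by (simp only: elementary_value_def sum_distrib_left mult.assoc)
  moreover have "elementary_integral W F t \<omega> = (\<Sum>i\<in>S. c i * elementary_integral W (E i) t \<omega>)" for W t \<omega>
    unfolding F(3) Sigma by (simp only: elementary_integral_def sum_distrib_left mult.assoc)
  ultimately show ?thesis using F(1) by blast
qed

text \<open>The product lives on the intersections of dyadic cells with grid cells. Both factors are
  known at the later of the two left end points, where the intersection begins.\<close>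

lemma elementary_dyadic_step:
  assumes filt: "filtered_prob_space M Fl" and E: "elementary_process M Fl E"
    and G: "\<And>k. G k \<in> borel_measurable (Fl (dyadic m k))" "\<And>k \<omega>. \<bar>G k \<omega>\<bar> \<le> C"
  shows "\<exists>F. elementary_process M Fl F \<and>
    (\<forall>s \<omega>. elementary_value F s \<omega> = dyadic_step (\<lambda>k. G k \<omega>) m s * elementary_value E s \<omega>) \<and>
    (\<forall>W t \<omega>. elementary_integral W F t \<omega> = (\<Sum>k<4 ^ m. G k \<omega> * increment (\<lambda>x. elementary_integral W E x \<omega>) m t k))"
proof -
  interpret filtered_prob_space M Fl by fact
  define K where "K = {..<4 ^ m :: nat} \<times> {..<stages E}"
  define a where "a x = max (dyadic m (fst x)) (grid E (snd x))" for x
  \<comment> \<open>The outer maximum turns an empty intersection into a degenerate interval, which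
    contributes 0 to value and integral.\<close>
  define b where "b x = max (a x) (min (dyadic m (Suc (fst x))) (grid E (Suc (snd x))))" for x
  define \<xi> where "\<xi> x \<omega> = G (fst x) \<omega> * level E (snd x) \<omega>" for x \<omega>
  have K: "finite K" by (simp add: K_def)
  have "\<exists>F. elementary_process M Fl F \<and>
    (\<forall>s \<omega>. elementary_value F s \<omega> = (\<Sum>x\<in>K. \<xi> x \<omega> * indicator {a x<..b x} s)) \<and>
    (\<forall>W t \<omega>. elementary_integral W F t \<omega> = (\<Sum>x\<in>K. \<xi> x \<omega> * (W (min (b x) t) \<omega> - W (min (a x) t) \<omega>)))"
  proof (rule elementary_of_intervals[OF filt K])
    fix x assume "x \<in> K"
    then have j: "snd x < stages E" by (auto simp: K_def)
    show "0 \<le> a x" by (simp add: a_def le_max_iff_disj)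
    show "a x \<le> b x" by (simp add: b_def)
    have "G (fst x) \<in> borel_measurable (Fl (a x))" by (rule measurable_Fl_mono[OF G(1)]) (simp add: a_def)
    moreover have "level E (snd x) \<in> borel_measurable (Fl (a x))"
      by (rule measurable_Fl_mono[of _ "grid E (snd x)"]) (use E j in \<open>auto simp: a_def elementary_process_def\<close>)
    ultimately show "\<xi> x \<in> borel_measurable (Fl (a x))" unfolding \<xi>_def[abs_def] by simp
    obtain D where D: "\<forall>\<omega>\<in>space M. \<bar>level E (snd x) \<omega>\<bar> \<le> D" using E j by (auto simp: elementary_process_def)
    have "\<bar>\<xi> x \<omega>\<bar> \<le> C * D" if "\<omega> \<in> space M" for \<omega>
      unfolding \<xi>_def abs_mult using G(2)[of "fst x" \<omega>] D that by (intro mult_mono) auto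
    then show "\<exists>C. \<forall>\<omega>\<in>space M. \<bar>\<xi> x \<omega>\<bar> \<le> C" by blast
  qed
  then obtain F where F: "elementary_process M Fl F"
    "\<And>s \<omega>. elementary_value F s \<omega> = (\<Sum>x\<in>K. \<xi> x \<omega> * indicator {a x<..b x} s)"
    "\<And>W t \<omega>. elementary_integral W F t \<omega> = (\<Sum>x\<in>K. \<xi> x \<omega> * (W (min (b x) t) \<omega> - W (min (a x) t) \<omega>))"
    by blast
  have "elementary_value F s \<omega> = dyadic_step (\<lambda>k. G k \<omega>) m s * elementary_value E s \<omega>" for s \<omega>
  proof -
    have eq: "\<xi> x \<omega> * indicator {a x<..b x} s = (G (fst x) \<omega> * indicator {dyadic m (fst x)<..dyadic m (Suc (fst x))} s) *
        (level E (snd x) \<omega> * indicator {grid E (snd x)<..grid E (Suc (snd x))} s)" for x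
      by (auto simp: a_def b_def \<xi>_def indicator_def)
    show ?thesis
      unfolding F(2) eq dyadic_step_def sum_product K_def sum.cartesian_product
        elementary_value_def[of E]
      by (simp only: case_prod_unfold)
  qed
  moreover have "elementary_integral W F t \<omega> = (\<Sum>k<4 ^ m. G k \<omega> * increment (\<lambda>x. elementary_integral W E x \<omega>) m t k)" for W t \<omega>
  proof -
    \<comment> \<open>The increment of \<open>f\<close> over the intersection of two intervals is
      the mixed difference of \<open>f (min g d)\<close>: integrating over the grid cell first and
      taking the increment over the dyadic cell afterwards gives the same.\<close>
    have key: "f (max (max d g) (min d' g')) - f (max d g) = (f (min g' d') - f (min g d')) - (f (min g' d) - f (min g d))"
      if "g \<le> g'" "d \<le> d'" for f :: "real \<Rightarrow> real" and d d' g g' :: real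
      using that by (cases "g \<le> d"; cases "g' \<le> d"; cases "g' \<le> d'"; cases "g \<le> d'")
        (auto simp: min_def max_def, (metis order.antisym order.trans)+)
    have "\<xi> x \<omega> * (W (min (b x) t) \<omega> - W (min (a x) t) \<omega>) = G (fst x) \<omega> * (level E (snd x) \<omega> *
        ((W (min (grid E (Suc (snd x))) (min (dyadic m (Suc (fst x))) t)) \<omega> - W (min (grid E (snd x)) (min (dyadic m (Suc (fst x))) t)) \<omega>)
        - (W (min (grid E (Suc (snd x))) (min (dyadic m (fst x)) t)) \<omega> - W (min (grid E (snd x)) (min (dyadic m (fst x)) t)) \<omega>)))"
      if x: "x \<in> K" for x
    proof -
      have "grid E (snd x) \<le> grid E (Suc (snd x))" using E x by (auto simp: elementary_process_def K_def)
      from key[OF this dyadic_le_Suc[of m "fst x"], of "\<lambda>y. W (min y t) \<omega>"]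
      show ?thesis unfolding \<xi>_def a_def b_def by (simp add: min.assoc)
    qed
    then have "elementary_integral W F t \<omega> = (\<Sum>x\<in>K. G (fst x) \<omega> * (level E (snd x) \<omega> *
        ((W (min (grid E (Suc (snd x))) (min (dyadic m (Suc (fst x))) t)) \<omega> - W (min (grid E (snd x)) (min (dyadic m (Suc (fst x))) t)) \<omega>)
        - (W (min (grid E (Suc (snd x))) (min (dyadic m (fst x)) t)) \<omega> - W (min (grid E (snd x)) (min (dyadic m (fst x)) t)) \<omega>))))"
      unfolding F(3) by (intro sum.cong refl)
    also have "\<dots> = (\<Sum>k<4 ^ m. \<Sum>j<stages E. G k \<omega> * (level E j \<omega> *
        ((W (min (grid E (Suc j)) (min (dyadic m (Suc k)) t)) \<omega> - W (min (grid E j) (min (dyadic m (Suc k)) t)) \<omega>)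
        - (W (min (grid E (Suc j)) (min (dyadic m k) t)) \<omega> - W (min (grid E j) (min (dyadic m k) t)) \<omega>))))"
      unfolding K_def sum.cartesian_product by (simp add: split_beta)
    also have "\<dots> = (\<Sum>k<4 ^ m. G k \<omega> * increment (\<lambda>x. elementary_integral W E x \<omega>) m t k)"
      unfolding increment_def elementary_integral_def sum_subtractf[symmetric] sum_distrib_left[symmetric]
      by (simp add: right_diff_distrib)
    finally show ?thesis .
  qed
  ultimately show ?thesis using F(1) by blast
qed

lemma elementary_value_bounded:
  assumes E: "elementary_process M Fl E" and \<omega>: "\<omega> \<in> space M"
  shows "(\<lambda>s. elementary_value E s \<omega>) \<in> borel_measurable borel"
    and "\<bar>elementary_value E s \<omega>\<bar> \<le> (\<Sum>k<stages E. \<bar>level E k \<omega>\<bar>)"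
proof -
  show "(\<lambda>s. elementary_value E s \<omega>) \<in> borel_measurable borel"
    unfolding elementary_value_def by measurable
  show "\<bar>elementary_value E s \<omega>\<bar> \<le> (\<Sum>k<stages E. \<bar>level E k \<omega>\<bar>)"
    unfolding elementary_value_def by (rule order_trans[OF sum_abs sum_mono]) (auto simp: indicator_def)
qed

lemma elementary_value_square:
  assumes E: "elementary_process M Fl E"
  shows "(elementary_value E s \<omega>)\<^sup>2 = (\<Sum>k<stages E. (level E k \<omega>)\<^sup>2 * indicator {grid E k<..grid E (Suc k)} s)"
proof -
  let ?i = "\<lambda>k. indicator {grid E k<..grid E (Suc k)} s :: real"
  have disj: "?i k * ?i l = 0" if "k < stages E" "l < stages E" "k \<noteq> l" for k l
    using elementary_grid_mono[OF E, of "Suc k" l] elementary_grid_mono[OF E, of "Suc l" k] that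
    by (cases k l rule: linorder_cases) (auto simp: indicator_def)
  have "(elementary_value E s \<omega>)\<^sup>2 = (\<Sum>k<stages E. \<Sum>l<stages E. (level E k \<omega> * ?i k) * (level E l \<omega> * ?i l))"
    unfolding elementary_value_def power2_eq_square by (rule sum_product)
  also have "\<dots> = (\<Sum>k<stages E. \<Sum>l<stages E. if k = l then (level E k \<omega>)\<^sup>2 * ?i k else 0)"
  proof (intro sum.cong refl)
    fix k l assume kl: "k \<in> {..<stages E}" "l \<in> {..<stages E}"
    show "(level E k \<omega> * ?i k) * (level E l \<omega> * ?i l) = (if k = l then (level E k \<omega>)\<^sup>2 * ?i k else 0)"
    proof (cases "k = l")
      case False
      have "(level E k \<omega> * ?i k) * (level E l \<omega> * ?i l) = level E k \<omega> * level E l \<omega> * (?i k * ?i l)" by simp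
      also have "?i k * ?i l = 0" using kl False by (intro disj) auto
      finally show ?thesis using False by simp
    qed (simp add: power2_eq_square indicator_def)
  qed
  also have "\<dots> = (\<Sum>k<stages E. (level E k \<omega>)\<^sup>2 * ?i k)" by (simp add: sum.delta')
  finally show ?thesis .
qed

text \<open>As a finite sum in the levels the integral is visibly measurable, can be matched with a
  limit of quadratic variations, and can be followed cell by cell when levels are truncated.\<close>

lemma elementary_value_square_integral:
  assumes E: "elementary_process M Fl E" and t: "0 \<le> t"
  shows "(LINT s:{0..t}|lborel. (elementary_value E s \<omega>)\<^sup>2) =
     (\<Sum>k<stages E. (level E k \<omega>)\<^sup>2 * (min (grid E (Suc k)) t - min (grid E k) t))"
proof -
  have i: "{0..t} \<inter> {grid E k<..grid E (Suc k)} = {min (grid E k) t<..min (grid E (Suc k)) t}"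
    and le: "min (grid E k) t \<le> min (grid E (Suc k)) t" if "k < stages E" for k
    using elementary_grid_nonneg[OF E, of k] elementary_grid_mono[OF E, of k "Suc k"] that t by auto
  have "indicator {0..t} s *\<^sub>R (elementary_value E s \<omega>)\<^sup>2
     = (\<Sum>k<stages E. (level E k \<omega>)\<^sup>2 * indicator {min (grid E k) t<..min (grid E (Suc k)) t} s)" for s
    unfolding elementary_value_square[OF E] real_scaleR_def sum_distrib_left
  proof (intro sum.cong refl)
    fix k assume "k \<in> {..<stages E}"
    then show "indicator {0..t} s * ((level E k \<omega>)\<^sup>2 * indicator {grid E k<..grid E (Suc k)} s)
      = (level E k \<omega>)\<^sup>2 * indicator {min (grid E k) t<..min (grid E (Suc k)) t} s"
      using i[of k] indicator_inter_arith[of "{0..t}" "{grid E k<..grid E (Suc k)}" s, where ?'a=real] by simp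
  qed
  then have "(LINT s:{0..t}|lborel. (elementary_value E s \<omega>)\<^sup>2)
     = (LINT s|lborel. (\<Sum>k<stages E. (level E k \<omega>)\<^sup>2 * indicator {min (grid E k) t<..min (grid E (Suc k)) t} s))"
    unfolding set_lebesgue_integral_def by presburger
  also have "\<dots> = (\<Sum>k<stages E. (LINT s|lborel. (level E k \<omega>)\<^sup>2 * indicator {min (grid E k) t<..min (grid E (Suc k)) t} s))"
  proof -
    have "emeasure lborel {u<..v} < \<infinity>" for u v :: real
      by (cases "u \<le> v") (auto simp: emeasure_lborel_Ioc)
    then show ?thesis
      by (intro Bochner_Integration.integral_sum integrable_mult_right integrable_real_indicator) simp_all
  qed
  moreover have len: "(LINT s|lborel. indicator {u<..v} s) = v - u" if "u \<le> v" for u v :: real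
    using that by simp
  have "(\<Sum>k<stages E. (LINT s|lborel. (level E k \<omega>)\<^sup>2 * indicator {min (grid E k) t<..min (grid E (Suc k)) t} s))
    = (\<Sum>k<stages E. (level E k \<omega>)\<^sup>2 * (min (grid E (Suc k)) t - min (grid E k) t))"
  proof (intro sum.cong refl)
    fix k assume "k \<in> {..<stages E}"
    then have "min (grid E k) t \<le> min (grid E (Suc k)) t" using le by blast
    then show "(LINT s|lborel. (level E k \<omega>)\<^sup>2 * indicator {min (grid E k) t<..min (grid E (Suc k)) t} s)
      = (level E k \<omega>)\<^sup>2 * (min (grid E (Suc k)) t - min (grid E k) t)"
      using len by (simp only: integral_mult_right_zero)
  qed
  ultimately show ?thesis by presburger
qed

section \<open>Almost sure quadratic variation\<close>

context prob_space
begin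

text \<open>The series of the functions has finite expectation, hence is almost surely finite, and
  its terms tend to 0. This plays the part of a Borel-Cantelli argument.\<close>

lemma AE_tendsto_0_if_summable_expectation:
  fixes f :: "nat \<Rightarrow> 'a \<Rightarrow> real"
  assumes f: "\<And>n. integrable M (f n)" "\<And>n \<omega>. 0 \<le> f n \<omega>"
    and c: "\<And>n. expectation (f n) \<le> c n" "summable c"
  shows "AE \<omega> in M. (\<lambda>n. f n \<omega>) \<longlonglongrightarrow> 0"
proof -
  have [measurable]: "f n \<in> borel_measurable M" for n using f(1) by (rule borel_measurable_integrable)
  have c0: "0 \<le> c n" for n using c(1)[of n] Bochner_Integration.integral_nonneg[of M "f n"] f(2) by (meson order_trans)
  have "(\<integral>\<^sup>+\<omega>. (\<Sum>n. ennreal (f n \<omega>)) \<partial>M) = (\<Sum>n. \<integral>\<^sup>+\<omega>. ennreal (f n \<omega>) \<partial>M)"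
    by (rule nn_integral_suminf) measurable
  also have "\<dots> = (\<Sum>n. ennreal (expectation (f n)))"
    using f by (intro suminf_cong nn_integral_eq_integral) auto
  also have "\<dots> \<le> (\<Sum>n. ennreal (c n))"
    using c(1) by (intro suminf_le summableI ennreal_leI)
  also have "\<dots> = ennreal (suminf c)" using c0 c(2) by (rule suminf_ennreal2)
  finally have "(\<integral>\<^sup>+\<omega>. (\<Sum>n. ennreal (f n \<omega>)) \<partial>M) \<noteq> \<infinity>" by (auto simp: top_unique)
  then have "AE \<omega> in M. (\<Sum>n. ennreal (f n \<omega>)) \<noteq> \<infinity>" by (rule nn_integral_PInf_AE[rotated]) measurable
  then show ?thesis
  proof eventually_elim
    case (elim \<omega>)
    then have "summable (\<lambda>n. f n \<omega>)" using f(2) by (intro summable_suminf_not_top) auto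
    then show ?case by (rule summable_LIMSEQ_zero)
  qed
qed

text \<open>For each \<open>n\<close> the truncated expectations tend to 0 as the second index
  grows; choosing \<open>m n\<close> with expectation below \<open>(1 / 2) ^ n\<close> gives a
  summable sequence. The condition \<open>n \<le> m n\<close> forces the mesh to 0 in the
  application.\<close>

lemma AE_diagonal:
  fixes f :: "nat \<Rightarrow> nat \<Rightarrow> 'a \<Rightarrow> real"
  assumes f [measurable]: "\<And>n m. f n m \<in> borel_measurable M"
    and lim: "\<And>n. AE \<omega> in M. (\<lambda>m. f n m \<omega>) \<longlonglongrightarrow> 0"
  shows "\<exists>m. (\<forall>n. n \<le> m n) \<and> (AE \<omega> in M. (\<lambda>n. f n (m n) \<omega>) \<longlonglongrightarrow> 0)"
proof -
  \<comment> \<open>Truncation at 1 supplies the dominating function and does not affect convergence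
    to 0.\<close>
  define \<phi> where "\<phi> n m \<omega> = min 1 \<bar>f n m \<omega>\<bar>" for n m \<omega>
  have [measurable]: "\<phi> n m \<in> borel_measurable M" for n m unfolding \<phi>_def[abs_def] by measurable
  have \<phi>: "0 \<le> \<phi> n m \<omega>" "\<phi> n m \<omega> \<le> 1" for n m \<omega> by (auto simp: \<phi>_def)
  have int: "integrable M (\<phi> n m)" for n m
    using \<phi> by (intro integrable_const_bound[where B=1]) auto
  have "(\<lambda>m. expectation (\<phi> n m)) \<longlonglongrightarrow> expectation (\<lambda>\<omega>. 0)" for n
  proof (rule integral_dominated_convergence[where w="\<lambda>_. 1"])
    show "AE \<omega> in M. (\<lambda>m. \<phi> n m \<omega>) \<longlonglongrightarrow> 0"
      using lim[of n]
    proof eventually_elim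
      case (elim \<omega>)
      have "(\<lambda>m. min 1 \<bar>f n m \<omega>\<bar>) \<longlonglongrightarrow> min 1 \<bar>0\<bar>" by (intro tendsto_intros elim)
      then show ?case by (simp add: \<phi>_def)
    qed
    show "AE \<omega> in M. norm (\<phi> n m \<omega>) \<le> 1" for m using \<phi> by auto
  qed auto
  then have lim0: "(\<lambda>m. expectation (\<phi> n m)) \<longlonglongrightarrow> 0" for n by simp
  have "\<exists>m\<ge>n. expectation (\<phi> n m) < (1 / 2) ^ n" for n
  proof -
    have "eventually (\<lambda>m. expectation (\<phi> n m) < (1 / 2) ^ n) sequentially"
      using order_tendstoD(2)[OF lim0[of n], of "(1 / 2) ^ n"] by simp
    then have "eventually (\<lambda>m. n \<le> m \<and> expectation (\<phi> n m) < (1 / 2) ^ n) sequentially"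
      using eventually_ge_at_top[of n] by eventually_elim simp
    then show ?thesis using eventually_happens'[OF sequentially_bot] by blast
  qed
  then obtain m where m: "\<And>n. n \<le> m n" "\<And>n. expectation (\<phi> n (m n)) < (1 / 2) ^ n" by metis
  have "AE \<omega> in M. (\<lambda>n. \<phi> n (m n) \<omega>) \<longlonglongrightarrow> 0"
    by (rule AE_tendsto_0_if_summable_expectation[where c="\<lambda>n. (1 / 2) ^ n"])
      (use int \<phi> less_imp_le[OF m(2)] in \<open>auto intro: summable_geometric\<close>)
  then have "AE \<omega> in M. (\<lambda>n. f n (m n) \<omega>) \<longlonglongrightarrow> 0"
  proof eventually_elim
    case (elim \<omega>)
    have "eventually (\<lambda>n. \<phi> n (m n) \<omega> < 1) sequentially" using elim by (rule order_tendstoD) simp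
    then have "eventually (\<lambda>n. \<phi> n (m n) \<omega> = \<bar>f n (m n) \<omega>\<bar>) sequentially"
      by eventually_elim (auto simp: \<phi>_def min_def split: if_splits)
    then have "(\<lambda>n. \<bar>f n (m n) \<omega>\<bar>) \<longlonglongrightarrow> 0" using elim by (rule Lim_transform_eventually[rotated])
    then show ?case by (simp add: tendsto_rabs_zero_iff)
  qed
  with m(1) show ?thesis by blast
qed

end

context real_brownian
begin

text \<open>The mean square error is at most \<open>2 * v\<close> times the mesh, which is summable
  over the dyadic levels; hence the convergence is almost sure without passing to a
  subsequence.\<close>

lemma quad_var_W_AE:
  assumes v: "0 \<le> v"
  shows "AE \<omega> in M. (\<lambda>m. quad_var (\<lambda>t. W t \<omega>) m v) \<longlonglongrightarrow> v"
proof -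
  let ?u = "\<lambda>m k. min (dyadic m k) v"
  let ?X = "\<lambda>m \<omega>. \<Sum>k<4 ^ m. (W (?u m (Suc k)) \<omega> - W (?u m k) \<omega>)\<^sup>2 - (?u m (Suc k) - ?u m k)"
  have u: "0 \<le> ?u m k" "?u m k \<le> ?u m (Suc k)" for m k
    using v dyadic_le_Suc[of m k] by auto
  have X: "?X m \<omega> = quad_var (\<lambda>t. W t \<omega>) m v - (\<Sum>k<4 ^ m. increment (\<lambda>x. x) m v k)" for m \<omega>
    by (simp add: quad_var_def increment_def sum_subtractf)
  have "AE \<omega> in M. (\<lambda>m. (?X m \<omega>)\<^sup>2) \<longlonglongrightarrow> 0"
  proof (rule AE_tendsto_0_if_summable_expectation)
    show "integrable M (\<lambda>\<omega>. (?X m \<omega>)\<^sup>2)" for m by (rule expectation_quadratic_variation_error(1)[where u="?u m" for m, OF u])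
    show "expectation (\<lambda>\<omega>. (?X m \<omega>)\<^sup>2) \<le> 2 * v * (1 / 2) ^ m" for m
    proof -
      have "expectation (\<lambda>\<omega>. (?X m \<omega>)\<^sup>2) = (\<Sum>k<4 ^ m. 2 * (?u m (Suc k) - ?u m k)\<^sup>2)"
        by (rule expectation_quadratic_variation_error(2)[where u="?u m" for m, OF u])
      also have "\<dots> \<le> (\<Sum>k<4 ^ m. 2 * (1 / 2) ^ m * increment (\<lambda>x. x) m v k)"
      proof (rule sum_mono)
        fix k
        have "?u m (Suc k) - ?u m k \<le> (1 / 2) ^ m"
          using min_dyadic_bounds(3)[OF v order_refl, of m k] by (simp add: power_one_over)
        then have "(?u m (Suc k) - ?u m k) * (?u m (Suc k) - ?u m k) \<le> (1 / 2) ^ m * (?u m (Suc k) - ?u m k)"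
          using u(2)[of m k] by (intro mult_right_mono) auto
        then show "2 * (?u m (Suc k) - ?u m k)\<^sup>2 \<le> 2 * (1 / 2) ^ m * increment (\<lambda>x. x) m v k"
          by (simp add: increment_def power2_eq_square)
      qed
      also have "\<dots> = 2 * (1 / 2) ^ m * (\<Sum>k<4 ^ m. increment (\<lambda>x. x) m v k)" by (simp add: sum_distrib_left)
      also have "\<dots> \<le> 2 * (1 / 2) ^ m * v" using sum_increment_id_le[OF v] by (intro mult_left_mono) auto
      finally show ?thesis by (simp add: mult_ac)
    qed
    show "summable (\<lambda>m. 2 * v * (1 / 2) ^ m)" by (intro summable_mult summable_geometric) simp
  qed simp
  then show ?thesis
  proof eventually_elim
    case (elim \<omega>)
    have "(\<lambda>m. ?X m \<omega>) \<longlonglongrightarrow> 0" using tendsto_real_sqrt[OF elim] by (simp add: tendsto_rabs_zero_iff)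
    moreover have "(\<lambda>m. \<Sum>k<4 ^ m. increment (\<lambda>x. x) m v k) \<longlonglongrightarrow> v"
    proof (rule tendsto_eventually)
      show "eventually (\<lambda>m. (\<Sum>k<4 ^ m. increment (\<lambda>x. x) m v k) = v) sequentially"
        using eventually_dyadic_covers[OF filterlim_ident, of v]
        by eventually_elim (use sum_increment[of v _ "\<lambda>x. x"] v in simp)
    qed
    ultimately show ?case using tendsto_add unfolding X by fastforce
  qed
qed

text \<open>By symmetry \<open>s \<le> r\<close>; then continuity of the path makes the sum
  asymptotic to the quadratic variation up to \<open>s\<close>. Two stopping times are needed to
  expand the square of an elementary integral.\<close>

lemma cross_variation_W_AE:
  assumes "0 \<le> s" "0 \<le> r"
  shows "AE \<omega> in M. (\<lambda>m. \<Sum>k<4 ^ m. increment (\<lambda>t. W t \<omega>) m s k * increment (\<lambda>t. W t \<omega>) m r k) \<longlonglongrightarrow> min s r"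
  using assms
proof (induction s r rule: linorder_wlog)
  case (sym a b)
  then show ?case by (simp add: mult.commute min.commute)
next
  case (le s r)
  from W_continuous quad_var_W_AE[OF le(2)] show ?case
  proof eventually_elim
    case (elim \<omega>)
    let ?W = "\<lambda>t. W t \<omega>"
    let ?c = "\<lambda>m. \<Sum>k<4 ^ m. increment ?W m s k * increment ?W m r k"
    have c: "continuous_on {0..r} ?W" using elim(1) by (rule continuous_on_subset) auto
    have "(\<lambda>m. ?c m - quad_var ?W m s) \<longlonglongrightarrow> 0"
    proof (rule tendstoI)
      fix e :: real assume e: "e > 0"
      have "eventually (\<lambda>m. osc_le ?W m r (min 1 (e / 4))) sequentially"
        using e eventually_osc_le[OF c uniform_limit_const filterlim_ident, of "min 1 (e / 4)"] by simp
      then show "eventually (\<lambda>m. dist (?c m - quad_var ?W m s) 0 < e) sequentially"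
      proof eventually_elim
        case (elim m)
        have "(min 1 (e / 4))\<^sup>2 \<le> 1 * (e / 4)"
          unfolding power2_eq_square using e by (intro mult_mono) auto
        then show ?case using cross_variation_stopped[OF elim le(2,1) order_refl] e
          by (simp add: dist_real_def)
      qed
    qed
    from tendsto_add[OF this elim(2)] show ?case using le(1) by (simp add: min_def)
  qed
qed

section \<open>Quadratic variation of elementary integrals\<close>

lemma elementary_integral_adapted:
  assumes E: "elementary_process M Fl E" and t: "0 \<le> t"
  shows "elementary_integral W E t \<in> borel_measurable (Fl t)"
  unfolding elementary_integral_def[abs_def]
proof (rule borel_measurable_sum)
  fix k assume k: "k \<in> {..<stages E}"
  have g: "0 \<le> grid E k" "0 \<le> grid E (Suc k)" "grid E k \<le> grid E (Suc k)"
    using elementary_grid_nonneg[OF E] elementary_grid_mono[OF E, of k "Suc k"] k by auto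
  show "(\<lambda>\<omega>. level E k \<omega> * (W (min (grid E (Suc k)) t) \<omega> - W (min (grid E k) t) \<omega>)) \<in> borel_measurable (Fl t)"
  proof (cases "grid E k \<le> t")
    case True
    have "level E k \<in> borel_measurable (Fl t)"
      by (rule measurable_Fl_mono[OF _ True]) (use E k in \<open>auto simp: elementary_process_def\<close>)
    moreover have "W (min (grid E j) t) \<in> borel_measurable (Fl t)" if "j \<le> Suc k" for j
      using elementary_grid_nonneg[OF E, of j] that k t by (intro measurable_Fl_mono[OF W_adapted]) auto
    ultimately show ?thesis by simp
  next
    case False
    then show ?thesis using g by (simp add: min_def)
  qed
qed

lemma elementary_integral_continuous:
  assumes E: "elementary_process M Fl E" and \<omega>: "continuous_on {0..} (\<lambda>t. W t \<omega>)"
  shows "continuous_on {0..} (\<lambda>t. elementary_integral W E t \<omega>)"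
  unfolding elementary_integral_def
proof (intro continuous_intros)
  fix k assume k: "k \<in> {..<stages E}"
  have c: "continuous_on {0..} (\<lambda>t. W (min (grid E j) t) \<omega>)" if "j \<le> stages E" for j
    by (rule continuous_on_compose2[OF \<omega>]) (use elementary_grid_nonneg[OF E that] in \<open>auto intro!: continuous_intros\<close>)
  show "continuous_on {0..} (\<lambda>t. W (min (grid E (Suc k)) t) \<omega>)" "continuous_on {0..} (\<lambda>t. W (min (grid E k) t) \<omega>)"
    using k by (auto intro: c)
qed

text \<open>An increment of the integral is linear in the increments of \<open>W\<close> stopped at
  the deterministic grid points, with coefficients that are constants on each path. Its quadratic
  variation is thus a finite combination of cross variations of \<open>W\<close>, and the randomness
  of the levels does no harm.\<close>

lemma quad_var_elementary_integral_AE: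
  assumes E: "elementary_process M Fl E" and v: "0 \<le> v"
  shows "AE \<omega> in M. (\<lambda>m. quad_var (\<lambda>t. elementary_integral W E t \<omega>) m v)
    \<longlonglongrightarrow> (LINT s:{0..v}|lborel. (elementary_value E s \<omega>)\<^sup>2)"
proof -
  \<comment> \<open>Indices past the last stage repeat the last grid point, so that \<open>r\<close>
    is nonnegative and monotone on all of \<open>nat\<close>.\<close>
  define r where "r j = min (grid E (min j (stages E))) v" for j
  have r: "0 \<le> r j" for j using elementary_grid_nonneg[OF E, of "min j (stages E)"] v by (simp add: r_def)
  have "AE \<omega> in M. \<forall>i j. (\<lambda>m. \<Sum>k<4 ^ m. increment (\<lambda>t. W t \<omega>) m (r i) k * increment (\<lambda>t. W t \<omega>) m (r j) k)
      \<longlonglongrightarrow> min (r i) (r j)"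
    unfolding AE_all_countable by (intro allI cross_variation_W_AE r)
  then show ?thesis
  proof eventually_elim
    case (elim \<omega>)
    let ?n = "stages E" and ?x = "\<lambda>j. level E j \<omega>"
    let ?d = "\<lambda>m i k. increment (\<lambda>t. W t \<omega>) m (r i) k"
    let ?C = "\<lambda>m i j. \<Sum>k<4 ^ m. ?d m i k * ?d m j k"
    have inc: "increment (\<lambda>t. elementary_integral W E t \<omega>) m v k = (\<Sum>j<?n. ?x j * (?d m (Suc j) k - ?d m j k))" for m k
    proof -
      have "min (grid E j) (min t v) = min t (min (grid E j) v)" for j t by (simp add: min.left_commute)
      then have "increment (\<lambda>t. elementary_integral W E t \<omega>) m v k
         = (\<Sum>j<?n. ?x j * (increment (\<lambda>t. W t \<omega>) m (min (grid E (Suc j)) v) k - increment (\<lambda>t. W t \<omega>) m (min (grid E j) v) k))"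
        unfolding increment_def elementary_integral_def sum_subtractf[symmetric]
        by (simp add: algebra_simps)
      also have "\<dots> = (\<Sum>j<?n. ?x j * (?d m (Suc j) k - ?d m j k))"
        by (intro sum.cong refl) (auto simp: r_def min_def)
      finally show ?thesis .
    qed
    have qv: "quad_var (\<lambda>t. elementary_integral W E t \<omega>) m v
      = (\<Sum>i<?n. \<Sum>j<?n. ?x i * ?x j * (?C m (Suc i) (Suc j) - ?C m (Suc i) j - ?C m i (Suc j) + ?C m i j))" for m
    proof -
      have "quad_var (\<lambda>t. elementary_integral W E t \<omega>) m v
        = (\<Sum>k<4 ^ m. \<Sum>i<?n. \<Sum>j<?n. (?x i * (?d m (Suc i) k - ?d m i k)) * (?x j * (?d m (Suc j) k - ?d m j k)))"
        unfolding quad_var_def inc power2_eq_square by (intro sum.cong refl sum_product)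
      also have "\<dots> = (\<Sum>i<?n. \<Sum>j<?n. \<Sum>k<4 ^ m. (?x i * (?d m (Suc i) k - ?d m i k)) * (?x j * (?d m (Suc j) k - ?d m j k)))"
        by (subst sum.swap, intro sum.cong refl sum.swap)
      also have "\<dots> = (\<Sum>i<?n. \<Sum>j<?n. ?x i * ?x j * (?C m (Suc i) (Suc j) - ?C m (Suc i) j - ?C m i (Suc j) + ?C m i j))"
        by (intro sum.cong refl)
           (simp add: sum_distrib_left algebra_simps flip: sum.distrib sum_subtractf)
      finally show ?thesis .
    qed
    have "(\<lambda>m. quad_var (\<lambda>t. elementary_integral W E t \<omega>) m v)
      \<longlonglongrightarrow> (\<Sum>i<?n. \<Sum>j<?n. ?x i * ?x j * (min (r (Suc i)) (r (Suc j)) - min (r (Suc i)) (r j) - min (r i) (r (Suc j)) + min (r i) (r j)))"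
      unfolding qv by (intro tendsto_sum tendsto_mult tendsto_const tendsto_add tendsto_diff) (use elim in blast)+
    \<comment> \<open>The mixed difference of minima is the length of the overlap of two grid cells:
      the whole length for \<open>i = j\<close> and 0 otherwise.\<close>
    also have "(\<Sum>i<?n. \<Sum>j<?n. ?x i * ?x j * (min (r (Suc i)) (r (Suc j)) - min (r (Suc i)) (r j) - min (r i) (r (Suc j)) + min (r i) (r j)))
      = (\<Sum>i<?n. \<Sum>j<?n. if i = j then (?x i)\<^sup>2 * (r (Suc i) - r i) else 0)"
    proof (intro sum.cong refl)
      fix i j assume ij: "i \<in> {..<?n}" "j \<in> {..<?n}"
      have mono: "r a \<le> r b" if "a \<le> b" for a b
        unfolding r_def using that by (intro min.mono elementary_grid_mono[OF E]) auto
      have le: "r i \<le> r (Suc i)" "r j \<le> r (Suc j)" by (auto intro: mono)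
      consider "i < j" | "i = j" | "j < i" by linarith
      then show "?x i * ?x j * (min (r (Suc i)) (r (Suc j)) - min (r (Suc i)) (r j) - min (r i) (r (Suc j)) + min (r i) (r j))
        = (if i = j then (?x i)\<^sup>2 * (r (Suc i) - r i) else 0)"
      proof cases
        case 1
        then have "r (Suc i) \<le> r j" by (intro mono) simp
        then show ?thesis using 1 le by (simp add: min_def)
      next
        case 2
        then show ?thesis using le by (simp add: min_def power2_eq_square)
      next
        case 3
        then have "r (Suc j) \<le> r i" by (intro mono) simp
        then show ?thesis using 3 le by (simp add: min_def)
      qed
    qed
    also have "\<dots> = (\<Sum>i<?n. (?x i)\<^sup>2 * (r (Suc i) - r i))" by (simp add: sum.delta')
    also have "\<dots> = (LINT s:{0..v}|lborel. (elementary_value E s \<omega>)\<^sup>2)"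
      unfolding elementary_value_square_integral[OF E v] by (intro sum.cong refl) (auto simp: r_def min_def)
    finally show ?case .
  qed
qed

text \<open>The limit in the mesh is known for each fixed \<open>E n\<close> only, while both must
  move together. The level \<open>m n\<close> is chosen after \<open>E n\<close>, and one choice has
  to serve all rational times.\<close>

lemma quad_var_diagonal:
  assumes E: "\<And>n. elementary_process M Fl (E n)"
  shows "\<exists>m. (\<forall>n. n \<le> m n) \<and> (AE \<omega> in M. \<forall>v\<in>\<rat>. 0 \<le> v \<longrightarrow>
    (\<lambda>n. quad_var (\<lambda>t. elementary_integral W (E n) t \<omega>) (m n) v
       - (LINT s:{0..v}|lborel. (elementary_value (E n) s \<omega>)\<^sup>2)) \<longlonglongrightarrow> 0)"
proof -
  define v where "v i = \<bar>of_rat (nat_to_rat_surj i) :: real\<bar>" for i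
  have v0: "0 \<le> v i" for i by (simp add: v_def)
  have v_surj: "\<exists>i. v i = q" if "q \<in> \<rat>" "0 \<le> q" for q
    using that surj_nat_to_rat_surj by (auto simp: v_def Rats_def surj_def) (metis abs_of_nonneg)
  define d where "d i n m \<omega> = quad_var (\<lambda>t. elementary_integral W (E n) t \<omega>) m (v i)
       - (LINT s:{0..v i}|lborel. (elementary_value (E n) s \<omega>)\<^sup>2)" for i n m \<omega>
  have [measurable]: "d i n m \<in> borel_measurable M" for i n m
  proof -
    have "elementary_integral W (E n) t \<in> borel_measurable M" if "0 \<le> t" for t
      by (rule measurable_Fl_M[OF elementary_integral_adapted[OF E that]])
    then have [measurable]: "elementary_integral W (E n) (min (dyadic m k) (v i)) \<in> borel_measurable M" for k
      using v0 by simp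
    have [measurable]: "level (E n) k \<in> borel_measurable M" if "k < stages (E n)" for k
      using E[of n] that by (intro measurable_Fl_M[of _ "grid (E n) k"]) (auto simp: elementary_process_def)
    show ?thesis
      unfolding d_def[abs_def] quad_var_def increment_def elementary_value_square_integral[OF E v0]
      by measurable
  qed
  have lim: "AE \<omega> in M. (\<lambda>m. d i n m \<omega>) \<longlonglongrightarrow> 0" for i n
    using quad_var_elementary_integral_AE[OF E[of n] v0[of i]] unfolding d_def
    by eventually_elim (rule LIM_zero)
  \<comment> \<open>Summing the errors over \<open>i \<le> n\<close> reduces countably many times to
    a single diagonal argument: a given time \<open>v i\<close> takes part as soon as
    \<open>n \<ge> i\<close>.\<close>
  have "\<exists>m. (\<forall>n. n \<le> m n) \<and> (AE \<omega> in M. (\<lambda>n. \<Sum>i\<le>n. \<bar>d i n (m n) \<omega>\<bar>) \<longlonglongrightarrow> 0)"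
  proof (rule AE_diagonal)
    fix n
    have "AE \<omega> in M. \<forall>i. (\<lambda>m. d i n m \<omega>) \<longlonglongrightarrow> 0" using lim by (simp add: AE_all_countable)
    then show "AE \<omega> in M. (\<lambda>m. \<Sum>i\<le>n. \<bar>d i n m \<omega>\<bar>) \<longlonglongrightarrow> 0"
    proof eventually_elim
      case (elim \<omega>)
      then show ?case by (intro tendsto_null_sum tendsto_rabs_zero) blast
    qed
  qed measurable
  then obtain m where m: "\<forall>n. n \<le> m n" "AE \<omega> in M. (\<lambda>n. \<Sum>i\<le>n. \<bar>d i n (m n) \<omega>\<bar>) \<longlonglongrightarrow> 0" by blast
  from m(2) have "AE \<omega> in M. \<forall>q\<in>\<rat>. 0 \<le> q \<longrightarrow>
    (\<lambda>n. quad_var (\<lambda>t. elementary_integral W (E n) t \<omega>) (m n) q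
       - (LINT s:{0..q}|lborel. (elementary_value (E n) s \<omega>)\<^sup>2)) \<longlonglongrightarrow> 0"
  proof eventually_elim
    case (elim \<omega>)
    show ?case
    proof (intro ballI impI)
      fix q :: real assume "q \<in> \<rat>" "0 \<le> q"
      then obtain i where i: "v i = q" using v_surj by blast
      have "(\<lambda>n. d i n (m n) \<omega>) \<longlonglongrightarrow> 0"
      proof (rule Lim_null_comparison[OF _ elim])
        show "eventually (\<lambda>n. norm (d i n (m n) \<omega>) \<le> (\<Sum>i\<le>n. \<bar>d i n (m n) \<omega>\<bar>)) sequentially"
          using eventually_ge_at_top[of i]
        proof eventually_elim
          case (elim n)
          then show ?case using member_le_sum[of i "{..n}" "\<lambda>i. \<bar>d i n (m n) \<omega>\<bar>"] by simp
        qed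
      qed
      then show "(\<lambda>n. quad_var (\<lambda>t. elementary_integral W (E n) t \<omega>) (m n) q
       - (LINT s:{0..q}|lborel. (elementary_value (E n) s \<omega>)\<^sup>2)) \<longlonglongrightarrow> 0"
        by (simp add: d_def i)
    qed
  qed
  with m(1) show ?thesis by blast
qed

section \<open>Uniqueness of the Ito integral\<close>

text \<open>Dropping each level that would push \<open>\<integral> E\<^sup>2\<close> above \<open>\<epsilon>\<close> keeps the process elementary, so that
  the isometry applies, and does not change it on the event considered.\<close>

lemma elementary_integral_tail:
  assumes E: "elementary_process M Fl E" and t: "0 \<le> t" and \<epsilon>: "0 < \<epsilon>" and \<eta>: "0 < \<eta>"
  shows "prob {\<omega>\<in>space M. \<eta> \<le> \<bar>elementary_integral W E t \<omega>\<bar> \<and>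
      (LINT s:{0..t}|lborel. (elementary_value E s \<omega>)\<^sup>2) \<le> \<epsilon>} \<le> \<epsilon> / \<eta>\<^sup>2"
    and "{\<omega>\<in>space M. \<eta> \<le> \<bar>elementary_integral W E t \<omega>\<bar> \<and>
      (LINT s:{0..t}|lborel. (elementary_value E s \<omega>)\<^sup>2) \<le> \<epsilon>} \<in> events"
proof -
  let ?n = "stages E"
  define u where "u k = min (grid E (min k ?n)) t" for k
  define A where "A k \<omega> = (\<Sum>j<k. (level E j \<omega>)\<^sup>2 * (u (Suc j) - u j))" for k \<omega>
  \<comment> \<open>\<open>A (Suc k)\<close> includes the contribution of cell \<open>k\<close>
    itself and yet is known at \<open>grid E k\<close>, because cell lengths are deterministic; so
    the decision to drop the level is adapted. The condition \<open>grid E k \<le> t\<close> ensures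
    \<open>u k = grid E k\<close>.\<close>
  define \<xi> where "\<xi> k \<omega> = (if k < ?n \<and> grid E k \<le> t \<and> A (Suc k) \<omega> \<le> \<epsilon> then level E k \<omega> else 0)" for k \<omega>
  let ?S = "\<lambda>\<omega>. \<Sum>k<?n. \<xi> k \<omega> * (W (u (Suc k)) \<omega> - W (u k) \<omega>)"
  have u0: "0 \<le> u k" for k using elementary_grid_nonneg[OF E, of "min k ?n"] t by (simp add: u_def)
  have umono: "u k \<le> u (Suc k)" for k
    unfolding u_def by (intro min.mono elementary_grid_mono[OF E]) auto
  have u_eq: "u k = min (grid E k) t" if "k \<le> ?n" for k using that by (simp add: u_def min_absorb1)
  have lev: "level E k \<in> borel_measurable (Fl (grid E k))" if "k < ?n" for k
    using E that by (auto simp: elementary_process_def)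
  have A_eq: "A ?n \<omega> = (LINT s:{0..t}|lborel. (elementary_value E s \<omega>)\<^sup>2)" for \<omega>
    unfolding elementary_value_square_integral[OF E t] A_def by (intro sum.cong refl) (simp add: u_eq)
  have A_meas: "A (Suc k) \<in> borel_measurable (Fl (grid E k))" if "k < ?n" for k
    unfolding A_def[abs_def]
  proof (rule borel_measurable_sum)
    fix j assume "j \<in> {..<Suc k}"
    then have "level E j \<in> borel_measurable (Fl (grid E k))"
      using that by (intro measurable_Fl_mono[OF lev elementary_grid_mono[OF E]]) auto
    then show "(\<lambda>\<omega>. (level E j \<omega>)\<^sup>2 * (u (Suc j) - u j)) \<in> borel_measurable (Fl (grid E k))" by simp
  qed
  have A_mono: "A j \<omega> \<le> A k \<omega>" if "j \<le> k" for j k \<omega>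
    unfolding A_def using that umono by (intro sum_mono2) auto
  have \<xi>_meas: "\<xi> k \<in> borel_measurable (Fl (u k))" for k
  proof (cases "k < ?n \<and> grid E k \<le> t")
    case True
    then have "u k = grid E k" by (simp add: u_eq)
    then show ?thesis unfolding \<xi>_def[abs_def] using lev[of k] A_meas[of k] True by simp
  next
    case False
    then have "\<xi> k = (\<lambda>\<omega>. 0)" by (auto simp: \<xi>_def)
    then show ?thesis by simp
  qed
  obtain C where C: "\<And>k \<omega>. k < ?n \<Longrightarrow> \<omega> \<in> space M \<Longrightarrow> \<bar>level E k \<omega>\<bar> \<le> C k"
    using E unfolding elementary_process_def by metis
  have \<xi>_bound: "\<bar>\<xi> k \<omega>\<bar> \<le> \<bar>C k\<bar>" if "\<omega> \<in> space M" for k \<omega>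
    using C[of k \<omega>] that by (auto simp: \<xi>_def)
  \<comment> \<open>The comparison with \<open>A n\<close> carries the induction: a level that is
    kept has \<open>A (Suc n) \<omega> \<le> \<epsilon>\<close>, and a level that is dropped leaves
    the sum unchanged.\<close>
  have sum_le: "(\<Sum>k<n. (\<xi> k \<omega>)\<^sup>2 * (u (Suc k) - u k)) \<le> \<epsilon> \<and> (\<Sum>k<n. (\<xi> k \<omega>)\<^sup>2 * (u (Suc k) - u k)) \<le> A n \<omega>" for n \<omega>
  proof (induction n)
    case 0
    show ?case using \<epsilon> by (simp add: A_def)
  next
    case (Suc n)
    have "0 \<le> (level E n \<omega>)\<^sup>2 * (u (Suc n) - u n)" using umono[of n] by simp
    then show ?case using Suc \<epsilon> by (auto simp: \<xi>_def A_def)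
  qed
  note S2 = expectation_stochastic_sum_square[where u=u and \<xi>=\<xi> and C="\<lambda>k. \<bar>C k\<bar>" and n="?n", OF u0 umono \<xi>_meas \<xi>_bound]
  have \<xi>2: "integrable M (\<lambda>\<omega>. (\<xi> k \<omega>)\<^sup>2)" for k
    using measurable_Fl_M[OF \<xi>_meas[of k]] \<xi>_bound[of _ k] abs_le_square_iff[of _ "C k"]
    by (intro integrable_const_bound[where B="(C k)\<^sup>2"] AE_I2) auto
  have "expectation (\<lambda>\<omega>. (?S \<omega>)\<^sup>2) = (\<Sum>k<?n. expectation (\<lambda>\<omega>. (\<xi> k \<omega>)\<^sup>2) * (u (Suc k) - u k))"
    by (rule S2(2))
  also have "\<dots> = expectation (\<lambda>\<omega>. \<Sum>k<?n. (\<xi> k \<omega>)\<^sup>2 * (u (Suc k) - u k))"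
    using \<xi>2 by simp
  also have "\<dots> \<le> expectation (\<lambda>\<omega>. \<epsilon>)"
    using \<xi>2 sum_le by (intro integral_mono) auto
  finally have ES: "expectation (\<lambda>\<omega>. (?S \<omega>)\<^sup>2) \<le> \<epsilon>" by (simp add: prob_space)
  let ?B = "{\<omega>\<in>space M. \<eta> \<le> \<bar>elementary_integral W E t \<omega>\<bar> \<and>
      (LINT s:{0..t}|lborel. (elementary_value E s \<omega>)\<^sup>2) \<le> \<epsilon>}"
  have sub: "?B \<subseteq> {\<omega>\<in>space M. \<eta>\<^sup>2 \<le> (?S \<omega>)\<^sup>2}"
  proof safe
    fix \<omega> assume "\<eta> \<le> \<bar>elementary_integral W E t \<omega>\<bar>" and le: "(LINT s:{0..t}|lborel. (elementary_value E s \<omega>)\<^sup>2) \<le> \<epsilon>"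
    moreover have "?S \<omega> = elementary_integral W E t \<omega>"
      unfolding elementary_integral_def
    proof (intro sum.cong refl)
      fix k assume k: "k \<in> {..<?n}"
      then have "A (Suc k) \<omega> \<le> \<epsilon>" using A_mono[of "Suc k" ?n \<omega>] le A_eq[of \<omega>] by simp
      moreover have "grid E k \<le> grid E (Suc k)" using elementary_grid_mono[OF E, of k "Suc k"] k by simp
      ultimately show "\<xi> k \<omega> * (W (u (Suc k)) \<omega> - W (u k) \<omega>)
        = level E k \<omega> * (W (min (grid E (Suc k)) t) \<omega> - W (min (grid E k) t) \<omega>)"
        using k by (auto simp: \<xi>_def u_eq min_def)
    qed
    ultimately show "\<eta>\<^sup>2 \<le> (?S \<omega>)\<^sup>2" using \<eta> abs_le_square_iff[of \<eta> "?S \<omega>"] by simp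
  qed
  show meas: "?B \<in> events"
  proof -
    have [measurable]: "elementary_integral W E t \<in> borel_measurable M"
      by (rule measurable_Fl_M[OF elementary_integral_adapted[OF E t]])
    have [measurable]: "level E k \<in> borel_measurable M" if "k < ?n" for k
      by (rule measurable_Fl_M[OF lev[OF that]])
    show ?thesis unfolding elementary_value_square_integral[OF E t] by measurable
  qed
  have "prob {\<omega>\<in>space M. \<eta>\<^sup>2 \<le> (?S \<omega>)\<^sup>2} \<le> expectation (\<lambda>\<omega>. (?S \<omega>)\<^sup>2) / \<eta>\<^sup>2"
    using \<eta> S2(1) by (intro integral_Markov_inequality_measure[where A="space M"]) auto
  also have "\<dots> \<le> \<epsilon> / \<eta>\<^sup>2" using ES by (intro divide_right_mono) auto
  finally have "prob {\<omega>\<in>space M. \<eta>\<^sup>2 \<le> (?S \<omega>)\<^sup>2} \<le> \<epsilon> / \<eta>\<^sup>2" .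
  moreover have "prob ?B \<le> prob {\<omega>\<in>space M. \<eta>\<^sup>2 \<le> (?S \<omega>)\<^sup>2}"
  proof (rule finite_measure_mono[OF sub])
    have "(\<lambda>\<omega>. (?S \<omega>)\<^sup>2) \<in> borel_measurable M" using S2(1) by (rule borel_measurable_integrable)
    then show "{\<omega>\<in>space M. \<eta>\<^sup>2 \<le> (?S \<omega>)\<^sup>2} \<in> events" by measurable
  qed
  ultimately show "prob ?B \<le> \<epsilon> / \<eta>\<^sup>2" by linarith
qed

text \<open>If the limit is not 0, then for some \<open>j\<close> and every \<open>p\<close> the
  path eventually stays in the events \<open>C j p n\<close>, whose probability is at most
  \<open>(j + 1)\<^sup>2 / (p + 1)\<close> uniformly in \<open>n\<close>. Letting \<open>p\<close>
  grow leaves a null set. The value \<open>I\<close> is quantified inside, so this null set depends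
  only on \<open>E\<close> and \<open>t\<close>.\<close>

lemma ito_integral_zero_at:
  assumes E: "\<And>n. elementary_process M Fl (E n)" and t: "0 \<le> t"
  shows "AE \<omega> in M. \<forall>I. (\<lambda>n. LINT s:{0..t}|lborel. (elementary_value (E n) s \<omega>)\<^sup>2) \<longlonglongrightarrow> 0 \<longrightarrow>
      (\<lambda>n. elementary_integral W (E n) t \<omega>) \<longlonglongrightarrow> I \<longrightarrow> I = 0"
proof -
  define C where "C j p n = {\<omega>\<in>space M. 1 / real (Suc j) \<le> \<bar>elementary_integral W (E n) t \<omega>\<bar> \<and>
      (LINT s:{0..t}|lborel. (elementary_value (E n) s \<omega>)\<^sup>2) \<le> 1 / real (Suc p)}" for j p n
  \<comment> \<open>The limit inferior of the events in \<open>n\<close>. It is an increasing union,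
    so the uniform bound on the probabilities passes to it.\<close>
  define N where "N j p = (\<Union>n. \<Inter>k\<in>{n..}. C j p k)" for j p
  have C: "C j p n \<in> events" "prob (C j p n) \<le> (real (Suc j))\<^sup>2 * (1 / real (Suc p))" for j p n
    using elementary_integral_tail[OF E t, of "1 / real (Suc p)" "1 / real (Suc j)" n]
    by (simp_all add: C_def power_divide mult.commute)
  have N: "N j p \<in> events" for j p unfolding N_def using C(1) by (intro sets.countable_UN sets.countable_INT) auto
  have Np: "prob (N j p) \<le> (real (Suc j))\<^sup>2 * (1 / real (Suc p))" for j p
  proof (rule LIMSEQ_le_const2)
    show "(\<lambda>n. prob (\<Inter>k\<in>{n..}. C j p k)) \<longlonglongrightarrow> prob (N j p)"
      unfolding N_def using C(1)
      by (intro finite_Lim_measure_incseq) (auto simp: incseq_def intro!: sets.countable_INT)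
    show "\<exists>n0. \<forall>n\<ge>n0. prob (\<Inter>k\<in>{n..}. C j p k) \<le> (real (Suc j))\<^sup>2 * (1 / real (Suc p))"
    proof (intro exI allI impI)
      fix n
      have "prob (\<Inter>k\<in>{n..}. C j p k) \<le> prob (C j p n)" using C(1) by (intro finite_measure_mono) auto
      also note C(2)
      finally show "prob (\<Inter>k\<in>{n..}. C j p k) \<le> (real (Suc j))\<^sup>2 * (1 / real (Suc p))" .
    qed
  qed
  have "(\<Inter>p. N j p) \<in> null_sets M" for j
  proof -
    have "prob (\<Inter>p. N j p) \<le> 0"
    proof (rule LIMSEQ_le_const)
      have "(\<lambda>p. (real (Suc j))\<^sup>2 * inverse (real (Suc p))) \<longlonglongrightarrow> (real (Suc j))\<^sup>2 * 0"
        by (intro tendsto_intros LIMSEQ_inverse_real_of_nat)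
      then show "(\<lambda>p. (real (Suc j))\<^sup>2 * (1 / real (Suc p))) \<longlonglongrightarrow> 0" by (simp add: inverse_eq_divide)
      show "\<exists>p0. \<forall>p\<ge>p0. prob (\<Inter>p. N j p) \<le> (real (Suc j))\<^sup>2 * (1 / real (Suc p))"
      proof (intro exI allI impI)
        fix p
        have "prob (\<Inter>p. N j p) \<le> prob (N j p)" using N by (intro finite_measure_mono) auto
        also note Np
        finally show "prob (\<Inter>p. N j p) \<le> (real (Suc j))\<^sup>2 * (1 / real (Suc p))" .
      qed
    qed
    then have "prob (\<Inter>p. N j p) = 0" by (simp add: measure_le_0_iff)
    then show ?thesis using N by (intro null_setsI) (auto simp: emeasure_eq_measure)
  qed
  then have "AE \<omega> in M. \<forall>j. \<omega> \<notin> (\<Inter>p. N j p)" unfolding AE_all_countable by (blast intro: AE_not_in)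
  then show ?thesis using AE_space
  proof eventually_elim
    case (elim \<omega>)
    show ?case
    proof (intro allI impI, rule ccontr)
      fix I assume lim0: "(\<lambda>n. LINT s:{0..t}|lborel. (elementary_value (E n) s \<omega>)\<^sup>2) \<longlonglongrightarrow> 0"
        and limI: "(\<lambda>n. elementary_integral W (E n) t \<omega>) \<longlonglongrightarrow> I" and "I \<noteq> 0"
      obtain j where j: "1 / real (Suc j) < \<bar>I\<bar>" using \<open>I \<noteq> 0\<close> nat_approx_posE[of "\<bar>I\<bar>"] by auto
      have "\<omega> \<in> N j p" for p
      proof -
        have "eventually (\<lambda>n. 1 / real (Suc j) < \<bar>elementary_integral W (E n) t \<omega>\<bar>) sequentially"
          using tendsto_rabs[OF limI] j by (rule order_tendstoD)
        moreover have "eventually (\<lambda>n. (LINT s:{0..t}|lborel. (elementary_value (E n) s \<omega>)\<^sup>2) < 1 / real (Suc p)) sequentially"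
          using lim0 by (rule order_tendstoD) simp
        ultimately have "eventually (\<lambda>n. \<omega> \<in> C j p n) sequentially"
          by eventually_elim (use elim(2) in \<open>simp add: C_def\<close>)
        then show ?thesis by (auto simp: N_def eventually_sequentially)
      qed
      with elim(1) show False by blast
    qed
  qed
qed

text \<open>Countably many null sets settle all rational times, each used on those paths that are
  still before \<tau>; continuity of the integral, a uniform limit of continuous paths, does the
  rest.\<close>

lemma ito_integral_zero:
  assumes I: "ito_integral M Fl W \<tau> H I"
    and H: "AE \<omega> in M. \<forall>t\<ge>0. ennreal t < \<tau> \<omega> \<longrightarrow> H t \<omega> = 0"
  shows "AE \<omega> in M. \<forall>t\<ge>0. ennreal t < \<tau> \<omega> \<longrightarrow> I t \<omega> = 0"
proof -
  obtain E where E: "\<And>n. elementary_process M Fl (E n)"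
    and ae: "AE \<omega> in M. \<forall>t\<ge>0. ennreal t < \<tau> \<omega> \<longrightarrow>
           ito_approximation W E H I t \<omega>"
    using I unfolding ito_integral_def by blast
  have "AE \<omega> in M. \<forall>q\<in>\<rat> \<inter> {0..}. \<forall>J. (\<lambda>n. LINT s:{0..q}|lborel. (elementary_value (E n) s \<omega>)\<^sup>2) \<longlonglongrightarrow> 0 \<longrightarrow>
      (\<lambda>n. elementary_integral W (E n) q \<omega>) \<longlonglongrightarrow> J \<longrightarrow> J = 0"
  proof (rule AE_ball_countable[THEN iffD2])
    show "countable (\<rat> \<inter> {0::real..})" using countable_rat by blast
  qed (intro ballI ito_integral_zero_at[OF E], simp)
  with ae H W_continuous show ?thesis
  proof eventually_elim
    case (elim \<omega>)
    have rat: "I q \<omega> = 0" if q: "q \<in> \<rat>" "0 \<le> q" "ennreal q < \<tau> \<omega>" for q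
    proof -
      have H0: "H s \<omega> = 0" if "s \<in> {0..q}" for s
        using elim(2) that q(3) by (metis atLeastAtMost_iff ennreal_leI order_le_less_trans)
      have "(LINT s:{0..q}|lborel. (elementary_value (E n) s \<omega> - H s \<omega>)\<^sup>2)
          = (LINT s:{0..q}|lborel. (elementary_value (E n) s \<omega>)\<^sup>2)" for n
        by (rule set_lebesgue_integral_cong) (auto simp: H0)
      moreover have "(\<lambda>n. LINT s:{0..q}|lborel. (elementary_value (E n) s \<omega> - H s \<omega>)\<^sup>2) \<longlonglongrightarrow> 0"
        using elim(1) q by blast
      ultimately have "(\<lambda>n. LINT s:{0..q}|lborel. (elementary_value (E n) s \<omega>)\<^sup>2) \<longlonglongrightarrow> 0"
        by simp
      moreover have "(\<lambda>n. elementary_integral W (E n) q \<omega>) \<longlonglongrightarrow> I q \<omega>"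
        using elim(1) q by (intro tendsto_uniform_limitI[where S="{0..q}"]) auto
      ultimately show ?thesis using elim(4) q by auto
    qed
    show ?case
    proof (intro allI impI, rule ccontr)
      fix t :: real assume t: "0 \<le> t" "ennreal t < \<tau> \<omega>" and nz: "I t \<omega> \<noteq> 0"
      have "t \<noteq> 0" using rat[of 0] t nz by auto
      have "continuous_on {0..t} (\<lambda>u. I u \<omega>)"
      proof (rule uniform_limit_theorem)
        show "uniform_limit {0..t} (\<lambda>n u. elementary_integral W (E n) u \<omega>) (\<lambda>u. I u \<omega>) sequentially"
          using elim(1) t by blast
        show "eventually (\<lambda>n. continuous_on {0..t} (\<lambda>u. elementary_integral W (E n) u \<omega>)) sequentially"
          by (intro always_eventually allI continuous_on_subset[OF elementary_integral_continuous[OF E elim(3)]]) auto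
      qed simp
      then obtain d where d: "d > 0" "\<And>u. u \<in> {0..t} \<Longrightarrow> dist u t < d \<Longrightarrow> dist (I u \<omega>) (I t \<omega>) < \<bar>I t \<omega>\<bar>"
        unfolding continuous_on_iff using nz t(1) by (metis atLeastAtMost_iff order_refl zero_less_abs_iff)
      \<comment> \<open>The rational time is taken to the left of \<open>t\<close>, so that it is
        still before \<tau>.\<close>
      obtain q where q: "q \<in> \<rat>" "max 0 (t - d) < q" "q < t"
        using Rats_dense_in_real[of "max 0 (t - d)" t] t \<open>t \<noteq> 0\<close> d(1) by auto
      have "dist (I q \<omega>) (I t \<omega>) < \<bar>I t \<omega>\<bar>" using q by (intro d(2)) (auto simp: dist_real_def)
      moreover have "ennreal q < \<tau> \<omega>" using q(3) t(2) by (metis ennreal_leI less_imp_le order_le_less_trans)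
      then have "I q \<omega> = 0" using q by (intro rat) auto
      ultimately show False by (simp add: dist_real_def)
    qed
  qed
qed

end

section \<open>The Ito formula for the square\<close>

text \<open>The uniform convergence of quadratic variations is available on intervals with rational
  end point, so \<open>t\<close> is enlarged to such a point without reaching the stopping
  time.\<close>

lemma rational_between_stopping:
  assumes "0 \<le> t" "ennreal t < \<tau>"
  obtains T where "T \<in> \<rat>" "t \<le> T" "ennreal T < \<tau>"
proof -
  obtain x where x: "ennreal t < x" "x < \<tau>" using dense[OF assms(2)] by blast
  then have "x < top" by (metis order_less_trans top_greatest order_le_less)
  then obtain r where r: "x = ennreal r" "0 \<le> r" by (cases x) auto
  have "t < r" using x(1) assms(1) r by (simp add: ennreal_less_iff)
  then obtain T where T: "T \<in> \<rat>" "t < T" "T < r" using Rats_dense_in_real by blast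
  have "ennreal T \<le> x" unfolding r(1) using T(3) by (intro ennreal_leI) simp
  then show ?thesis using that[of T] T x(2) by auto
qed

lemma before_stopping_mono: "ennreal t < \<tau> \<Longrightarrow> s \<le> t \<Longrightarrow> ennreal s < \<tau>"
  by (metis ennreal_leI order_le_less_trans)

lemma before_stopping_subset: "ennreal T < \<tau> \<Longrightarrow> {0..T} \<subseteq> {t. 0 \<le> t \<and> ennreal t < \<tau>}"
  by (auto intro: before_stopping_mono)

lemma LINT_eq_integral:
  fixes f :: "real \<Rightarrow> real"
  assumes "continuous_on {a..b} f"
  shows "(LINT s:{a..b}|lborel. f s) = integral {a..b} f"
  by (rule set_borel_integral_eq_integral(2)[OF borel_integrable_atLeastAtMost'[OF assms]])

text \<open>With \<open>x = E n s - \<sigma> s\<close> the squares differ by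
  \<open>x\<^sup>2 + 2 * x * \<sigma> s\<close>, and the weighted inequality \<open>2 * \<bar>x *
  \<sigma> s\<bar> \<le> x\<^sup>2 / c + c * (\<sigma> s)\<^sup>2\<close> isolates the mean square
  error.\<close>

lemma square_integral_tendsto:
  fixes \<sigma> :: "real \<Rightarrow> real" and E :: "nat \<Rightarrow> real \<Rightarrow> real"
  assumes v: "0 \<le> v" and \<sigma>: "continuous_on {0..v} \<sigma>"
    and E: "\<And>n. E n \<in> borel_measurable borel" "\<And>n s. \<bar>E n s\<bar> \<le> C n"
    and lim: "(\<lambda>n. LINT s:{0..v}|lborel. (E n s - \<sigma> s)\<^sup>2) \<longlonglongrightarrow> 0"
  shows "(\<lambda>n. LINT s:{0..v}|lborel. (E n s)\<^sup>2) \<longlonglongrightarrow> (LINT s:{0..v}|lborel. (\<sigma> s)\<^sup>2)"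
proof -
  have "bounded (\<sigma> ` {0..v})" using \<sigma> by (intro compact_imp_bounded compact_continuous_image) auto
  then obtain S where "\<forall>x\<in>\<sigma> ` {0..v}. norm x \<le> S" unfolding bounded_iff by blast
  then have S: "\<And>s. s \<in> {0..v} \<Longrightarrow> \<bar>\<sigma> s\<bar> \<le> S" by simp
  have iE: "set_integrable lborel {0..v} (\<lambda>s. (E n s)\<^sup>2)" for n
    using set_integrable_bounded_minus_continuous_square[OF E(1)[of n] E(2)[of n], of 0 v "\<lambda>_. 0"] by simp
  have id: "set_integrable lborel {0..v} (\<lambda>s. (E n s - \<sigma> s)\<^sup>2)" for n
    by (rule set_integrable_bounded_minus_continuous_square[OF E(1)[of n] E(2)[of n] \<sigma>])
  have i\<sigma>: "set_integrable lborel {0..v} (\<lambda>s. (\<sigma> s)\<^sup>2)"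
    using \<sigma> by (intro borel_integrable_atLeastAtMost' continuous_intros)
  have bound: "\<bar>(LINT s:{0..v}|lborel. (E n s)\<^sup>2) - (LINT s:{0..v}|lborel. (\<sigma> s)\<^sup>2)\<bar>
      \<le> (1 + 1 / c) * (LINT s:{0..v}|lborel. (E n s - \<sigma> s)\<^sup>2) + c * S\<^sup>2 * v" if c: "0 < c" for c n
  proof -
    have pt: "\<bar>(E n s)\<^sup>2 - (\<sigma> s)\<^sup>2\<bar> \<le> (1 + 1 / c) * (E n s - \<sigma> s)\<^sup>2 + c * S\<^sup>2" if s: "s \<in> {0..v}" for s
    proof -
      define x where "x = E n s - \<sigma> s"
      have "0 \<le> (\<bar>x\<bar> - c * \<bar>\<sigma> s\<bar>)\<^sup>2" by simp
      then have "c * (2 * \<bar>x * \<sigma> s\<bar>) \<le> x\<^sup>2 + c * (c * (\<sigma> s)\<^sup>2)"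
        by (simp add: power2_diff power_mult_distrib abs_mult) (simp add: power2_eq_square mult_ac)
      also have "\<dots> = c * (x\<^sup>2 / c + c * (\<sigma> s)\<^sup>2)" using c by (simp add: distrib_left)
      finally have "2 * \<bar>x * \<sigma> s\<bar> \<le> x\<^sup>2 / c + c * (\<sigma> s)\<^sup>2" using c by (simp only: mult_le_cancel_left_pos)
      moreover have "c * (\<sigma> s)\<^sup>2 \<le> c * S\<^sup>2"
        using S[OF s] c abs_le_square_iff[of "\<sigma> s" S] by (intro mult_left_mono) auto
      moreover have "(E n s)\<^sup>2 - (\<sigma> s)\<^sup>2 = x\<^sup>2 + 2 * (x * \<sigma> s)"
        by (simp add: x_def power2_eq_square algebra_simps)
      then have "\<bar>(E n s)\<^sup>2 - (\<sigma> s)\<^sup>2\<bar> \<le> x\<^sup>2 + 2 * \<bar>x * \<sigma> s\<bar>"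
        using abs_triangle_ineq[of "x\<^sup>2" "2 * (x * \<sigma> s)"] by simp
      ultimately show ?thesis by (simp add: x_def[symmetric] distrib_right)
    qed
    have ic: "set_integrable lborel {0..v} (\<lambda>s. (1 + 1 / c) * (E n s - \<sigma> s)\<^sup>2)"
      "set_integrable lborel {0..v} (\<lambda>s. c * S\<^sup>2)"
      using id[of n] by (intro set_integrable_mult_right, simp)
        (rule borel_integrable_atLeastAtMost', rule continuous_on_const)
    have "\<bar>(LINT s:{0..v}|lborel. (E n s)\<^sup>2) - (LINT s:{0..v}|lborel. (\<sigma> s)\<^sup>2)\<bar>
       = \<bar>LINT s|lborel. indicator {0..v} s *\<^sub>R ((E n s)\<^sup>2 - (\<sigma> s)\<^sup>2)\<bar>"
      using set_integral_diff(2)[OF iE[of n] i\<sigma>] by (simp add: set_lebesgue_integral_def)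
    also have "\<dots> \<le> (LINT s|lborel. \<bar>indicator {0..v} s *\<^sub>R ((E n s)\<^sup>2 - (\<sigma> s)\<^sup>2)\<bar>)"
      by (rule integral_abs_bound)
    also have "\<dots> \<le> (LINT s|lborel. indicator {0..v} s *\<^sub>R ((1 + 1 / c) * (E n s - \<sigma> s)\<^sup>2 + c * S\<^sup>2))"
    proof (rule integral_mono)
      show "integrable lborel (\<lambda>s. \<bar>indicator {0..v} s *\<^sub>R ((E n s)\<^sup>2 - (\<sigma> s)\<^sup>2)\<bar>)"
        using set_integral_diff(1)[OF iE[of n] i\<sigma>] by (intro integrable_abs) (simp add: set_integrable_def)
      show "integrable lborel (\<lambda>s. indicator {0..v} s *\<^sub>R ((1 + 1 / c) * (E n s - \<sigma> s)\<^sup>2 + c * S\<^sup>2))"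
        using set_integral_add(1)[OF ic] by (simp add: set_integrable_def)
      show "\<bar>indicator {0..v} s *\<^sub>R ((E n s)\<^sup>2 - (\<sigma> s)\<^sup>2)\<bar> \<le> indicator {0..v} s *\<^sub>R ((1 + 1 / c) * (E n s - \<sigma> s)\<^sup>2 + c * S\<^sup>2)" for s
        using pt[of s] by (simp add: indicator_def)
    qed
    also have "\<dots> = (1 + 1 / c) * (LINT s:{0..v}|lborel. (E n s - \<sigma> s)\<^sup>2) + c * S\<^sup>2 * v"
      using set_integral_add(2)[OF ic] v by (simp add: set_lebesgue_integral_def)
    finally show ?thesis .
  qed
  show ?thesis
  proof (rule tendstoI)
    fix r :: real assume r: "r > 0"
    define A where "A = S\<^sup>2 * v + 1"
    have A: "A > 0" using v by (simp add: A_def add_nonneg_pos)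
    \<comment> \<open>The weight is fixed first and bounds the \<sigma> term by
      \<open>r / 2\<close>; only then is \<open>n\<close> taken large, against the factor
      \<open>1 + 1 / c\<close>.\<close>
    define c where "c = r / (2 * A)"
    have c: "0 < c" using r A by (simp add: c_def)
    have "c * (S\<^sup>2 * v) \<le> c * A" using c by (simp add: A_def)
    also have "\<dots> = r / 2" using A by (simp add: c_def)
    finally have small: "c * S\<^sup>2 * v \<le> r / 2" by (simp add: mult.assoc)
    have "(\<lambda>n. (1 + 1 / c) * (LINT s:{0..v}|lborel. (E n s - \<sigma> s)\<^sup>2)) \<longlonglongrightarrow> (1 + 1 / c) * 0"
      by (intro tendsto_intros lim)
    then have "eventually (\<lambda>n. (1 + 1 / c) * (LINT s:{0..v}|lborel. (E n s - \<sigma> s)\<^sup>2) < r / 2) sequentially"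
      using r by (intro order_tendstoD(2)) auto
    then show "eventually (\<lambda>n. dist (LINT s:{0..v}|lborel. (E n s)\<^sup>2) (LINT s:{0..v}|lborel. (\<sigma> s)\<^sup>2) < r) sequentially"
    proof eventually_elim
      case (elim n)
      then show ?case using bound[OF c, of n] small unfolding dist_real_def by linarith
    qed
  qed
qed

context real_brownian
begin

text \<open>The approximating processes are \<open>2 X\<^sub>n 1_{(t\<^sub>k, t\<^sub>k\<^sub>+\<^sub>1]} E\<^sub>n\<close>, where \<open>X\<^sub>n = X - I + E\<^sub>n\<cdot>W\<close> has the
  martingale part of \<open>X\<close> replaced by its approximation. As the filtration is not complete, \<open>I\<close> enters
  \<open>X\<^sub>n\<close> through the adapted limit of \<open>E\<^sub>n\<cdot>W\<close>. Clamping makes the levels bounded and is pathwise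
  eventually without effect.\<close>

lemma ito_integral_square:
  assumes adapted: "\<And>t. 0 \<le> t \<Longrightarrow> (\<lambda>\<omega>. if ennreal t < \<tau> \<omega> then X t \<omega> else 0) \<in> borel_measurable (Fl t)"
    and cont: "AE \<omega> in M. continuous_on (lifetime \<tau> \<omega>) (\<lambda>t. X t \<omega>) \<and>
       continuous_on (lifetime \<tau> \<omega>) (\<lambda>t. \<beta> t \<omega>) \<and>
       continuous_on (lifetime \<tau> \<omega>) (\<lambda>t. \<sigma> t \<omega>)"
    and I: "ito_integral M Fl W \<tau> \<sigma> I"
    and X: "AE \<omega> in M. \<forall>t\<ge>0. ennreal t < \<tau> \<omega> \<longrightarrow> X t \<omega> = X 0 \<omega> + (LINT s:{0..t}|lborel. \<beta> s \<omega>) + I t \<omega>"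
  shows "ito_integral M Fl W \<tau> (\<lambda>t \<omega>. 2 * X t \<omega> * \<sigma> t \<omega>)
    (\<lambda>t \<omega>. (X t \<omega>)\<^sup>2 - (X 0 \<omega>)\<^sup>2 - (LINT s:{0..t}|lborel. 2 * X s \<omega> * \<beta> s \<omega> + (\<sigma> s \<omega>)\<^sup>2))"
proof -
  have filt: "filtered_prob_space M Fl" by unfold_locales
  obtain E where E: "\<And>n. elementary_process M Fl (E n)"
    and ae: "AE \<omega> in M. \<forall>t\<ge>0. ennreal t < \<tau> \<omega> \<longrightarrow>
           ito_approximation W E \<sigma> I t \<omega>"
    using I unfolding ito_integral_def by blast
  obtain m where m: "\<And>n. n \<le> m n" and qv: "AE \<omega> in M. \<forall>v\<in>\<rat>. 0 \<le> v \<longrightarrow>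
    (\<lambda>n. quad_var (\<lambda>t. elementary_integral W (E n) t \<omega>) (m n) v
       - (LINT s:{0..v}|lborel. (elementary_value (E n) s \<omega>)\<^sup>2)) \<longlonglongrightarrow> 0"
    using quad_var_diagonal[of E, OF E] by blast
  have m_top: "filterlim m at_top sequentially"
    using m by (intro filterlim_at_top_mono[OF filterlim_ident]) auto
  \<comment> \<open>\<open>lim\<close> has a value on every path, convergent or not, so
    \<open>x\<close> is measurable for the filtration without removing a null set.\<close>
  define x where "x n k \<omega> = 2 * ((if ennreal (dyadic (m n) k) < \<tau> \<omega> then X (dyadic (m n) k) \<omega> else 0)
     - lim (\<lambda>n'. elementary_integral W (E n') (dyadic (m n) k) \<omega>) + elementary_integral W (E n) (dyadic (m n) k) \<omega>)" for n k \<omega>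
  define G where "G n k \<omega> = max (- real n) (min (real n) (x n k \<omega>))" for n k \<omega>
  have G_meas: "G n k \<in> borel_measurable (Fl (dyadic (m n) k))" for n k
  proof -
    have [measurable]: "elementary_integral W (E j) (dyadic (m n) k) \<in> borel_measurable (Fl (dyadic (m n) k))" for j
      by (rule elementary_integral_adapted[OF E dyadic_nonneg])
    have [measurable]: "(\<lambda>\<omega>. if ennreal (dyadic (m n) k) < \<tau> \<omega> then X (dyadic (m n) k) \<omega> else 0) \<in> borel_measurable (Fl (dyadic (m n) k))"
      by (rule adapted[OF dyadic_nonneg])
    show ?thesis unfolding G_def[abs_def] x_def by measurable
  qed
  have "\<forall>n. \<exists>F. elementary_process M Fl F \<and>
    (\<forall>s \<omega>. elementary_value F s \<omega> = dyadic_step (\<lambda>k. G n k \<omega>) (m n) s * elementary_value (E n) s \<omega>) \<and>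
    (\<forall>W t \<omega>. elementary_integral W F t \<omega> = (\<Sum>k<4 ^ m n. G n k \<omega> * increment (\<lambda>x. elementary_integral W (E n) x \<omega>) (m n) t k))"
  proof
    fix n
    have "\<bar>G n k \<omega>\<bar> \<le> real n" for k \<omega> by (auto simp: G_def abs_le_iff)
    then show "\<exists>F. elementary_process M Fl F \<and>
      (\<forall>s \<omega>. elementary_value F s \<omega> = dyadic_step (\<lambda>k. G n k \<omega>) (m n) s * elementary_value (E n) s \<omega>) \<and>
      (\<forall>W t \<omega>. elementary_integral W F t \<omega> = (\<Sum>k<4 ^ m n. G n k \<omega> * increment (\<lambda>x. elementary_integral W (E n) x \<omega>) (m n) t k))"
      by (intro elementary_dyadic_step[OF filt E G_meas])
  qed
  then obtain F where F: "\<And>n. elementary_process M Fl (F n)"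
    and F_val: "\<And>n s \<omega>. elementary_value (F n) s \<omega> = dyadic_step (\<lambda>k. G n k \<omega>) (m n) s * elementary_value (E n) s \<omega>"
    and F_int: "\<And>n W t \<omega>. elementary_integral W (F n) t \<omega> = (\<Sum>k<4 ^ m n. G n k \<omega> * increment (\<lambda>x. elementary_integral W (E n) x \<omega>) (m n) t k)"
    by metis
  show ?thesis unfolding ito_integral_def
  proof (intro exI[of _ F] conjI allI F)
    show "AE \<omega> in M. \<forall>t\<ge>0. ennreal t < \<tau> \<omega> \<longrightarrow>
           ito_approximation W F (\<lambda>s \<omega>. 2 * X s \<omega> * \<sigma> s \<omega>) (\<lambda>t \<omega>. (X t \<omega>)\<^sup>2 - (X 0 \<omega>)\<^sup>2 - (LINT s:{0..t}|lborel. 2 * X s \<omega> * \<beta> s \<omega> + (\<sigma> s \<omega>)\<^sup>2)) t \<omega>"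
      using ae qv cont X AE_space
    proof eventually_elim
      case (elim \<omega>)
      show ?case
      proof (intro allI impI)
        fix t :: real assume t: "0 \<le> t" "ennreal t < \<tau> \<omega>"
        obtain T where T: "T \<in> \<rat>" "t \<le> T" "ennreal T < \<tau> \<omega>" using rational_between_stopping[OF t] .
        have T0: "0 \<le> T" using t T by simp
        define J where "J n u = elementary_integral W (E n) u \<omega>" for n u
        have lt: "ennreal u < \<tau> \<omega>" if "u \<le> T" for u using before_stopping_mono[OF T(3) that] .
        note sub = before_stopping_subset[OF T(3)]
        have Xc: "continuous_on {0..T} (\<lambda>t. X t \<omega>)" and \<beta>c: "continuous_on {0..T} (\<lambda>t. \<beta> t \<omega>)"
          and \<sigma>c: "continuous_on {0..T} (\<lambda>t. \<sigma> t \<omega>)"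
          using elim(3) continuous_on_subset[OF _ sub] by blast+
        have subc: "continuous_on {0..u} f" if "continuous_on {0..T} f" "u \<le> T" for f :: "real \<Rightarrow> real" and u
          using that(2) by (intro continuous_on_subset[OF that(1)]) auto
        have JI: "uniform_limit {0..T} J (\<lambda>u. I u \<omega>) sequentially"
          using elim(1) T0 T(3) unfolding J_def[abs_def] by blast
        have lim_I: "lim (\<lambda>n'. elementary_integral W (E n') u \<omega>) = I u \<omega>" if "u \<in> {0..T}" for u
          using tendsto_uniform_limitI[OF JI that] unfolding J_def by (rule limI)
        have L2: "(\<lambda>n. LINT s:{0..u}|lborel. (elementary_value (E n) s \<omega> - \<sigma> s \<omega>)\<^sup>2) \<longlonglongrightarrow> 0" if "0 \<le> u" "u \<le> T" for u
          using elim(1) that lt by blast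
        note Eb = elementary_value_bounded[OF E elim(5)]
        have U: "uniform_limit {0..T}
          (\<lambda>n u. \<Sum>k<4 ^ m n. 2 * (X (dyadic (m n) k) \<omega> - I (dyadic (m n) k) \<omega> + J n (dyadic (m n) k)) * increment (J n) (m n) u k)
          (\<lambda>u. (X u \<omega>)\<^sup>2 - (X 0 \<omega>)\<^sup>2 - integral {0..u} (\<lambda>s. 2 * X s \<omega> * \<beta> s \<omega> + (\<sigma> s \<omega>)\<^sup>2)) sequentially"
        proof (rule pathwise_ito_square[OF T0 T(1) Xc \<beta>c \<sigma>c _ JI m_top])
          fix u assume u: "u \<in> {0..T}"
          then have "X u \<omega> = X 0 \<omega> + (LINT s:{0..u}|lborel. \<beta> s \<omega>) + I u \<omega>" using elim(4) lt by auto
          also have "(LINT s:{0..u}|lborel. \<beta> s \<omega>) = integral {0..u} (\<lambda>s. \<beta> s \<omega>)"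
            using u by (intro LINT_eq_integral subc[OF \<beta>c]) auto
          finally show "X u \<omega> = X 0 \<omega> + integral {0..u} (\<lambda>s. \<beta> s \<omega>) + I u \<omega>" .
        next
          fix v assume v: "v \<in> \<rat>" "v \<in> {0..T}"
          have \<sigma>v: "continuous_on {0..v} (\<lambda>t. \<sigma> t \<omega>)" using v by (intro subc[OF \<sigma>c]) auto
          have "(\<lambda>n. quad_var (J n) (m n) v - (LINT s:{0..v}|lborel. (elementary_value (E n) s \<omega>)\<^sup>2)) \<longlonglongrightarrow> 0"
            using elim(2) v unfolding J_def[abs_def] by auto
          moreover have "(\<lambda>n. LINT s:{0..v}|lborel. (elementary_value (E n) s \<omega>)\<^sup>2) \<longlonglongrightarrow> (LINT s:{0..v}|lborel. (\<sigma> s \<omega>)\<^sup>2)"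
            using v by (intro square_integral_tendsto[OF _ \<sigma>v Eb] L2) auto
          ultimately have "(\<lambda>n. quad_var (J n) (m n) v) \<longlonglongrightarrow> (LINT s:{0..v}|lborel. (\<sigma> s \<omega>)\<^sup>2)"
            using tendsto_add by fastforce
          also have "(LINT s:{0..v}|lborel. (\<sigma> s \<omega>)\<^sup>2) = integral {0..v} (\<lambda>s. (\<sigma> s \<omega>)\<^sup>2)"
            using \<sigma>v by (intro LINT_eq_integral continuous_intros)
          finally show "(\<lambda>n. quad_var (J n) (m n) v) \<longlonglongrightarrow> integral {0..v} (\<lambda>s. (\<sigma> s \<omega>)\<^sup>2)" .
        qed
        have "bounded ((\<lambda>t. X t \<omega>) ` {0..T})"
          using Xc by (intro compact_imp_bounded compact_continuous_image) auto
        then obtain D where D: "\<forall>x\<in>(\<lambda>t. X t \<omega>) ` {0..T}. norm x \<le> D" unfolding bounded_iff by blast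
        \<comment> \<open>The clamp is inactive once \<open>n\<close> exceeds
          \<open>2 * D + 2\<close>: the path is bounded by \<open>D\<close>, the error of
          \<open>J n\<close> by 1, and the sum is doubled.\<close>
        have G_eq: "eventually (\<lambda>n. \<forall>k. dyadic (m n) k \<le> T \<longrightarrow>
           G n k \<omega> = 2 * (X (dyadic (m n) k) \<omega> - I (dyadic (m n) k) \<omega> + J n (dyadic (m n) k))) sequentially"
          using eventually_ge_at_top[of "nat \<lceil>2 * D + 2\<rceil>"] uniform_limitD[OF JI zero_less_one]
        proof eventually_elim
          case (elim n)
          show ?case
          proof (intro allI impI)
            fix k assume k: "dyadic (m n) k \<le> T"
            let ?s = "dyadic (m n) k"
            have s: "?s \<in> {0..T}" using k by simp
            have x: "x n k \<omega> = 2 * (X ?s \<omega> - I ?s \<omega> + J n ?s)"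
              using lt[OF k] lim_I[OF s] by (simp add: x_def J_def)
            have "\<bar>J n ?s - I ?s \<omega>\<bar> < 1" using elim(2) s by (auto simp: dist_real_def)
            moreover have "\<bar>X ?s \<omega>\<bar> \<le> D" using D s by auto
            moreover have "2 * D + 2 \<le> real n" using elim(1) by linarith
            moreover have "\<bar>x n k \<omega>\<bar> = 2 * \<bar>X ?s \<omega> + (J n ?s - I ?s \<omega>)\<bar>"
              unfolding x abs_mult abs_numeral by (intro arg_cong[where f="\<lambda>y. 2 * \<bar>y\<bar>"]) simp
            moreover note abs_triangle_ineq[of "X ?s \<omega>" "J n ?s - I ?s \<omega>"]
            ultimately have "\<bar>x n k \<omega>\<bar> \<le> real n" by argo
            then show "G n k \<omega> = 2 * (X ?s \<omega> - I ?s \<omega> + J n ?s)" by (auto simp: G_def x)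
          qed
        qed
        have "uniform_limit {0..T} (\<lambda>n u. elementary_integral W (F n) u \<omega>)
             (\<lambda>t. (X t \<omega>)\<^sup>2 - (X 0 \<omega>)\<^sup>2 - (LINT s:{0..t}|lborel. 2 * X s \<omega> * \<beta> s \<omega> + (\<sigma> s \<omega>)\<^sup>2)) sequentially"
        proof (rule uniform_limit_cong[THEN iffD1, OF _ _ U])
          show "eventually (\<lambda>n. \<forall>u\<in>{0..T}. (\<Sum>k<4 ^ m n. 2 * (X (dyadic (m n) k) \<omega> - I (dyadic (m n) k) \<omega>
               + J n (dyadic (m n) k)) * increment (J n) (m n) u k) = elementary_integral W (F n) u \<omega>) sequentially"
            using G_eq
          proof eventually_elim
            case (elim n)
            show ?case unfolding F_int
            proof (intro ballI sum.cong refl)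
              fix u k assume u: "u \<in> {0..T}"
              show "2 * (X (dyadic (m n) k) \<omega> - I (dyadic (m n) k) \<omega> + J n (dyadic (m n) k)) * increment (J n) (m n) u k
                = G n k \<omega> * increment (\<lambda>x. elementary_integral W (E n) x \<omega>) (m n) u k"
              \<comment> \<open>\<open>G_eq\<close> says nothing about grid points beyond
                \<open>T\<close>, but the cells starting there have increment 0.\<close>
              proof (cases "dyadic (m n) k \<le> T")
                case True
                then show ?thesis using elim by (simp add: J_def[abs_def])
              next
                case False
                then show ?thesis using u by (simp add: increment_eq_0)
              qed
            qed
          qed
          show "(X u \<omega>)\<^sup>2 - (X 0 \<omega>)\<^sup>2 - integral {0..u} (\<lambda>s. 2 * X s \<omega> * \<beta> s \<omega> + (\<sigma> s \<omega>)\<^sup>2) =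
              (X u \<omega>)\<^sup>2 - (X 0 \<omega>)\<^sup>2 - (LINT s:{0..u}|lborel. 2 * X s \<omega> * \<beta> s \<omega> + (\<sigma> s \<omega>)\<^sup>2)" if "u \<in> {0..T}" for u
            using that subc[OF Xc, of u] subc[OF \<beta>c, of u] subc[OF \<sigma>c, of u]
            by (subst LINT_eq_integral) (auto intro!: continuous_intros)
        qed
        then have 3: "uniform_limit {0..t} (\<lambda>n u. elementary_integral W (F n) u \<omega>)
             (\<lambda>t. (X t \<omega>)\<^sup>2 - (X 0 \<omega>)\<^sup>2 - (LINT s:{0..t}|lborel. 2 * X s \<omega> * \<beta> s \<omega> + (\<sigma> s \<omega>)\<^sup>2)) sequentially"
          by (rule uniform_limit_on_subset) (use T in auto)
        have X2: "continuous_on {0..T} (\<lambda>t. 2 * X t \<omega>)" using Xc by (intro continuous_intros)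
        have close: "eventually (\<lambda>n. \<forall>k s. dyadic (m n) k < s \<longrightarrow> s \<le> dyadic (m n) (Suc k) \<longrightarrow> s \<le> T
           \<longrightarrow> \<bar>G n k \<omega> - 2 * X s \<omega>\<bar> \<le> e) sequentially" if e: "0 < e" for e
        proof -
          \<comment> \<open>Two errors of \<open>e / 4\<close>, oscillation of the path and distance
            of \<open>J n\<close> from \<open>I\<close>, are doubled by the factor in
            \<open>G\<close>, which gives at most \<open>e\<close>.\<close>
          have e4: "0 < e / 4" using e by simp
          from G_eq eventually_osc_le[OF Xc uniform_limit_const m_top e4] uniform_limitD[OF JI e4]
          show ?thesis
          proof eventually_elim
            case (elim n)
            show ?case
            proof (intro allI impI)
              fix k s assume s: "dyadic (m n) k < s" "s \<le> dyadic (m n) (Suc k)" "s \<le> T"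
              let ?s = "dyadic (m n) k"
              have in0: "?s \<in> {0..T}" "s \<in> {0..T}" using s dyadic_nonneg[of "m n" k] by (auto simp del: dyadic_nonneg)
              have "\<bar>?s - s\<bar> \<le> 1 / 2 ^ m n" using s dyadic_Suc[of "m n" k] by linarith
              then have "\<bar>X ?s \<omega> - X s \<omega>\<bar> \<le> e / 4" using elim(2) in0 unfolding osc_le_def by blast
              moreover have "\<bar>J n ?s - I ?s \<omega>\<bar> < e / 4" using elim(3) in0 by (auto simp: dist_real_def)
              moreover have "G n k \<omega> = 2 * (X ?s \<omega> - I ?s \<omega> + J n ?s)" using elim(1) in0 by simp
              then have "\<bar>G n k \<omega> - 2 * X s \<omega>\<bar> = \<bar>2 * ((X ?s \<omega> - X s \<omega>) + (J n ?s - I ?s \<omega>))\<bar>"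
                by (intro arg_cong[where f=abs]) simp
              then have "\<bar>G n k \<omega> - 2 * X s \<omega>\<bar> = 2 * \<bar>(X ?s \<omega> - X s \<omega>) + (J n ?s - I ?s \<omega>)\<bar>"
                by (simp only: abs_mult abs_numeral)
              moreover note abs_triangle_ineq[of "X ?s \<omega> - X s \<omega>" "J n ?s - I ?s \<omega>"] e
              ultimately show "\<bar>G n k \<omega> - 2 * X s \<omega>\<bar> \<le> e" by argo
            qed
          qed
        qed
        have close': "eventually (\<lambda>n. \<forall>k s. dyadic (m n) k < s \<longrightarrow> s \<le> dyadic (m n) (Suc k) \<longrightarrow> s \<le> t
           \<longrightarrow> \<bar>G n k \<omega> - 2 * X s \<omega>\<bar> \<le> e) sequentially" if e: "0 < e" for e
          using close[OF e] by eventually_elim (use T(2) in \<open>meson order_trans\<close>)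
        note P = dyadic_step_product_L2[OF t(1) subc[OF X2 T(2)] subc[OF \<sigma>c T(2)] m_top Eb L2[OF t(1) T(2)] close']
        show "ito_approximation W F (\<lambda>s \<omega>. 2 * X s \<omega> * \<sigma> s \<omega>) (\<lambda>t \<omega>. (X t \<omega>)\<^sup>2 - (X 0 \<omega>)\<^sup>2 - (LINT s:{0..t}|lborel. 2 * X s \<omega> * \<beta> s \<omega> + (\<sigma> s \<omega>)\<^sup>2)) t \<omega>"
          unfolding F_val using P 3 by blast
      qed
    qed
  qed
qed

end

section \<open>Calculus of scalar Ito processes\<close>

lemma ito_integral_cong:
  assumes I: "ito_integral M Fl W \<tau> H I"
    and eq: "AE \<omega> in M. \<forall>t\<ge>0. ennreal t < \<tau> \<omega> \<longrightarrow> H t \<omega> = H' t \<omega> \<and> I t \<omega> = I' t \<omega>"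
  shows "ito_integral M Fl W \<tau> H' I'"
proof -
  obtain E where E: "\<forall>n. elementary_process M Fl (E n)"
    and ae: "AE \<omega> in M. \<forall>t\<ge>0. ennreal t < \<tau> \<omega> \<longrightarrow>
           ito_approximation W E H I t \<omega>"
    using I unfolding ito_integral_def by blast
  show ?thesis unfolding ito_integral_def
  proof (intro exI[of _ E] conjI E)
    from ae eq show "AE \<omega> in M. \<forall>t\<ge>0. ennreal t < \<tau> \<omega> \<longrightarrow>
           ito_approximation W E H' I' t \<omega>"
    proof eventually_elim
      case (elim \<omega>)
      show ?case
      proof (intro allI impI)
        fix t :: real assume t: "0 \<le> t" "ennreal t < \<tau> \<omega>"
        have eq: "H s \<omega> = H' s \<omega>" "I s \<omega> = I' s \<omega>" if "s \<in> {0..t}" for s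
          using elim(2) before_stopping_mono[OF t(2), of s] that by auto
        have "set_integrable lborel {0..t} (\<lambda>s. (elementary_value (E n) s \<omega> - H' s \<omega>)\<^sup>2)
            \<longleftrightarrow> set_integrable lborel {0..t} (\<lambda>s. (elementary_value (E n) s \<omega> - H s \<omega>)\<^sup>2)" for n
          by (rule set_integrable_cong) (simp_all add: eq)
        moreover have "(LINT s:{0..t}|lborel. (elementary_value (E n) s \<omega> - H' s \<omega>)\<^sup>2)
            = (LINT s:{0..t}|lborel. (elementary_value (E n) s \<omega> - H s \<omega>)\<^sup>2)" for n
          by (rule set_lebesgue_integral_cong) (simp_all add: eq)
        moreover have "uniform_limit {0..t} (\<lambda>n u. elementary_integral W (E n) u \<omega>) (\<lambda>u. I' u \<omega>) sequentially
            \<longleftrightarrow> uniform_limit {0..t} (\<lambda>n u. elementary_integral W (E n) u \<omega>) (\<lambda>u. I u \<omega>) sequentially"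
          by (rule uniform_limit_cong') (simp_all add: eq)
        ultimately show "ito_approximation W E H' I' t \<omega>"
          using elim(1) t by simp
      qed
    qed
  qed
qed

lemma ito_integral_of_zero: "ito_integral M Fl W \<tau> (\<lambda>t \<omega>. 0) (\<lambda>t \<omega>. 0)"
  unfolding ito_integral_def
  by (intro exI[of _ "\<lambda>_. Elementary 0 (\<lambda>_. 0) (\<lambda>_ _. 0)"])
     (simp add: elementary_process_def elementary_value_def elementary_integral_def
       set_integrable_def set_lebesgue_integral_def uniform_limit_const)

lemma uniform_limit_linear_combination:
  fixes f :: "'i \<Rightarrow> 'a \<Rightarrow> 'b \<Rightarrow> real"
  assumes "finite S" "\<And>i. i \<in> S \<Longrightarrow> uniform_limit A (f i) (g i) F"
  shows "uniform_limit A (\<lambda>n x. \<Sum>i\<in>S. c i * f i n x) (\<lambda>x. \<Sum>i\<in>S. c i * g i x) F"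
  using assms
proof (induction S rule: finite_induct)
  case (insert i S)
  have "uniform_limit A (\<lambda>n x. c i * f i n x + (\<Sum>i\<in>S. c i * f i n x)) (\<lambda>x. c i * g i x + (\<Sum>i\<in>S. c i * g i x)) F"
    using insert by (intro uniform_limit_add bounded_linear.uniform_limit[OF bounded_linear_mult_right]) auto
  then show ?case using insert by simp
qed (simp add: uniform_limit_const)

text \<open>The same combination of the approximating processes works, the squared error of a sum
  being at most \<open>card S\<close> times the sum of the squared errors. Continuity of the
  \<open>H i\<close> makes the combined error Borel: measurability of each squared difference does
  not determine that of the difference.\<close>

lemma ito_integral_lincomb:
  fixes H I :: "'i \<Rightarrow> real \<Rightarrow> 'w \<Rightarrow> real"
  assumes filt: "filtered_prob_space M Fl" and S: "finite S"
    and I: "\<And>i. i \<in> S \<Longrightarrow> ito_integral M Fl W \<tau> (H i) (I i)"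
    and H: "\<And>i. i \<in> S \<Longrightarrow> AE \<omega> in M. continuous_on (lifetime \<tau> \<omega>) (\<lambda>t. H i t \<omega>)"
  shows "ito_integral M Fl W \<tau> (\<lambda>t \<omega>. \<Sum>i\<in>S. c i * H i t \<omega>) (\<lambda>t \<omega>. \<Sum>i\<in>S. c i * I i t \<omega>)"
proof -
  have "\<forall>i\<in>S. \<exists>E. (\<forall>n. elementary_process M Fl (E n)) \<and> (AE \<omega> in M. \<forall>t\<ge>0. ennreal t < \<tau> \<omega> \<longrightarrow>
           ito_approximation W E (H i) (I i) t \<omega>)"
    using I unfolding ito_integral_def by blast
  then obtain E where E: "\<And>i n. i \<in> S \<Longrightarrow> elementary_process M Fl (E i n)"
    and ae: "\<And>i. i \<in> S \<Longrightarrow> AE \<omega> in M. \<forall>t\<ge>0. ennreal t < \<tau> \<omega> \<longrightarrow>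
           ito_approximation W (E i) (H i) (I i) t \<omega>"
    unfolding bchoice_iff by blast
  have "\<forall>n. \<exists>F. elementary_process M Fl F \<and>
    (\<forall>s \<omega>. elementary_value F s \<omega> = (\<Sum>i\<in>S. c i * elementary_value (E i n) s \<omega>)) \<and>
    (\<forall>W t \<omega>. elementary_integral W F t \<omega> = (\<Sum>i\<in>S. c i * elementary_integral W (E i n) t \<omega>))"
    by (intro allI elementary_lincomb filt S E)
  then obtain F where F: "\<And>n. elementary_process M Fl (F n)"
    and F_val: "\<And>n s \<omega>. elementary_value (F n) s \<omega> = (\<Sum>i\<in>S. c i * elementary_value (E i n) s \<omega>)"
    and F_int: "\<And>n W t \<omega>. elementary_integral W (F n) t \<omega> = (\<Sum>i\<in>S. c i * elementary_integral W (E i n) t \<omega>)"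
    by metis
  have ae': "AE \<omega> in M. \<forall>i\<in>S. (\<forall>t\<ge>0. ennreal t < \<tau> \<omega> \<longrightarrow>
           ito_approximation W (E i) (H i) (I i) t \<omega>)"
    by (intro eventually_ball_finite S ballI ae)
  have H': "AE \<omega> in M. \<forall>i\<in>S. continuous_on (lifetime \<tau> \<omega>) (\<lambda>t. H i t \<omega>)"
    by (intro eventually_ball_finite S ballI H)
  show ?thesis unfolding ito_integral_def
  proof (intro exI[of _ F] conjI allI F)
    from ae' H' AE_space show "AE \<omega> in M. \<forall>t\<ge>0. ennreal t < \<tau> \<omega> \<longrightarrow>
           ito_approximation W F (\<lambda>s \<omega>. \<Sum>i\<in>S. c i * H i s \<omega>) (\<lambda>u \<omega>. \<Sum>i\<in>S. c i * I i u \<omega>) t \<omega>"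
    proof eventually_elim
      case (elim \<omega>)
      show ?case
      proof (intro allI impI)
        fix t :: real assume t: "0 \<le> t" "ennreal t < \<tau> \<omega>"
        have Hc: "continuous_on {0..t} (\<lambda>s. \<Sum>i\<in>S. c i * H i s \<omega>)"
          using elim(2) continuous_on_subset[OF _ before_stopping_subset[OF t(2)]]
          by (intro continuous_intros) blast
        have int: "set_integrable lborel {0..t} (\<lambda>s. (elementary_value (F n) s \<omega> - (\<Sum>i\<in>S. c i * H i s \<omega>))\<^sup>2)" for n
          by (rule set_integrable_bounded_minus_continuous_square[OF elementary_value_bounded[OF F elim(3)] Hc])
        have inti: "set_integrable lborel {0..t} (\<lambda>s. (elementary_value (E i n) s \<omega> - H i s \<omega>)\<^sup>2)" if "i \<in> S" for i n
          using elim(1) t that by blast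
        have limi: "(\<lambda>n. LINT s:{0..t}|lborel. (elementary_value (E i n) s \<omega> - H i s \<omega>)\<^sup>2) \<longlonglongrightarrow> 0" if "i \<in> S" for i
          using elim(1) t that by blast
        have bound: "(LINT s:{0..t}|lborel. (elementary_value (F n) s \<omega> - (\<Sum>i\<in>S. c i * H i s \<omega>))\<^sup>2)
           \<le> (\<Sum>i\<in>S. ((c i)\<^sup>2 * card S) * (LINT s:{0..t}|lborel. (elementary_value (E i n) s \<omega> - H i s \<omega>)\<^sup>2))" for n
        proof -
          have ii: "integrable lborel (\<lambda>s. ((c i)\<^sup>2 * card S) * (indicator {0..t} s *\<^sub>R (elementary_value (E i n) s \<omega> - H i s \<omega>)\<^sup>2))"
            if "i \<in> S" for i
            using inti[OF that, of n] unfolding set_integrable_def by (rule integrable_mult_right)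
          have "(LINT s:{0..t}|lborel. (elementary_value (F n) s \<omega> - (\<Sum>i\<in>S. c i * H i s \<omega>))\<^sup>2)
             \<le> (LINT s|lborel. (\<Sum>i\<in>S. ((c i)\<^sup>2 * card S) * (indicator {0..t} s *\<^sub>R (elementary_value (E i n) s \<omega> - H i s \<omega>)\<^sup>2)))"
            unfolding set_lebesgue_integral_def
          proof (rule integral_mono)
            show "integrable lborel (\<lambda>s. indicator {0..t} s *\<^sub>R (elementary_value (F n) s \<omega> - (\<Sum>i\<in>S. c i * H i s \<omega>))\<^sup>2)"
              using int[of n] unfolding set_integrable_def .
            show "integrable lborel (\<lambda>s. \<Sum>i\<in>S. ((c i)\<^sup>2 * card S) * (indicator {0..t} s *\<^sub>R (elementary_value (E i n) s \<omega> - H i s \<omega>)\<^sup>2))"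
              by (rule Bochner_Integration.integrable_sum[OF ii])
            fix s
            have "(elementary_value (F n) s \<omega> - (\<Sum>i\<in>S. c i * H i s \<omega>))\<^sup>2
               = (\<Sum>i\<in>S. c i * (elementary_value (E i n) s \<omega> - H i s \<omega>))\<^sup>2"
              unfolding F_val by (simp add: right_diff_distrib sum_subtractf)
            also have "\<dots> \<le> (\<Sum>i\<in>S. (c i * (elementary_value (E i n) s \<omega> - H i s \<omega>))\<^sup>2) * card S"
              by (rule sum_squared_le_sum_of_squares)
            also have "\<dots> = (\<Sum>i\<in>S. ((c i)\<^sup>2 * card S) * (elementary_value (E i n) s \<omega> - H i s \<omega>)\<^sup>2)"
              unfolding sum_distrib_right by (intro sum.cong refl) (simp add: power_mult_distrib mult_ac)
            finally show "indicator {0..t} s *\<^sub>R (elementary_value (F n) s \<omega> - (\<Sum>i\<in>S. c i * H i s \<omega>))\<^sup>2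
              \<le> (\<Sum>i\<in>S. ((c i)\<^sup>2 * card S) * (indicator {0..t} s *\<^sub>R (elementary_value (E i n) s \<omega> - H i s \<omega>)\<^sup>2))"
              by (cases "s \<in> {0..t}") auto
          qed
          also have "\<dots> = (\<Sum>i\<in>S. ((c i)\<^sup>2 * card S) * (LINT s:{0..t}|lborel. (elementary_value (E i n) s \<omega> - H i s \<omega>)\<^sup>2))"
            unfolding set_lebesgue_integral_def
            by (subst Bochner_Integration.integral_sum[OF ii], assumption) (simp only: integral_mult_right_zero)
          finally show ?thesis .
        qed
        have lim: "(\<lambda>n. LINT s:{0..t}|lborel. (elementary_value (F n) s \<omega> - (\<Sum>i\<in>S. c i * H i s \<omega>))\<^sup>2) \<longlonglongrightarrow> 0"
        proof (rule tendsto_sandwich[OF _ _ tendsto_const])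
          show "eventually (\<lambda>n. 0 \<le> (LINT s:{0..t}|lborel. (elementary_value (F n) s \<omega> - (\<Sum>i\<in>S. c i * H i s \<omega>))\<^sup>2)) sequentially"
            unfolding set_lebesgue_integral_def by (intro always_eventually allI integral_nonneg_AE AE_I2) simp
          show "eventually (\<lambda>n. (LINT s:{0..t}|lborel. (elementary_value (F n) s \<omega> - (\<Sum>i\<in>S. c i * H i s \<omega>))\<^sup>2)
             \<le> (\<Sum>i\<in>S. ((c i)\<^sup>2 * card S) * (LINT s:{0..t}|lborel. (elementary_value (E i n) s \<omega> - H i s \<omega>)\<^sup>2))) sequentially"
            using bound by (intro always_eventually allI)
          show "(\<lambda>n. \<Sum>i\<in>S. ((c i)\<^sup>2 * card S) * (LINT s:{0..t}|lborel. (elementary_value (E i n) s \<omega> - H i s \<omega>)\<^sup>2)) \<longlonglongrightarrow> 0"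
            by (intro tendsto_null_sum tendsto_mult_right_zero limi)
        qed
        have "uniform_limit {0..t} (\<lambda>n u. elementary_integral W (F n) u \<omega>) (\<lambda>u. \<Sum>i\<in>S. c i * I i u \<omega>) sequentially"
          unfolding F_int using elim(1) t by (intro uniform_limit_linear_combination S) blast
        with int lim show "ito_approximation W F (\<lambda>s \<omega>. \<Sum>i\<in>S. c i * H i s \<omega>) (\<lambda>u \<omega>. \<Sum>i\<in>S. c i * I i u \<omega>) t \<omega>" by blast
      qed
    qed
  qed
qed

text \<open>One component of \<open>ito_differential\<close>. Continuity of the coefficients is added because
  \<open>ito_integral\<close> alone does not make the paths of the integrand Borel.\<close>

definition scalar_ito ::
    "'w measure \<Rightarrow> (real \<Rightarrow> 'w measure) \<Rightarrow> (real \<Rightarrow> 'w \<Rightarrow> real^'p) \<Rightarrow> ('w \<Rightarrow> ennreal) \<Rightarrow>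
     (real \<Rightarrow> 'w \<Rightarrow> real) \<Rightarrow> (real \<Rightarrow> 'w \<Rightarrow> real) \<Rightarrow> ('p \<Rightarrow> real \<Rightarrow> 'w \<Rightarrow> real) \<Rightarrow> bool" where
  "scalar_ito M Fl B \<tau> X \<beta> H \<longleftrightarrow>
     (\<forall>t\<ge>0. (\<lambda>\<omega>. if ennreal t < \<tau> \<omega> then X t \<omega> else 0) \<in> borel_measurable (Fl t)) \<and>
     (AE \<omega> in M. continuous_on (lifetime \<tau> \<omega>) (\<lambda>t. X t \<omega>) \<and>
        continuous_on (lifetime \<tau> \<omega>) (\<lambda>t. \<beta> t \<omega>) \<and>
        (\<forall>k. continuous_on (lifetime \<tau> \<omega>) (\<lambda>t. H k t \<omega>))) \<and>
     (\<exists>J. (\<forall>k. ito_integral M Fl (\<lambda>t \<omega>. B t \<omega> $ k) \<tau> (H k) (J k)) \<and>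
        (AE \<omega> in M. \<forall>t\<ge>0. ennreal t < \<tau> \<omega> \<longrightarrow>
           X t \<omega> = X 0 \<omega> + (LINT s:{0..t}|lborel. \<beta> s \<omega>) + (\<Sum>k\<in>UNIV. J k t \<omega>)))"

lemma scalar_ito_cong:
  assumes X: "scalar_ito M Fl B \<tau> X \<beta> H"
    and eq: "AE \<omega> in M. \<forall>t\<ge>0. ennreal t < \<tau> \<omega> \<longrightarrow> \<beta> t \<omega> = \<beta>' t \<omega> \<and> (\<forall>k. H k t \<omega> = H' k t \<omega>)"
  shows "scalar_ito M Fl B \<tau> X \<beta>' H'"
proof -
  obtain J where J: "\<And>k. ito_integral M Fl (\<lambda>t \<omega>. B t \<omega> $ k) \<tau> (H k) (J k)"
    and XJ: "AE \<omega> in M. \<forall>t\<ge>0. ennreal t < \<tau> \<omega> \<longrightarrow>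
           X t \<omega> = X 0 \<omega> + (LINT s:{0..t}|lborel. \<beta> s \<omega>) + (\<Sum>k\<in>UNIV. J k t \<omega>)"
    and cont: "AE \<omega> in M. continuous_on (lifetime \<tau> \<omega>) (\<lambda>t. X t \<omega>) \<and>
        continuous_on (lifetime \<tau> \<omega>) (\<lambda>t. \<beta> t \<omega>) \<and>
        (\<forall>k. continuous_on (lifetime \<tau> \<omega>) (\<lambda>t. H k t \<omega>))"
    and meas: "\<forall>t\<ge>0. (\<lambda>\<omega>. if ennreal t < \<tau> \<omega> then X t \<omega> else 0) \<in> borel_measurable (Fl t)"
    using X unfolding scalar_ito_def by blast
  show ?thesis unfolding scalar_ito_def
  proof (intro conjI meas exI[of _ J] allI)
    from cont eq show "AE \<omega> in M. continuous_on (lifetime \<tau> \<omega>) (\<lambda>t. X t \<omega>) \<and>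
        continuous_on (lifetime \<tau> \<omega>) (\<lambda>t. \<beta>' t \<omega>) \<and>
        (\<forall>k. continuous_on (lifetime \<tau> \<omega>) (\<lambda>t. H' k t \<omega>))"
    proof eventually_elim
      case (elim \<omega>)
      have "continuous_on (lifetime \<tau> \<omega>) (\<lambda>t. \<beta>' t \<omega>)"
        by (rule continuous_on_eq[of _ "\<lambda>t. \<beta> t \<omega>"]) (use elim in blast)+
      moreover have "continuous_on (lifetime \<tau> \<omega>) (\<lambda>t. H' k t \<omega>)" for k
        by (rule continuous_on_eq[of _ "\<lambda>t. H k t \<omega>"]) (use elim in blast)+
      ultimately show ?case using elim(1) by blast
    qed
    show "ito_integral M Fl (\<lambda>t \<omega>. B t \<omega> $ k) \<tau> (H' k) (J k)" for k
      by (rule ito_integral_cong[OF J]) (use eq in eventually_elim, simp)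
    from XJ eq show "AE \<omega> in M. \<forall>t\<ge>0. ennreal t < \<tau> \<omega> \<longrightarrow>
           X t \<omega> = X 0 \<omega> + (LINT s:{0..t}|lborel. \<beta>' s \<omega>) + (\<Sum>k\<in>UNIV. J k t \<omega>)"
    proof eventually_elim
      case (elim \<omega>)
      show ?case
      proof (intro allI impI)
        fix t :: real assume t: "0 \<le> t" "ennreal t < \<tau> \<omega>"
        have "(LINT s:{0..t}|lborel. \<beta> s \<omega>) = (LINT s:{0..t}|lborel. \<beta>' s \<omega>)"
          using elim(2) before_stopping_mono[OF t(2)] by (intro set_lebesgue_integral_cong) auto
        then show "X t \<omega> = X 0 \<omega> + (LINT s:{0..t}|lborel. \<beta>' s \<omega>) + (\<Sum>k\<in>UNIV. J k t \<omega>)" using elim(1) t by metis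
      qed
    qed
  qed
qed

lemma scalar_ito_lincomb:
  fixes X :: "'i \<Rightarrow> real \<Rightarrow> 'w \<Rightarrow> real"
  assumes filt: "filtered_prob_space M Fl" and S: "finite S"
    and X: "\<And>i. i \<in> S \<Longrightarrow> scalar_ito M Fl B \<tau> (X i) (\<beta> i) (H i)"
  shows "scalar_ito M Fl B \<tau> (\<lambda>t \<omega>. \<Sum>i\<in>S. c i * X i t \<omega>) (\<lambda>t \<omega>. \<Sum>i\<in>S. c i * \<beta> i t \<omega>) (\<lambda>k t \<omega>. \<Sum>i\<in>S. c i * H i k t \<omega>)"
proof -
  have "\<forall>i\<in>S. \<exists>J. (\<forall>k. ito_integral M Fl (\<lambda>t \<omega>. B t \<omega> $ k) \<tau> (H i k) (J k)) \<and>
        (AE \<omega> in M. \<forall>t\<ge>0. ennreal t < \<tau> \<omega> \<longrightarrow>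
           X i t \<omega> = X i 0 \<omega> + (LINT s:{0..t}|lborel. \<beta> i s \<omega>) + (\<Sum>k\<in>UNIV. J k t \<omega>))"
    using X unfolding scalar_ito_def by blast
  then obtain J where J: "\<And>i k. i \<in> S \<Longrightarrow> ito_integral M Fl (\<lambda>t \<omega>. B t \<omega> $ k) \<tau> (H i k) (J i k)"
    and XJ: "\<And>i. i \<in> S \<Longrightarrow> AE \<omega> in M. \<forall>t\<ge>0. ennreal t < \<tau> \<omega> \<longrightarrow>
           X i t \<omega> = X i 0 \<omega> + (LINT s:{0..t}|lborel. \<beta> i s \<omega>) + (\<Sum>k\<in>UNIV. J i k t \<omega>)"
    unfolding bchoice_iff by blast
  have meas: "(\<lambda>\<omega>. if ennreal t < \<tau> \<omega> then X i t \<omega> else 0) \<in> borel_measurable (Fl t)" if "0 \<le> t" "i \<in> S" for t i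
    using X[OF that(2)] that(1) unfolding scalar_ito_def by blast
  have cont: "AE \<omega> in M. \<forall>i\<in>S. continuous_on (lifetime \<tau> \<omega>) (\<lambda>t. X i t \<omega>) \<and>
        continuous_on (lifetime \<tau> \<omega>) (\<lambda>t. \<beta> i t \<omega>) \<and>
        (\<forall>k. continuous_on (lifetime \<tau> \<omega>) (\<lambda>t. H i k t \<omega>))"
    using X unfolding scalar_ito_def by (intro eventually_ball_finite S ballI) blast
  show ?thesis unfolding scalar_ito_def
  proof (intro conjI allI impI exI[of _ "\<lambda>k t \<omega>. \<Sum>i\<in>S. c i * J i k t \<omega>"])
    fix t :: real assume t: "0 \<le> t"
    have "(\<lambda>\<omega>. if ennreal t < \<tau> \<omega> then \<Sum>i\<in>S. c i * X i t \<omega> else 0)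
      = (\<lambda>\<omega>. \<Sum>i\<in>S. c i * (if ennreal t < \<tau> \<omega> then X i t \<omega> else 0))" by auto
    also have "\<dots> \<in> borel_measurable (Fl t)"
      by (intro borel_measurable_sum borel_measurable_times borel_measurable_const meas[OF t])
    finally show "(\<lambda>\<omega>. if ennreal t < \<tau> \<omega> then \<Sum>i\<in>S. c i * X i t \<omega> else 0) \<in> borel_measurable (Fl t)" .
  next
    from cont show "AE \<omega> in M. continuous_on (lifetime \<tau> \<omega>) (\<lambda>t. \<Sum>i\<in>S. c i * X i t \<omega>) \<and>
        continuous_on (lifetime \<tau> \<omega>) (\<lambda>t. \<Sum>i\<in>S. c i * \<beta> i t \<omega>) \<and>
        (\<forall>k. continuous_on (lifetime \<tau> \<omega>) (\<lambda>t. \<Sum>i\<in>S. c i * H i k t \<omega>))"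
      by eventually_elim (intro conjI allI continuous_on_sum continuous_on_mult continuous_on_const, blast+)
  next
    fix k
    show "ito_integral M Fl (\<lambda>t \<omega>. B t \<omega> $ k) \<tau> (\<lambda>t \<omega>. \<Sum>i\<in>S. c i * H i k t \<omega>) (\<lambda>t \<omega>. \<Sum>i\<in>S. c i * J i k t \<omega>)"
    proof (rule ito_integral_lincomb[OF filt S J])
      fix i assume "i \<in> S"
      with cont show "AE \<omega> in M. continuous_on (lifetime \<tau> \<omega>) (\<lambda>t. H i k t \<omega>)"
        by (auto elim: eventually_mono)
    qed
  next
    have "AE \<omega> in M. \<forall>i\<in>S. \<forall>t\<ge>0. ennreal t < \<tau> \<omega> \<longrightarrow>
           X i t \<omega> = X i 0 \<omega> + (LINT s:{0..t}|lborel. \<beta> i s \<omega>) + (\<Sum>k\<in>UNIV. J i k t \<omega>)"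
      by (intro eventually_ball_finite S ballI XJ)
    with cont show "AE \<omega> in M. \<forall>t\<ge>0. ennreal t < \<tau> \<omega> \<longrightarrow>
      (\<Sum>i\<in>S. c i * X i t \<omega>) = (\<Sum>i\<in>S. c i * X i 0 \<omega>) + (LINT s:{0..t}|lborel. (\<Sum>i\<in>S. c i * \<beta> i s \<omega>)) + (\<Sum>k\<in>UNIV. \<Sum>i\<in>S. c i * J i k t \<omega>)"
    proof eventually_elim
      case (elim \<omega>)
      show ?case
      proof (intro allI impI)
        fix t :: real assume t: "0 \<le> t" "ennreal t < \<tau> \<omega>"
        have i: "set_integrable lborel {0..t} (\<lambda>s. \<beta> i s \<omega>)" if "i \<in> S" for i
          using elim(1) that continuous_on_subset[OF _ before_stopping_subset[OF t(2)]]
          by (intro borel_integrable_atLeastAtMost') blast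
        have "(LINT s:{0..t}|lborel. (\<Sum>i\<in>S. c i * \<beta> i s \<omega>)) = (\<Sum>i\<in>S. c i * (LINT s:{0..t}|lborel. \<beta> i s \<omega>))"
        proof -
          have "(LINT s:{0..t}|lborel. (\<Sum>i\<in>S. c i * \<beta> i s \<omega>)) = (LINT s|lborel. (\<Sum>i\<in>S. c i * (indicator {0..t} s *\<^sub>R \<beta> i s \<omega>)))"
            unfolding set_lebesgue_integral_def by (simp add: sum_distrib_left mult_ac)
          also have "\<dots> = (\<Sum>i\<in>S. c i * (LINT s:{0..t}|lborel. \<beta> i s \<omega>))"
            unfolding set_lebesgue_integral_def
            using i by (subst Bochner_Integration.integral_sum) (auto simp: set_integrable_def)
          finally show ?thesis .
        qed
        moreover have "(\<Sum>i\<in>S. c i * X i t \<omega>) = (\<Sum>i\<in>S. c i * (X i 0 \<omega> + (LINT s:{0..t}|lborel. \<beta> i s \<omega>) + (\<Sum>k\<in>UNIV. J i k t \<omega>)))"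
        proof (rule sum.cong[OF refl])
          fix i assume "i \<in> S"
          then have "X i t \<omega> = X i 0 \<omega> + (LINT s:{0..t}|lborel. \<beta> i s \<omega>) + (\<Sum>k\<in>UNIV. J i k t \<omega>)"
            using elim(2) t by blast
          then show "c i * X i t \<omega> = c i * (X i 0 \<omega> + (LINT s:{0..t}|lborel. \<beta> i s \<omega>) + (\<Sum>k\<in>UNIV. J i k t \<omega>))" by (rule arg_cong)
        qed
        moreover have "(\<Sum>k\<in>UNIV. \<Sum>i\<in>S. c i * J i k t \<omega>) = (\<Sum>i\<in>S. c i * (\<Sum>k\<in>UNIV. J i k t \<omega>))"
          by (subst sum.swap) (simp add: sum_distrib_left)
        ultimately show "(\<Sum>i\<in>S. c i * X i t \<omega>) = (\<Sum>i\<in>S. c i * X i 0 \<omega>) + (LINT s:{0..t}|lborel. (\<Sum>i\<in>S. c i * \<beta> i s \<omega>)) + (\<Sum>k\<in>UNIV. \<Sum>i\<in>S. c i * J i k t \<omega>)"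
          by (simp add: distrib_left sum.distrib)
      qed
    qed
  qed
qed

lemma scalar_ito_square:
  fixes B :: "real \<Rightarrow> 'w \<Rightarrow> real^'p"
  assumes filt: "filtered_prob_space M Fl" and B: "brownian_motion M Fl B"
    and X: "scalar_ito M Fl B \<tau> X \<beta> H"
    and H: "AE \<omega> in M. \<forall>t\<ge>0. ennreal t < \<tau> \<omega> \<longrightarrow> (\<forall>k. k \<noteq> k0 \<longrightarrow> H k t \<omega> = 0)"
  shows "scalar_ito M Fl B \<tau> (\<lambda>t \<omega>. (X t \<omega>)\<^sup>2) (\<lambda>t \<omega>. 2 * X t \<omega> * \<beta> t \<omega> + (H k0 t \<omega>)\<^sup>2) (\<lambda>k t \<omega>. 2 * X t \<omega> * H k t \<omega>)"
proof -
  obtain J where J: "\<And>k. ito_integral M Fl (\<lambda>t \<omega>. B t \<omega> $ k) \<tau> (H k) (J k)"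
    and XJ: "AE \<omega> in M. \<forall>t\<ge>0. ennreal t < \<tau> \<omega> \<longrightarrow>
           X t \<omega> = X 0 \<omega> + (LINT s:{0..t}|lborel. \<beta> s \<omega>) + (\<Sum>k\<in>UNIV. J k t \<omega>)"
    and cont: "AE \<omega> in M. continuous_on (lifetime \<tau> \<omega>) (\<lambda>t. X t \<omega>) \<and>
        continuous_on (lifetime \<tau> \<omega>) (\<lambda>t. \<beta> t \<omega>) \<and>
        (\<forall>k. continuous_on (lifetime \<tau> \<omega>) (\<lambda>t. H k t \<omega>))"
    and meas: "\<And>t. 0 \<le> t \<Longrightarrow> (\<lambda>\<omega>. if ennreal t < \<tau> \<omega> then X t \<omega> else 0) \<in> borel_measurable (Fl t)"
    using X unfolding scalar_ito_def by blast
  have bm: "real_brownian M Fl (\<lambda>t \<omega>. B t \<omega> $ k)" for k by (rule real_brownian_component[OF filt B])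
  have J0: "AE \<omega> in M. \<forall>t\<ge>0. ennreal t < \<tau> \<omega> \<longrightarrow> J k t \<omega> = 0" if "k \<noteq> k0" for k
    by (rule real_brownian.ito_integral_zero[OF bm J]) (use H in eventually_elim, use that in simp)
  have "AE \<omega> in M. \<forall>k\<in>UNIV - {k0}. \<forall>t\<ge>0. ennreal t < \<tau> \<omega> \<longrightarrow> J k t \<omega> = 0"
    by (intro eventually_ball_finite ballI J0) auto
  with XJ have XJ0: "AE \<omega> in M. \<forall>t\<ge>0. ennreal t < \<tau> \<omega> \<longrightarrow> X t \<omega> = X 0 \<omega> + (LINT s:{0..t}|lborel. \<beta> s \<omega>) + J k0 t \<omega>"
  proof eventually_elim
    case (elim \<omega>)
    have "(\<Sum>k\<in>UNIV. J k t \<omega>) = J k0 t \<omega>" if "0 \<le> t" "ennreal t < \<tau> \<omega>" for t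
      using elim(2) that by (subst sum.remove[of _ k0]) (auto intro!: sum.neutral)
    then show ?case using elim(1) by metis
  qed
  \<comment> \<open>\<open>K\<close> is defined as the remainder, so that the integral equation of
    the square is an identity; the content is that \<open>K\<close> is an Ito integral.\<close>
  define K where "K t \<omega> = (X t \<omega>)\<^sup>2 - (X 0 \<omega>)\<^sup>2 - (LINT s:{0..t}|lborel. 2 * X s \<omega> * \<beta> s \<omega> + (H k0 s \<omega>)\<^sup>2)" for t \<omega>
  have K: "ito_integral M Fl (\<lambda>t \<omega>. B t \<omega> $ k0) \<tau> (\<lambda>t \<omega>. 2 * X t \<omega> * H k0 t \<omega>) K"
    unfolding K_def[abs_def]
  proof (rule real_brownian.ito_integral_square[OF bm _ _ J XJ0])
    from cont show "AE \<omega> in M. continuous_on (lifetime \<tau> \<omega>) (\<lambda>t. X t \<omega>) \<and>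
       continuous_on (lifetime \<tau> \<omega>) (\<lambda>t. \<beta> t \<omega>) \<and>
       continuous_on (lifetime \<tau> \<omega>) (\<lambda>t. H k0 t \<omega>)"
      by eventually_elim blast
  qed (rule meas)
  show ?thesis unfolding scalar_ito_def
  proof (intro conjI allI impI exI[of _ "\<lambda>k t \<omega>. if k = k0 then K t \<omega> else 0"])
    fix t :: real assume t: "0 \<le> t"
    have "(\<lambda>\<omega>. if ennreal t < \<tau> \<omega> then (X t \<omega>)\<^sup>2 else 0) = (\<lambda>\<omega>. (if ennreal t < \<tau> \<omega> then X t \<omega> else 0)\<^sup>2)" by auto
    also have "\<dots> \<in> borel_measurable (Fl t)" using meas[OF t] by (rule borel_measurable_power)
    finally show "(\<lambda>\<omega>. if ennreal t < \<tau> \<omega> then (X t \<omega>)\<^sup>2 else 0) \<in> borel_measurable (Fl t)" .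
  next
    from cont show "AE \<omega> in M. continuous_on (lifetime \<tau> \<omega>) (\<lambda>t. (X t \<omega>)\<^sup>2) \<and>
        continuous_on (lifetime \<tau> \<omega>) (\<lambda>t. 2 * X t \<omega> * \<beta> t \<omega> + (H k0 t \<omega>)\<^sup>2) \<and>
        (\<forall>k. continuous_on (lifetime \<tau> \<omega>) (\<lambda>t. 2 * X t \<omega> * H k t \<omega>))"
      by eventually_elim (intro conjI allI continuous_intros, blast+)
  next
    fix k
    show "ito_integral M Fl (\<lambda>t \<omega>. B t \<omega> $ k) \<tau> (\<lambda>t \<omega>. 2 * X t \<omega> * H k t \<omega>) (\<lambda>t \<omega>. if k = k0 then K t \<omega> else 0)"
    proof (cases "k = k0")
      case True
      then show ?thesis using K by simp
    next
      case False
      show ?thesis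
        by (rule ito_integral_cong[OF ito_integral_of_zero]) (use H in eventually_elim, use False in simp)
    qed
  next
    show "AE \<omega> in M. \<forall>t\<ge>0. ennreal t < \<tau> \<omega> \<longrightarrow>
           (X t \<omega>)\<^sup>2 = (X 0 \<omega>)\<^sup>2 + (LINT s:{0..t}|lborel. 2 * X s \<omega> * \<beta> s \<omega> + (H k0 s \<omega>)\<^sup>2) + (\<Sum>k\<in>UNIV. if k = k0 then K t \<omega> else 0)"
      by (simp add: K_def)
  qed
qed

section \<open>Passage between vector equations and their components\<close>

lemma set_integral_vec_nth:
  fixes f :: "real \<Rightarrow> real^'q"
  assumes "set_integrable lborel A f"
  shows "(LINT s:A|lborel. f s) $ j = (LINT s:A|lborel. f s $ j)"
  using integral_bounded_linear[OF bounded_linear_vec_nth assms[unfolded set_integrable_def], of j]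
  by (simp add: set_lebesgue_integral_def)

lemma scalar_ito_component:
  fixes X :: "real \<Rightarrow> 'w \<Rightarrow> real^'q" and B :: "real \<Rightarrow> 'w \<Rightarrow> real^'p"
  assumes X: "ito_differential M Fl B \<tau> X \<beta> \<Sigma>"
    and cont: "AE \<omega> in M. continuous_on (lifetime \<tau> \<omega>) (\<lambda>t. \<beta> t \<omega> $ j) \<and>
        (\<forall>k. continuous_on (lifetime \<tau> \<omega>) (\<lambda>t. \<Sigma> t \<omega> $ j $ k))"
  shows "scalar_ito M Fl B \<tau> (\<lambda>t \<omega>. X t \<omega> $ j) (\<lambda>t \<omega>. \<beta> t \<omega> $ j) (\<lambda>k t \<omega>. \<Sigma> t \<omega> $ j $ k)"
proof -
  obtain J where J: "\<And>j k. ito_integral M Fl (\<lambda>t \<omega>. B t \<omega> $ k) \<tau> (\<lambda>t \<omega>. \<Sigma> t \<omega> $ j $ k) (J j k)"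
    and XJ: "AE \<omega> in M. \<forall>t\<ge>0. ennreal t < \<tau> \<omega> \<longrightarrow> set_integrable lborel {0..t} (\<lambda>s. \<beta> s \<omega>) \<and>
           X t \<omega> = X 0 \<omega> + (LINT s:{0..t}|lborel. \<beta> s \<omega>) + (\<chi> j. \<Sum>k\<in>UNIV. J j k t \<omega>)"
    using X unfolding ito_differential_def by blast
  have meas: "(\<lambda>\<omega>. if ennreal t < \<tau> \<omega> then X t \<omega> else 0) \<in> borel_measurable (Fl t)" if "0 \<le> t" for t
    using X that unfolding ito_differential_def by blast
  have Xc: "AE \<omega> in M. continuous_on (lifetime \<tau> \<omega>) (\<lambda>t. X t \<omega>)"
    using X unfolding ito_differential_def by blast
  show ?thesis unfolding scalar_ito_def
  proof (intro conjI allI impI exI[of _ "J j"] J)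
    fix t :: real assume t: "0 \<le> t"
    have nth: "(\<lambda>x::real^'q. x $ j) \<in> borel_measurable borel"
      by (intro borel_measurable_continuous_onI continuous_intros)
    have "(\<lambda>\<omega>. if ennreal t < \<tau> \<omega> then X t \<omega> $ j else 0) = (\<lambda>\<omega>. (if ennreal t < \<tau> \<omega> then X t \<omega> else 0) $ j)" by auto
    also have "\<dots> \<in> borel_measurable (Fl t)" by (rule measurable_compose[OF meas[OF t] nth])
    finally show "(\<lambda>\<omega>. if ennreal t < \<tau> \<omega> then X t \<omega> $ j else 0) \<in> borel_measurable (Fl t)" .
  next
    from Xc cont show "AE \<omega> in M. continuous_on (lifetime \<tau> \<omega>) (\<lambda>t. X t \<omega> $ j) \<and>
        continuous_on (lifetime \<tau> \<omega>) (\<lambda>t. \<beta> t \<omega> $ j) \<and>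
        (\<forall>k. continuous_on (lifetime \<tau> \<omega>) (\<lambda>t. \<Sigma> t \<omega> $ j $ k))"
    proof eventually_elim
      case (elim \<omega>)
      then show ?case using continuous_on_component[OF elim(1), of j] by blast
    qed
  next
    from XJ show "AE \<omega> in M. \<forall>t\<ge>0. ennreal t < \<tau> \<omega> \<longrightarrow>
           X t \<omega> $ j = X 0 \<omega> $ j + (LINT s:{0..t}|lborel. \<beta> s \<omega> $ j) + (\<Sum>k\<in>UNIV. J j k t \<omega>)"
    proof eventually_elim
      case (elim \<omega>)
      show ?case
      proof (intro allI impI)
        fix t :: real assume t: "0 \<le> t" "ennreal t < \<tau> \<omega>"
        then have i: "set_integrable lborel {0..t} (\<lambda>s. \<beta> s \<omega>)"
          and eq: "X t \<omega> = X 0 \<omega> + (LINT s:{0..t}|lborel. \<beta> s \<omega>) + (\<chi> j. \<Sum>k\<in>UNIV. J j k t \<omega>)"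
          using elim by blast+
        show "X t \<omega> $ j = X 0 \<omega> $ j + (LINT s:{0..t}|lborel. \<beta> s \<omega> $ j) + (\<Sum>k\<in>UNIV. J j k t \<omega>)"
          using arg_cong[OF eq, of "\<lambda>v. v $ j"] by (simp add: set_integral_vec_nth[OF i])
      qed
    qed
  qed
qed

lemma ito_differential_of_components:
  fixes X :: "real \<Rightarrow> 'w \<Rightarrow> real^'q" and B :: "real \<Rightarrow> 'w \<Rightarrow> real^'p"
  assumes X: "\<And>j. scalar_ito M Fl B \<tau> (\<lambda>t \<omega>. X t \<omega> $ j) (\<lambda>t \<omega>. \<beta> t \<omega> $ j) (\<lambda>k t \<omega>. \<Sigma> t \<omega> $ j $ k)"
  shows "ito_differential M Fl B \<tau> X \<beta> \<Sigma>"
proof -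
  have "\<forall>j. \<exists>J. (\<forall>k. ito_integral M Fl (\<lambda>t \<omega>. B t \<omega> $ k) \<tau> (\<lambda>t \<omega>. \<Sigma> t \<omega> $ j $ k) (J k)) \<and>
        (AE \<omega> in M. \<forall>t\<ge>0. ennreal t < \<tau> \<omega> \<longrightarrow>
           X t \<omega> $ j = X 0 \<omega> $ j + (LINT s:{0..t}|lborel. \<beta> s \<omega> $ j) + (\<Sum>k\<in>UNIV. J k t \<omega>))"
    using X unfolding scalar_ito_def by blast
  then obtain J where J: "\<And>j k. ito_integral M Fl (\<lambda>t \<omega>. B t \<omega> $ k) \<tau> (\<lambda>t \<omega>. \<Sigma> t \<omega> $ j $ k) (J j k)"
    and XJ: "\<And>j. AE \<omega> in M. \<forall>t\<ge>0. ennreal t < \<tau> \<omega> \<longrightarrow>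
           X t \<omega> $ j = X 0 \<omega> $ j + (LINT s:{0..t}|lborel. \<beta> s \<omega> $ j) + (\<Sum>k\<in>UNIV. J j k t \<omega>)"
    unfolding choice_iff by blast
  have meas: "(\<lambda>\<omega>. if ennreal t < \<tau> \<omega> then X t \<omega> $ j else 0) \<in> borel_measurable (Fl t)" if "0 \<le> t" for t j
    using X[of j] that unfolding scalar_ito_def by blast
  have cont_j: "AE \<omega> in M. continuous_on (lifetime \<tau> \<omega>) (\<lambda>t. X t \<omega> $ j) \<and>
        continuous_on (lifetime \<tau> \<omega>) (\<lambda>t. \<beta> t \<omega> $ j)" for j
    using X[of j] unfolding scalar_ito_def by (auto elim: eventually_mono)
  have cont: "AE \<omega> in M. \<forall>j. continuous_on (lifetime \<tau> \<omega>) (\<lambda>t. X t \<omega> $ j) \<and>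
        continuous_on (lifetime \<tau> \<omega>) (\<lambda>t. \<beta> t \<omega> $ j)"
    by (intro eventually_all_finite cont_j)
  have vec: "continuous_on D f" if "\<And>j. continuous_on D (\<lambda>t. f t $ j)" for D and f :: "real \<Rightarrow> real^'q"
    using continuous_on_vec_lambda[of D "\<lambda>j t. f t $ j", OF that] by simp
  show ?thesis unfolding ito_differential_def
  proof (intro conjI allI impI exI[of _ J] J)
    fix t :: real assume t: "0 \<le> t"
    have "(\<lambda>\<omega>. (if ennreal t < \<tau> \<omega> then X t \<omega> else 0) \<bullet> b) \<in> borel_measurable (Fl t)" if "b \<in> Basis" for b
    proof -
      obtain j where b: "b = axis j 1" using \<open>b \<in> Basis\<close> by (auto simp: Basis_vec_def)
      have "(\<lambda>\<omega>. (if ennreal t < \<tau> \<omega> then X t \<omega> else 0) \<bullet> b) = (\<lambda>\<omega>. if ennreal t < \<tau> \<omega> then X t \<omega> $ j else 0)"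
        by (auto simp: b inner_axis)
      then show ?thesis using meas[OF t, of j] by simp
    qed
    then show "(\<lambda>\<omega>. if ennreal t < \<tau> \<omega> then X t \<omega> else 0) \<in> borel_measurable (Fl t)"
      by (subst borel_measurable_euclidean_space) blast
  next
    from cont show "AE \<omega> in M. continuous_on (lifetime \<tau> \<omega>) (\<lambda>t. X t \<omega>)"
      by eventually_elim (rule vec, blast)
  next
    have "AE \<omega> in M. \<forall>j. \<forall>t\<ge>0. ennreal t < \<tau> \<omega> \<longrightarrow>
           X t \<omega> $ j = X 0 \<omega> $ j + (LINT s:{0..t}|lborel. \<beta> s \<omega> $ j) + (\<Sum>k\<in>UNIV. J j k t \<omega>)"
      by (intro eventually_all_finite XJ)
    with cont show "AE \<omega> in M. \<forall>t\<ge>0. ennreal t < \<tau> \<omega> \<longrightarrow> set_integrable lborel {0..t} (\<lambda>s. \<beta> s \<omega>) \<and>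
           X t \<omega> = X 0 \<omega> + (LINT s:{0..t}|lborel. \<beta> s \<omega>) + (\<chi> j. \<Sum>k\<in>UNIV. J j k t \<omega>)"
    proof eventually_elim
      case (elim \<omega>)
      show ?case
      proof (intro allI impI conjI)
        fix t :: real assume t: "0 \<le> t" "ennreal t < \<tau> \<omega>"
        have "continuous_on {0..t} (\<lambda>s. \<beta> s \<omega>)"
          using elim(1) continuous_on_subset[OF _ before_stopping_subset[OF t(2)]] by (intro vec) blast
        then show i: "set_integrable lborel {0..t} (\<lambda>s. \<beta> s \<omega>)" by (rule borel_integrable_atLeastAtMost')
        show "X t \<omega> = X 0 \<omega> + (LINT s:{0..t}|lborel. \<beta> s \<omega>) + (\<chi> j. \<Sum>k\<in>UNIV. J j k t \<omega>)"
          unfolding vec_eq_iff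
        proof
          fix j
          have "X t \<omega> $ j = X 0 \<omega> $ j + (LINT s:{0..t}|lborel. \<beta> s \<omega> $ j) + (\<Sum>k\<in>UNIV. J j k t \<omega>)"
            using elim(2) t by blast
          then show "X t \<omega> $ j = (X 0 \<omega> + (LINT s:{0..t}|lborel. \<beta> s \<omega>) + (\<chi> j. \<Sum>k\<in>UNIV. J j k t \<omega>)) $ j"
            by (simp add: set_integral_vec_nth[OF i])
        qed
      qed
    qed
  qed
qed

section \<open>Moments of the empirical measure\<close>

lemma integral_empirical:
  fixes Y :: "(real^'d)^'n" and f :: "real^'d \<Rightarrow> 'b::{banach, second_countable_topology}"
  assumes "f \<in> borel_measurable borel"
  shows "(\<integral>x. f x \<partial>empirical Y) = (\<Sum>i\<in>UNIV. (1 / real CARD('n)) *\<^sub>R f (Y $ i))"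
proof -
  have "(\<lambda>i. Y $ i) \<in> measurable (uniform_count_measure UNIV) borel"
    by (simp add: measurable_def space_uniform_count_measure sets_uniform_count_measure)
  then have "(\<integral>x. f x \<partial>empirical Y) = (\<integral>i. f (Y $ i) \<partial>uniform_count_measure (UNIV :: 'n set))"
    unfolding empirical_def using assms by (rule integral_distr)
  then show ?thesis by (simp add: uniform_count_measure_def lebesgue_integral_point_measure_finite)
qed

lemma mean_empirical:
  fixes Y :: "(real^'d)^'n"
  shows "mean (empirical Y) $ j = (\<Sum>i\<in>UNIV. 1 / real CARD('n) * Y $ i $ j)"
  unfolding mean_def by (subst integral_empirical) simp_all

lemma integral_marginal_empirical:
  fixes Y :: "(real^'d)^'n" and f :: "real \<Rightarrow> real"
  assumes f: "f \<in> borel_measurable borel"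
  shows "(\<integral>x. f x \<partial>marginal (empirical Y) j) = (\<Sum>i\<in>UNIV. 1 / real CARD('n) * f (Y $ i $ j))"
proof -
  have nth: "(\<lambda>x::real^'d. x $ j) \<in> borel_measurable borel"
    by (intro borel_measurable_continuous_onI continuous_intros)
  then have "(\<lambda>x. x $ j) \<in> measurable (empirical Y) borel" by (simp add: empirical_def)
  then have "(\<integral>x. f x \<partial>marginal (empirical Y) j) = (\<integral>x. f (x $ j) \<partial>empirical Y)"
    unfolding marginal_def using f by (rule integral_distr)
  also have "\<dots> = (\<Sum>i\<in>UNIV. 1 / real CARD('n) * f (Y $ i $ j))"
    using measurable_compose[OF nth f] by (subst integral_empirical) simp_all
  finally show ?thesis .
qed

lemma second_moment_empirical:
  fixes Y :: "(real^'d)^'n"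
  shows "second_moment (empirical Y) $ j = (\<Sum>i\<in>UNIV. 1 / real CARD('n) * (Y $ i $ j)\<^sup>2)"
  by (simp add: second_moment_def integral_marginal_empirical)

lemma Var_empirical:
  fixes Y :: "(real^'d)^'n"
  shows "Var (empirical Y) $ j = (\<Sum>i\<in>UNIV. 1 / real CARD('n) * (Y $ i $ j - mean (empirical Y) $ j)\<^sup>2)"
  by (simp add: Var_def integral_marginal_empirical mean_empirical)

section \<open>Moments of a particle system\<close>

text \<open>The drift of one square is
  \<open>(x i)\<^sup>2 * (2 * (\<delta> - 3/2) + 1) / (4 * S\<^sup>2)\<close>, where the 1 is the
  Ito correction, and its noise is \<open>(x i)\<^sup>2 / S\<close>. Both are multiples of
  \<open>(x i)\<^sup>2\<close>, so averaging replaces that by \<open>S\<close>. The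
  \<open>x i\<close> are kept general in order to admit centred coordinates as well.\<close>

lemma scalar_ito_second_moment:
  fixes x :: "'n::finite \<Rightarrow> real \<Rightarrow> 'w \<Rightarrow> real"
  defines "S \<equiv> \<lambda>t \<omega>. \<Sum>i\<in>UNIV. 1 / real CARD('n) * (x i t \<omega>)\<^sup>2"
  assumes filt: "filtered_prob_space M Fl" and B: "brownian_motion M Fl B"
    and x: "\<And>i. scalar_ito M Fl B \<tau> (x i) (\<lambda>t \<omega>. (\<delta> - 3/2) * (x i t \<omega> / (4 * (S t \<omega>)\<^sup>2)))
        (\<lambda>k t \<omega>. if k = k0 then x i t \<omega> / (2 * S t \<omega>) else 0)"
    and pos: "AE \<omega> in M. \<forall>t\<ge>0. ennreal t < \<tau> \<omega> \<longrightarrow> 0 < S t \<omega>"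
  shows "scalar_ito M Fl B \<tau> S (\<lambda>t \<omega>. (\<delta> - 1) / (2 * S t \<omega>)) (\<lambda>k t \<omega>. if k = k0 then 1 else 0)"
proof -
  let ?w = "1 / real CARD('n)"
  have "scalar_ito M Fl B \<tau> (\<lambda>t \<omega>. (x i t \<omega>)\<^sup>2)
      (\<lambda>t \<omega>. 2 * x i t \<omega> * ((\<delta> - 3/2) * (x i t \<omega> / (4 * (S t \<omega>)\<^sup>2))) + (if k0 = k0 then x i t \<omega> / (2 * S t \<omega>) else 0)\<^sup>2)
      (\<lambda>k t \<omega>. 2 * x i t \<omega> * (if k = k0 then x i t \<omega> / (2 * S t \<omega>) else 0))" for i
    by (rule scalar_ito_square[OF filt B x, of k0]) simp
  from scalar_ito_lincomb[OF filt finite_class.finite_UNIV this, of "\<lambda>_. ?w"]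
  have *: "scalar_ito M Fl B \<tau> S
      (\<lambda>t \<omega>. \<Sum>i\<in>UNIV. ?w * (2 * x i t \<omega> * ((\<delta> - 3/2) * (x i t \<omega> / (4 * (S t \<omega>)\<^sup>2))) + (if k0 = k0 then x i t \<omega> / (2 * S t \<omega>) else 0)\<^sup>2))
      (\<lambda>k t \<omega>. \<Sum>i\<in>UNIV. ?w * (2 * x i t \<omega> * (if k = k0 then x i t \<omega> / (2 * S t \<omega>) else 0)))"
    by (simp only: S_def)
  show ?thesis
  proof (rule scalar_ito_cong[OF *])
    \<comment> \<open>Positivity is what allows the cancellations
      \<open>S / S\<^sup>2 = 1 / S\<close> and \<open>S / S = 1\<close>.\<close>
    from pos show "AE \<omega> in M. \<forall>t\<ge>0. ennreal t < \<tau> \<omega> \<longrightarrow>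
      (\<Sum>i\<in>UNIV. ?w * (2 * x i t \<omega> * ((\<delta> - 3/2) * (x i t \<omega> / (4 * (S t \<omega>)\<^sup>2))) + (if k0 = k0 then x i t \<omega> / (2 * S t \<omega>) else 0)\<^sup>2))
        = (\<delta> - 1) / (2 * S t \<omega>) \<and>
      (\<forall>k. (\<Sum>i\<in>UNIV. ?w * (2 * x i t \<omega> * (if k = k0 then x i t \<omega> / (2 * S t \<omega>) else 0))) = (if k = k0 then 1 else 0))"
    proof eventually_elim
      case (elim \<omega>)
      show ?case
      proof (intro allI impI conjI)
        fix t :: real assume "0 \<le> t" "ennreal t < \<tau> \<omega>"
        then have S: "0 < S t \<omega>" using elim by blast
        have "(\<Sum>i\<in>UNIV. ?w * (2 * x i t \<omega> * ((\<delta> - 3/2) * (x i t \<omega> / (4 * (S t \<omega>)\<^sup>2))) + (if k0 = k0 then x i t \<omega> / (2 * S t \<omega>) else 0)\<^sup>2))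
          = (\<Sum>i\<in>UNIV. (\<delta> - 1) / (2 * (S t \<omega>)\<^sup>2) * (?w * (x i t \<omega>)\<^sup>2))"
          using S by (intro sum.cong refl) (simp add: power2_eq_square field_simps)
        also have "\<dots> = (\<delta> - 1) / (2 * (S t \<omega>)\<^sup>2) * S t \<omega>" by (simp only: S_def sum_distrib_left)
        also have "\<dots> = (\<delta> - 1) / (2 * S t \<omega>)" using S by (simp add: power2_eq_square)
        finally show "(\<Sum>i\<in>UNIV. ?w * (2 * x i t \<omega> * ((\<delta> - 3/2) * (x i t \<omega> / (4 * (S t \<omega>)\<^sup>2))) + (if k0 = k0 then x i t \<omega> / (2 * S t \<omega>) else 0)\<^sup>2))
          = (\<delta> - 1) / (2 * S t \<omega>)" .
        fix k
        have "(\<Sum>i\<in>UNIV. ?w * (2 * x i t \<omega> * (if k = k0 then x i t \<omega> / (2 * S t \<omega>) else 0)))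
          = (\<Sum>i\<in>UNIV. (if k = k0 then 1 / S t \<omega> else 0) * (?w * (x i t \<omega>)\<^sup>2))"
          using S by (intro sum.cong refl) (simp add: power2_eq_square field_simps)
        also have "\<dots> = (if k = k0 then 1 / S t \<omega> else 0) * S t \<omega>" by (simp only: S_def sum_distrib_left)
        also have "\<dots> = (if k = k0 then 1 else 0)" using S by simp
        finally show "(\<Sum>i\<in>UNIV. ?w * (2 * x i t \<omega> * (if k = k0 then x i t \<omega> / (2 * S t \<omega>) else 0))) = (if k = k0 then 1 else 0)" .
      qed
    qed
  qed
qed

text \<open>The coefficients \<open>h\<close> common to all particles act on the mean only; centring cancels them.\<close>

lemma scalar_ito_mean_variance:
  fixes x :: "'n::finite \<Rightarrow> real \<Rightarrow> 'w \<Rightarrow> real" and h :: "'p::finite \<Rightarrow> real"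
  defines "m \<equiv> \<lambda>t \<omega>. \<Sum>i\<in>UNIV. 1 / real CARD('n) * x i t \<omega>"
  defines "V \<equiv> \<lambda>t \<omega>. \<Sum>i\<in>UNIV. 1 / real CARD('n) * (x i t \<omega> - m t \<omega>)\<^sup>2"
  assumes filt: "filtered_prob_space M Fl" and B: "brownian_motion M Fl B"
    and x: "\<And>i. scalar_ito M Fl B \<tau> (x i) (\<lambda>t \<omega>. (\<delta> - 3/2) * ((x i t \<omega> - m t \<omega>) / (4 * (V t \<omega>)\<^sup>2)))
        (\<lambda>k t \<omega>. if k = k0 then (x i t \<omega> - m t \<omega>) / (2 * V t \<omega>) else h k)"
    and pos: "AE \<omega> in M. \<forall>t\<ge>0. ennreal t < \<tau> \<omega> \<longrightarrow> 0 < V t \<omega>"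
  shows "scalar_ito M Fl B \<tau> m (\<lambda>t \<omega>. 0) (\<lambda>k t \<omega>. if k = k0 then 0 else h k)"
    and "scalar_ito M Fl B \<tau> V (\<lambda>t \<omega>. (\<delta> - 1) / (2 * V t \<omega>)) (\<lambda>k t \<omega>. if k = k0 then 1 else 0)"
proof -
  let ?w = "1 / real CARD('n)"
  let ?\<beta> = "\<lambda>i t \<omega>. (\<delta> - 3/2) * ((x i t \<omega> - m t \<omega>) / (4 * (V t \<omega>)\<^sup>2))"
  let ?H = "\<lambda>i k t \<omega>. if k = k0 then (x i t \<omega> - m t \<omega>) / (2 * V t \<omega>) else h k"
  have w1: "(\<Sum>i\<in>(UNIV::'n set). ?w * c) = c" for c :: real by simp
  have centred: "(\<Sum>i\<in>UNIV. ?w * (x i t \<omega> - m t \<omega>)) = 0" for t \<omega>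
    using w1[of "m t \<omega>"] by (simp only: right_diff_distrib sum_subtractf) (simp add: m_def)
  \<comment> \<open>This includes \<open>d = 0\<close>, where the quotient is 0, so the averages
    vanish at all times and can be used for rewriting without a condition on
    \<open>t\<close>.\<close>
  have scaled: "(\<Sum>i\<in>UNIV. ?w * (c * ((x i t \<omega> - m t \<omega>) / d))) = 0" for c d t \<omega>
  proof -
    have "(\<Sum>i\<in>UNIV. ?w * (c * ((x i t \<omega> - m t \<omega>) / d))) = (\<Sum>i\<in>UNIV. c / d * (?w * (x i t \<omega> - m t \<omega>)))"
      by (intro sum.cong refl) simp
    also have "\<dots> = c / d * (\<Sum>i\<in>UNIV. ?w * (x i t \<omega> - m t \<omega>))" by (rule sum_distrib_left[symmetric])
    finally show ?thesis by (simp only: centred mult_zero_right)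
  qed
  have avg_\<beta>: "(\<Sum>i\<in>UNIV. ?w * ?\<beta> i t \<omega>) = 0" for t \<omega> by (rule scaled)
  have avg_H: "(\<Sum>i\<in>UNIV. ?w * ?H i k t \<omega>) = (if k = k0 then 0 else h k)" for k t \<omega>
  proof (cases "k = k0")
    case True
    then show ?thesis using scaled[of 1 t \<omega> "2 * V t \<omega>"] by (simp only: mult_1 if_True simp_thms)
  next
    case False
    then show ?thesis using w1[of "h k"] by simp
  qed
  have "scalar_ito M Fl B \<tau> m (\<lambda>t \<omega>. \<Sum>i\<in>UNIV. ?w * ?\<beta> i t \<omega>) (\<lambda>k t \<omega>. \<Sum>i\<in>UNIV. ?w * ?H i k t \<omega>)"
    using scalar_ito_lincomb[OF filt finite_class.finite_UNIV x, of "\<lambda>_. ?w"] by (simp only: m_def)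
  then show "scalar_ito M Fl B \<tau> m (\<lambda>t \<omega>. 0) (\<lambda>k t \<omega>. if k = k0 then 0 else h k)"
    by (simp only: avg_\<beta> avg_H)
  \<comment> \<open>Centring is a linear combination of the particles, with coefficients Kronecker
    delta minus \<open>?w\<close>, so that \<open>scalar_ito_lincomb\<close> covers it.\<close>
  have centring: "(\<Sum>l\<in>UNIV. ((if l = i then 1 else 0) - ?w) * f l) = f i - (\<Sum>l\<in>UNIV. ?w * f l)" for i and f :: "'n \<Rightarrow> real"
    by (simp add: left_diff_distrib sum_subtractf if_distrib[where f="\<lambda>y. y * _"] cong: if_cong)
  have m_eq: "(\<Sum>l\<in>UNIV. ?w * x l t \<omega>) = m t \<omega>" for t \<omega> by (simp add: m_def)
  have D: "scalar_ito M Fl B \<tau> (\<lambda>t \<omega>. x i t \<omega> - m t \<omega>) (?\<beta> i)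
      (\<lambda>k t \<omega>. if k = k0 then (x i t \<omega> - m t \<omega>) / (2 * V t \<omega>) else 0)" for i
  proof -
    have "scalar_ito M Fl B \<tau> (\<lambda>t \<omega>. \<Sum>l\<in>UNIV. ((if l = i then 1 else 0) - ?w) * x l t \<omega>)
       (\<lambda>t \<omega>. \<Sum>l\<in>UNIV. ((if l = i then 1 else 0) - ?w) * ?\<beta> l t \<omega>)
       (\<lambda>k t \<omega>. \<Sum>l\<in>UNIV. ((if l = i then 1 else 0) - ?w) * ?H l k t \<omega>)"
      by (rule scalar_ito_lincomb[OF filt finite_class.finite_UNIV x])
    then have "scalar_ito M Fl B \<tau> (\<lambda>t \<omega>. x i t \<omega> - m t \<omega>) (\<lambda>t \<omega>. ?\<beta> i t \<omega> - 0)
       (\<lambda>k t \<omega>. ?H i k t \<omega> - (if k = k0 then 0 else h k))"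
      unfolding centring avg_\<beta> avg_H m_eq .
    then show ?thesis by (rule scalar_ito_cong) simp
  qed
  \<comment> \<open>\<open>V\<close> is the second moment of the centred coordinates, and these
    satisfy the equation of the second-moment system with \<open>V\<close> in place of
    \<open>S\<close>.\<close>
  show "scalar_ito M Fl B \<tau> V (\<lambda>t \<omega>. (\<delta> - 1) / (2 * V t \<omega>)) (\<lambda>k t \<omega>. if k = k0 then 1 else 0)"
    unfolding V_def
    by (rule scalar_ito_second_moment[where x="\<lambda>i t \<omega>. x i t \<omega> - m t \<omega>",
          OF filt B D[unfolded V_def] pos[unfolded V_def]])
qed

lemma particle_solution_continuous:
  fixes Y :: "real \<Rightarrow> 'w \<Rightarrow> (real^'d)^'n"
  assumes "particle_solution M Fl B \<tau> b \<sigma> Y"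
  shows "AE \<omega> in M. \<forall>i j. continuous_on (lifetime \<tau> \<omega>) (\<lambda>t. Y t \<omega> $ i $ j)"
proof -
  have "AE \<omega> in M. \<forall>i. continuous_on (lifetime \<tau> \<omega>) (\<lambda>t. Y t \<omega> $ i)"
    using assms unfolding particle_solution_def ito_differential_def by (intro eventually_all_finite) blast
  then show ?thesis
  proof eventually_elim
    case (elim \<omega>)
    then show ?case using continuous_on_component by blast
  qed
qed

text \<open>One statement for both systems with variance drift: \<open>k0\<close> is the column of
  the diagonal block and \<open>h\<close> the rest of row \<open>j\<close>, namely 0 for the
  variance alone and the row of the identity block for mean and variance together.\<close>

lemma particle_mean_variance:
  fixes Y :: "real \<Rightarrow> 'w \<Rightarrow> (real^'d)^'n" and B :: "real \<Rightarrow> 'w \<Rightarrow> real^'p"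
  assumes filt: "filtered_prob_space M Fl" and B: "brownian_motion M Fl B"
    and Y: "particle_solution M Fl B \<tau> (drift_var \<delta>) \<sigma> Y"
    and pos: "positive_before M \<tau> (\<lambda>t \<omega>. Var (empirical (Y t \<omega>)))"
    and \<sigma>: "\<And>x \<rho> k. \<sigma> x \<rho> $ j $ k = (if k = k0 then (x $ j - mean \<rho> $ j) / (2 * Var \<rho> $ j) else h k)"
  shows "scalar_ito M Fl B \<tau> (\<lambda>t \<omega>. mean (empirical (Y t \<omega>)) $ j) (\<lambda>t \<omega>. 0) (\<lambda>k t \<omega>. if k = k0 then 0 else h k)"
    and "scalar_ito M Fl B \<tau> (\<lambda>t \<omega>. Var (empirical (Y t \<omega>)) $ j) (\<lambda>t \<omega>. (\<delta> - 1) / (2 * Var (empirical (Y t \<omega>)) $ j))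
      (\<lambda>k t \<omega>. if k = k0 then 1 else 0)"
proof -
  let ?m = "\<lambda>t \<omega>. mean (empirical (Y t \<omega>)) $ j" and ?V = "\<lambda>t \<omega>. Var (empirical (Y t \<omega>)) $ j"
  have "scalar_ito M Fl B \<tau> (\<lambda>t \<omega>. Y t \<omega> $ i $ j) (\<lambda>t \<omega>. drift_var \<delta> (Y t \<omega> $ i) (empirical (Y t \<omega>)) $ j)
      (\<lambda>k t \<omega>. \<sigma> (Y t \<omega> $ i) (empirical (Y t \<omega>)) $ j $ k)" for i
  proof (rule scalar_ito_component)
    show "ito_differential M Fl B \<tau> (\<lambda>t \<omega>. Y t \<omega> $ i) (\<lambda>t \<omega>. drift_var \<delta> (Y t \<omega> $ i) (empirical (Y t \<omega>)))
      (\<lambda>t \<omega>. \<sigma> (Y t \<omega> $ i) (empirical (Y t \<omega>)))" using Y by (simp add: particle_solution_def)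
    from particle_solution_continuous[OF Y] pos[unfolded positive_before_def]
    show "AE \<omega> in M. continuous_on (lifetime \<tau> \<omega>) (\<lambda>t. drift_var \<delta> (Y t \<omega> $ i) (empirical (Y t \<omega>)) $ j) \<and>
      (\<forall>k. continuous_on (lifetime \<tau> \<omega>) (\<lambda>t. \<sigma> (Y t \<omega> $ i) (empirical (Y t \<omega>)) $ j $ k))"
    proof eventually_elim
      case (elim \<omega>)
      let ?D = "lifetime \<tau> \<omega>"
      have Yc: "continuous_on ?D (\<lambda>t. Y t \<omega> $ i $ j)" for i using elim(1) by blast
      have mc: "continuous_on ?D (\<lambda>t. ?m t \<omega>)"
        unfolding mean_empirical by (intro continuous_intros Yc)
      have Vc: "continuous_on ?D (\<lambda>t. ?V t \<omega>)"
        unfolding Var_empirical by (intro continuous_intros Yc mc)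
      \<comment> \<open>The coefficients are continuous only where their denominator does not
        vanish, which positivity grants on the lifetime.\<close>
      have V0: "?V t \<omega> \<noteq> 0" if "t \<in> ?D" for t using elim(2) that by (metis mem_Collect_eq less_irrefl)
      have "continuous_on ?D (\<lambda>t. (\<delta> - 3/2) * ((Y t \<omega> $ i $ j - ?m t \<omega>) / (4 * (?V t \<omega>)\<^sup>2)))"
        using V0 by (intro continuous_intros Yc mc Vc) auto
      moreover have "continuous_on ?D (\<lambda>t. (Y t \<omega> $ i $ j - ?m t \<omega>) / (2 * ?V t \<omega>))"
        using V0 by (intro continuous_intros Yc mc Vc) auto
      then have "continuous_on ?D (\<lambda>t. if k = k0 then (Y t \<omega> $ i $ j - ?m t \<omega>) / (2 * ?V t \<omega>) else h k)" for k
        by (cases "k = k0") simp_all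
      ultimately show ?case by (simp add: drift_var_def \<sigma> cong: if_cong)
    qed
  qed
  then have x: "scalar_ito M Fl B \<tau> (\<lambda>t \<omega>. Y t \<omega> $ i $ j) (\<lambda>t \<omega>. (\<delta> - 3/2) * ((Y t \<omega> $ i $ j - ?m t \<omega>) / (4 * (?V t \<omega>)\<^sup>2)))
      (\<lambda>k t \<omega>. if k = k0 then (Y t \<omega> $ i $ j - ?m t \<omega>) / (2 * ?V t \<omega>) else h k)" for i
    by (rule scalar_ito_cong) (auto simp: drift_var_def \<sigma>)
  have pos': "AE \<omega> in M. \<forall>t\<ge>0. ennreal t < \<tau> \<omega> \<longrightarrow> 0 < ?V t \<omega>"
    using pos[unfolded positive_before_def] by eventually_elim blast
  \<comment> \<open>The mean has to be folded first: the right-hand side of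
    \<open>Var_empirical\<close> contains it in folded form.\<close>
  note mv = scalar_ito_mean_variance[where x="\<lambda>i t \<omega>. Y t \<omega> $ i $ j" and M=M and Fl=Fl and B=B and \<tau>=\<tau> and \<delta>=\<delta> and ?k0.0=k0 and h=h,
      folded mean_empirical, folded Var_empirical, OF filt B x pos']
  show "scalar_ito M Fl B \<tau> ?m (\<lambda>t \<omega>. 0) (\<lambda>k t \<omega>. if k = k0 then 0 else h k)" by (rule mv(1))
  show "scalar_ito M Fl B \<tau> ?V (\<lambda>t \<omega>. (\<delta> - 1) / (2 * ?V t \<omega>)) (\<lambda>k t \<omega>. if k = k0 then 1 else 0)" by (rule mv(2))
qed

section \<open>Coordinatewise verification for the four observables\<close>

theorem lemma3p1:
  fixes M :: "'w measure" and Fl :: "real \<Rightarrow> 'w measure" and \<tau> :: "'w \<Rightarrow> ennreal"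
    and B :: "real \<Rightarrow> 'w \<Rightarrow> real^'d"
    and B2 :: "real \<Rightarrow> 'w \<Rightarrow> real^('d::finite + 'd)"
    and Y :: "real \<Rightarrow> 'w \<Rightarrow> (real^'d)^'n"
    and \<delta> :: real
  assumes "filtered_prob_space M Fl"
    and "extended_stopping_time Fl \<tau>"
    and "\<delta> \<ge> 2"
  shows
    "(brownian_motion M Fl B \<longrightarrow>
      particle_solution M Fl B \<tau> (\<lambda>x \<rho>. 0) (\<lambda>x \<rho>. mat 1) Y \<longrightarrow>
      sde_solution M Fl B \<tau> (\<lambda>z. 0) (\<lambda>z. mat 1) (\<lambda>t \<omega>. mean (empirical (Y t \<omega>))))
   \<and> (brownian_motion M Fl B \<longrightarrow>
      particle_solution M Fl B \<tau> (drift_sm \<delta>) diffusion_sm Y \<longrightarrow>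
      positive_before M \<tau> (\<lambda>t \<omega>. second_moment (empirical (Y t \<omega>))) \<longrightarrow>
      sde_solution M Fl B \<tau> (bessel_drift \<delta>) (\<lambda>z. mat 1)
        (\<lambda>t \<omega>. second_moment (empirical (Y t \<omega>))))
   \<and> (brownian_motion M Fl B \<longrightarrow>
      particle_solution M Fl B \<tau> (drift_var \<delta>) diffusion_var Y \<longrightarrow>
      positive_before M \<tau> (\<lambda>t \<omega>. Var (empirical (Y t \<omega>))) \<longrightarrow>
      sde_solution M Fl B \<tau> (bessel_drift \<delta>) (\<lambda>z. mat 1)
        (\<lambda>t \<omega>. Var (empirical (Y t \<omega>))))
   \<and> (brownian_motion M Fl B2 \<longrightarrow>
      particle_solution M Fl B2 \<tau> (drift_var \<delta>) (\<lambda>x \<rho>. hblock (mat 1) (diffusion_var x \<rho>)) Y \<longrightarrow>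
      positive_before M \<tau> (\<lambda>t \<omega>. Var (empirical (Y t \<omega>))) \<longrightarrow>
      sde_solution M Fl B2 \<tau> (\<lambda>z. concat_vec 0 (bessel_drift \<delta> (second_block z))) (\<lambda>z. mat 1)
        (\<lambda>t \<omega>. mean_var (empirical (Y t \<omega>))))"
proof (intro conjI impI)
  note filt = assms(1)
  assume Y: "particle_solution M Fl B \<tau> (\<lambda>x \<rho>. 0) (\<lambda>x \<rho>. mat 1) Y"
  show "sde_solution M Fl B \<tau> (\<lambda>z. 0) (\<lambda>z. mat 1) (\<lambda>t \<omega>. mean (empirical (Y t \<omega>)))"
    unfolding sde_solution_def
  proof (rule ito_differential_of_components)
    fix j
    let ?w = "1 / real CARD('n)"
    have "scalar_ito M Fl B \<tau> (\<lambda>t \<omega>. Y t \<omega> $ i $ j) (\<lambda>t \<omega>. 0 $ j) (\<lambda>k t \<omega>. (mat 1 :: real^'d^'d) $ j $ k)" for i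
      using Y unfolding particle_solution_def by (intro scalar_ito_component) auto
    from scalar_ito_lincomb[OF filt finite_class.finite_UNIV this, of "\<lambda>_. ?w"]
    have "scalar_ito M Fl B \<tau> (\<lambda>t \<omega>. mean (empirical (Y t \<omega>)) $ j) (\<lambda>t \<omega>. \<Sum>i\<in>(UNIV::'n set). ?w * 0 $ j)
      (\<lambda>k t \<omega>. \<Sum>i\<in>(UNIV::'n set). ?w * (mat 1 :: real^'d^'d) $ j $ k)" by (simp only: mean_empirical)
    \<comment> \<open>Linearity is enough here: the coefficients are the same for all particles and
      the weights \<open>?w\<close> sum to 1.\<close>
    then show "scalar_ito M Fl B \<tau> (\<lambda>t \<omega>. mean (empirical (Y t \<omega>)) $ j) (\<lambda>t \<omega>. 0 $ j)
      (\<lambda>k t \<omega>. (mat 1 :: real^'d^'d) $ j $ k)" by (rule scalar_ito_cong) simp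
  qed
next
  note filt = assms(1)
  assume B: "brownian_motion M Fl B" and Y: "particle_solution M Fl B \<tau> (drift_sm \<delta>) diffusion_sm Y"
    and pos: "positive_before M \<tau> (\<lambda>t \<omega>. second_moment (empirical (Y t \<omega>)))"
  show "sde_solution M Fl B \<tau> (bessel_drift \<delta>) (\<lambda>z. mat 1) (\<lambda>t \<omega>. second_moment (empirical (Y t \<omega>)))"
    unfolding sde_solution_def
  proof (rule ito_differential_of_components)
    fix j
    let ?S = "\<lambda>t \<omega>. second_moment (empirical (Y t \<omega>)) $ j"
    have "scalar_ito M Fl B \<tau> (\<lambda>t \<omega>. Y t \<omega> $ i $ j) (\<lambda>t \<omega>. drift_sm \<delta> (Y t \<omega> $ i) (empirical (Y t \<omega>)) $ j)
        (\<lambda>k t \<omega>. diffusion_sm (Y t \<omega> $ i) (empirical (Y t \<omega>)) $ j $ k)" for i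
    proof (rule scalar_ito_component)
      show "ito_differential M Fl B \<tau> (\<lambda>t \<omega>. Y t \<omega> $ i) (\<lambda>t \<omega>. drift_sm \<delta> (Y t \<omega> $ i) (empirical (Y t \<omega>)))
        (\<lambda>t \<omega>. diffusion_sm (Y t \<omega> $ i) (empirical (Y t \<omega>)))" using Y by (simp add: particle_solution_def)
      from particle_solution_continuous[OF Y] pos[unfolded positive_before_def]
      show "AE \<omega> in M. continuous_on (lifetime \<tau> \<omega>) (\<lambda>t. drift_sm \<delta> (Y t \<omega> $ i) (empirical (Y t \<omega>)) $ j) \<and>
        (\<forall>k. continuous_on (lifetime \<tau> \<omega>) (\<lambda>t. diffusion_sm (Y t \<omega> $ i) (empirical (Y t \<omega>)) $ j $ k))"
      proof eventually_elim
        case (elim \<omega>)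
        let ?D = "lifetime \<tau> \<omega>"
        have Yc: "continuous_on ?D (\<lambda>t. Y t \<omega> $ i $ j)" for i using elim(1) by blast
        have Sc: "continuous_on ?D (\<lambda>t. ?S t \<omega>)"
          unfolding second_moment_empirical by (intro continuous_intros Yc)
        have S0: "?S t \<omega> \<noteq> 0" if "t \<in> ?D" for t using elim(2) that by (metis mem_Collect_eq less_irrefl)
        have "continuous_on ?D (\<lambda>t. (\<delta> - 3/2) * (Y t \<omega> $ i $ j / (4 * (?S t \<omega>)\<^sup>2)))"
          using S0 by (intro continuous_intros Yc Sc) auto
        moreover have "continuous_on ?D (\<lambda>t. Y t \<omega> $ i $ j / (2 * ?S t \<omega>))"
          using S0 by (intro continuous_intros Yc Sc) auto
        then have "continuous_on ?D (\<lambda>t. if j = k then Y t \<omega> $ i $ j / (2 * ?S t \<omega>) else 0)" for k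
          by (cases "j = k") simp_all
        ultimately show ?case by (simp add: drift_sm_def diffusion_sm_def Diag_def cong: if_cong)
      qed
    qed
    then have x: "scalar_ito M Fl B \<tau> (\<lambda>t \<omega>. Y t \<omega> $ i $ j) (\<lambda>t \<omega>. (\<delta> - 3/2) * (Y t \<omega> $ i $ j / (4 * (?S t \<omega>)\<^sup>2)))
        (\<lambda>k t \<omega>. if k = j then Y t \<omega> $ i $ j / (2 * ?S t \<omega>) else 0)" for i
      by (rule scalar_ito_cong) (auto simp: drift_sm_def diffusion_sm_def Diag_def)
    have "scalar_ito M Fl B \<tau> ?S (\<lambda>t \<omega>. (\<delta> - 1) / (2 * ?S t \<omega>)) (\<lambda>k t \<omega>. if k = j then 1 else 0)"
      unfolding second_moment_empirical
    proof (rule scalar_ito_second_moment[OF filt B])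
      show "scalar_ito M Fl B \<tau> (\<lambda>t \<omega>. Y t \<omega> $ i $ j)
        (\<lambda>t \<omega>. (\<delta> - 3/2) * (Y t \<omega> $ i $ j / (4 * (\<Sum>i\<in>UNIV. 1 / real CARD('n) * (Y t \<omega> $ i $ j)\<^sup>2)\<^sup>2)))
        (\<lambda>k t \<omega>. if k = j then Y t \<omega> $ i $ j / (2 * (\<Sum>i\<in>UNIV. 1 / real CARD('n) * (Y t \<omega> $ i $ j)\<^sup>2)) else 0)" for i
        using x[of i] unfolding second_moment_empirical .
      from pos[unfolded positive_before_def]
      show "AE \<omega> in M. \<forall>t\<ge>0. ennreal t < \<tau> \<omega> \<longrightarrow> 0 < (\<Sum>i\<in>UNIV. 1 / real CARD('n) * (Y t \<omega> $ i $ j)\<^sup>2)"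
        by eventually_elim (metis second_moment_empirical)
    qed
    then show "scalar_ito M Fl B \<tau> ?S (\<lambda>t \<omega>. bessel_drift \<delta> (second_moment (empirical (Y t \<omega>))) $ j)
      (\<lambda>k t \<omega>. (mat 1 :: real^'d^'d) $ j $ k)"
      by (rule scalar_ito_cong) (auto simp: bessel_drift_def mat_def)
  qed
next
  note filt = assms(1)
  assume B: "brownian_motion M Fl B" and Y: "particle_solution M Fl B \<tau> (drift_var \<delta>) diffusion_var Y"
    and pos: "positive_before M \<tau> (\<lambda>t \<omega>. Var (empirical (Y t \<omega>)))"
  show "sde_solution M Fl B \<tau> (bessel_drift \<delta>) (\<lambda>z. mat 1) (\<lambda>t \<omega>. Var (empirical (Y t \<omega>)))"
    unfolding sde_solution_def
  proof (rule ito_differential_of_components)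
    fix j
    have \<sigma>: "diffusion_var x \<rho> $ j $ k = (if k = j then (x $ j - mean \<rho> $ j) / (2 * Var \<rho> $ j) else 0)" for x :: "real^'d" and \<rho> k
      by (auto simp: diffusion_var_def Diag_def)
    show "scalar_ito M Fl B \<tau> (\<lambda>t \<omega>. Var (empirical (Y t \<omega>)) $ j) (\<lambda>t \<omega>. bessel_drift \<delta> (Var (empirical (Y t \<omega>))) $ j)
      (\<lambda>k t \<omega>. (mat 1 :: real^'d^'d) $ j $ k)"
      by (rule scalar_ito_cong[OF particle_mean_variance(2)[OF filt B Y pos \<sigma>]]) (auto simp: bessel_drift_def mat_def)
  qed
next
  note filt = assms(1)
  assume B2: "brownian_motion M Fl B2"
    and Y: "particle_solution M Fl B2 \<tau> (drift_var \<delta>) (\<lambda>x \<rho>. hblock (mat 1) (diffusion_var x \<rho>)) Y"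
    and pos: "positive_before M \<tau> (\<lambda>t \<omega>. Var (empirical (Y t \<omega>)))"
  show "sde_solution M Fl B2 \<tau> (\<lambda>z. concat_vec 0 (bessel_drift \<delta> (second_block z))) (\<lambda>z. mat 1)
      (\<lambda>t \<omega>. mean_var (empirical (Y t \<omega>)))"
    unfolding sde_solution_def
  proof (rule ito_differential_of_components)
    fix l :: "'d + 'd"
    \<comment> \<open>Row \<open>j\<close> of the block matrix: column \<open>Inr j\<close> carries
      the centred coefficient, and the identity block becomes the common noise \<open>h\<close>,
      which acts on the mean.\<close>
    have \<sigma>: "hblock (mat 1) (diffusion_var x \<rho>) $ j $ k = (if k = Inr j then (x $ j - mean \<rho> $ j) / (2 * Var \<rho> $ j)
        else (case k of Inl i \<Rightarrow> if j = i then 1 else 0 | Inr i \<Rightarrow> 0))" for x :: "real^'d" and \<rho> j k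
      by (cases k) (auto simp: hblock_def concat_vec_def diffusion_var_def Diag_def mat_def)
    note * = particle_mean_variance[OF filt B2 Y pos \<sigma>]
    show "scalar_ito M Fl B2 \<tau> (\<lambda>t \<omega>. mean_var (empirical (Y t \<omega>)) $ l)
      (\<lambda>t \<omega>. concat_vec 0 (bessel_drift \<delta> (second_block (mean_var (empirical (Y t \<omega>))))) $ l)
      (\<lambda>k t \<omega>. (mat 1 :: real^('d + 'd)^('d + 'd)) $ l $ k)"
    proof (cases l)
      case (Inl j)
      have X: "(\<lambda>t \<omega>. mean_var (empirical (Y t \<omega>)) $ l) = (\<lambda>t \<omega>. mean (empirical (Y t \<omega>)) $ j)"
        by (simp add: mean_var_def concat_vec_def Inl)
      show ?thesis unfolding X
        by (rule scalar_ito_cong[OF *(1)[of j]]) (auto simp: concat_vec_def mat_def Inl split: sum.split)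
    next
      case (Inr j)
      have X: "(\<lambda>t \<omega>. mean_var (empirical (Y t \<omega>)) $ l) = (\<lambda>t \<omega>. Var (empirical (Y t \<omega>)) $ j)"
        by (simp add: mean_var_def concat_vec_def Inr)
      show ?thesis unfolding X
        by (rule scalar_ito_cong[OF *(2)[of j]])
           (auto simp: concat_vec_def mat_def Inr mean_var_def second_block_def bessel_drift_def)
    qed
  qed
qed

end
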